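(* For every real $C>1$ there exists a constant $\varepsilon>0$ such that for all sufficiently large positive integers $\ell$, \[R(\ell, C\ell)\geq \big(p_C^{-1/2}+\varepsilon\big)^\ell,\] where $p_C\in(0,1/2)$ is the unique solution of the equation $C=\frac{\log p_C}{\log(1-p_C)}$.
   Context: For positive integers $\ell,k$, the Ramsey number $R(\ell,k)$ is the smallest integer $n$ such that every red/blue colouring of the edges of the complete graph $K_n$ contains either a red copy of $K_\ell$ (all edges red) or a blue copy of $K_k$ (all edges blue). In the statement $C\ell$ is used as the second argument of $R$, as printed in the paper. *)

theory Defs
  imports Complex_Main
begin

text \<open>A red/blue colouring of the edges of the complete graph on vertex set {..<n}
  is a function on 2-element vertex sets; True means red, False means blue.\<close>

definition mono_clique :: "(nat set \<Rightarrow> bool) \<Rightarrow> bool \<Rightarrow> nat \<Rightarrow> nat \<Rightarrow> bool" where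
  "mono_clique c col n k \<longleftrightarrow>
     (\<exists>S. S \<subseteq> {..<n} \<and> card S = k \<and>
          (\<forall>x\<in>S. \<forall>y\<in>S. x \<noteq> y \<longrightarrow> c {x, y} = col))"

definition ramsey_prop :: "nat \<Rightarrow> nat \<Rightarrow> nat \<Rightarrow> bool" where
  "ramsey_prop l k n \<longleftrightarrow>
     (\<forall>c :: nat set \<Rightarrow> bool. mono_clique c True n l \<or> mono_clique c False n k)"

definition ramsey_number :: "nat \<Rightarrow> nat \<Rightarrow> nat" where
  "ramsey_number l k = (LEAST n. ramsey_prop l k n)"

end

theory Submission
  imports Defs "HOL-Probability.Probability" "HOL-Library.Ramsey"
begin

text \<open>
  Attach to every vertex an independent standard Gaussian vector in \<open>d\<close> dimensions, conditioned on
  having almost the expected norm, where \<open>d\<close> is a constant times the square of the clique size.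
  With \<open>g = \<langle>x, y\<rangle> / sqrt d\<close>, colour the edge between \<open>x\<close> and \<open>y\<close> red with probability \<open>p (1 - t g)\<close>,
  clipped to the unit interval, for a small constant \<open>t\<close>. The three inner products along a triangle
  are positively correlated at third order, so that red cliques on \<open>l\<close> vertices become rarer and blue
  cliques more frequent than in the binomial random graph, each by a factor that is exponential in
  the square of \<open>l\<close>. The two exponents are in the ratio of the cubes of \<open>1 / p\<close> and \<open>C / (1 - p)\<close>.
  As \<open>C p\<^sup>2 < (1 - p)\<^sup>2\<close>, a slight increase of \<open>p\<close> turns this into a gain for both colours.

  The expected number of cliques is bounded by eliminating one vertex after the other. A red or blue edge has
  probability proportional to at most \<open>max 0 (1 + b g)\<close>, with \<open>b < 0\<close> for red and \<open>b > 0\<close> for blue; this is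
  dominated by a mixture of exponentials of quadratic polynomials in \<open>g\<close>. Integrating out a Gaussian vertex
  keeps the product in this class but moves the slope \<open>b\<close> to \<open>b + b\<^sup>2 / sqrt d\<close>, and the accumulated
  change of \<open>b\<^sup>2\<close> is the cubic term.
\<close>

section \<open>Gaussian integrals\<close>

text \<open>Per pair, averaging \<open>exp (b * g)\<close> adds \<open>b\<^sup>2 / 2\<close> to the
  exponent, far more than the gain at third order; the concavity of the logarithm of
  \<open>1 + b * g\<close> has to cancel it almost exactly. Hence every relative error at second
  order, including that of the norms, must be small against \<open>b * k / s\<close>, where
  \<open>s = sqrt d\<close> and \<open>k\<close> is the clique size. A triangle contributes
  \<open>b ^ 3 / s\<close>, since its three values of \<open>g\<close> have a product of mean
  \<open>1 / s\<close>. The number of triangles divided by \<open>s\<close> is of the order of the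
  square of \<open>l\<close> when \<open>d\<close> is.

  Let \<open>r = p / (1 - p)\<close> and let \<open>\<Delta> * l\<^sup>2\<close> be the red gain in
  the exponent. Blue cliques have \<open>C * l\<close> vertices and slope \<open>r * t\<close>, so
  in the same unit blue loses \<open>C ^ 3 * r ^ 3 * \<Delta>\<close>. Multiplying \<open>p\<close>
  by \<open>exp (2 * N)\<close> costs red \<open>N\<close> and gives blue about
  \<open>C\<^sup>2 * r * N\<close>. Both colours gain if \<open>N\<close> lies strictly between
  \<open>C * r\<^sup>2 * \<Delta>\<close> and \<open>\<Delta>\<close>, which is possible exactly
  when \<open>C * r\<^sup>2 < 1\<close>.\<close>

definition std_gauss :: "real measure" where
  "std_gauss = density lborel std_normal_density"

lemma prob_space_std_gauss: "prob_space std_gauss"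
  unfolding std_gauss_def by (rule prob_space_normal_density) simp

lemma sets_std_gauss [measurable_cong, simp]: "sets std_gauss = sets borel"
  by (simp add: std_gauss_def)

lemma space_std_gauss [simp]: "space std_gauss = UNIV"
  by (simp add: std_gauss_def)

lemma nn_integral_std_gauss_exp:
  assumes "q > -1/2"
  shows "(\<integral>\<^sup>+x. ennreal (exp (b * x - q * x\<^sup>2)) \<partial>std_gauss)
           = ennreal (exp (b\<^sup>2 / (2 * (1 + 2*q))) / sqrt (1 + 2*q))"
proof -
  define D where "D = 1 + 2*q"
  have D: "D > 0" using assms by (simp add: D_def)
  have q: "q = (D - 1) / 2" by (simp add: D_def)
  define c where "c = exp (b\<^sup>2 / (2 * D)) / sqrt D"
  have eq: "std_normal_density x * exp (b * x - q * x\<^sup>2) = c * normal_density (b / D) (1 / sqrt D) x" for x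
  proof -
    have *: "- x\<^sup>2 / 2 + (b * x - q * x\<^sup>2) = b\<^sup>2 / (2 * D) + - (x - b / D)\<^sup>2 / (2 * (1 / sqrt D)\<^sup>2)"
      using D unfolding q by (simp add: power_divide power2_eq_square field_simps)
    have "exp (- x\<^sup>2 / 2) * exp (b * x - q * x\<^sup>2)
        = exp (b\<^sup>2 / (2 * D)) * exp (- (x - b / D)\<^sup>2 / (2 * (1 / sqrt D)\<^sup>2))"
      by (simp only: exp_add [symmetric] *)
    then have "std_normal_density x * exp (b * x - q * x\<^sup>2)
        = 1 / sqrt (2 * pi) * (exp (b\<^sup>2 / (2 * D)) * exp (- (x - b / D)\<^sup>2 / (2 * (1 / sqrt D)\<^sup>2)))"
      by (simp add: std_normal_density_def)
    also have "\<dots> = c * normal_density (b / D) (1 / sqrt D) x"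
    proof -
      have "sqrt (2 * pi * (1 / sqrt D)\<^sup>2) = sqrt (2*pi) / sqrt D"
        using D by (simp add: power_divide real_sqrt_divide)
      then show ?thesis
        using D by (simp add: normal_density_def c_def)
    qed
    finally show ?thesis .
  qed
  have "(\<integral>\<^sup>+x. ennreal (exp (b * x - q * x\<^sup>2)) \<partial>std_gauss)
      = (\<integral>\<^sup>+x. ennreal (std_normal_density x) * ennreal (exp (b * x - q * x\<^sup>2)) \<partial>lborel)"
    unfolding std_gauss_def by (subst nn_integral_density) auto
  also have "\<dots> = (\<integral>\<^sup>+x. ennreal c * ennreal (normal_density (b / D) (1 / sqrt D) x) \<partial>lborel)"
    using D by (intro nn_integral_cong) (simp add: ennreal_mult'[symmetric] eq c_def)
  also have "\<dots> = ennreal c * (\<integral>\<^sup>+x. ennreal (normal_density (b / D) (1 / sqrt D) x) \<partial>lborel)"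
    by (subst nn_integral_cmult) auto
  also have "(\<integral>\<^sup>+x. ennreal (normal_density (b / D) (1 / sqrt D) x) \<partial>lborel) = 1"
  proof -
    interpret prob_space "density lborel (normal_density (b / D) (1 / sqrt D))"
      using D by (intro prob_space_normal_density) auto
    show ?thesis using emeasure_space_1 by (simp add: emeasure_density)
  qed
  finally show ?thesis by (simp add: c_def D_def)
qed

text \<open>This is the logarithm of the factor \<open>1 / sqrt (1 + 2 * q)\<close> of a Gaussian
  integral, expanded to second order. Its matrix analogue bounds the determinant factor by the
  traces of \<open>Q\<close> and of its square, the two sums in the next theorem.\<close>

lemma neg_half_ln_one_plus_le:
  assumes "(q::real) \<ge> 0" shows "- ln (1 + 2*q) / 2 \<le> - q + q\<^sup>2"
proof -
  have "- ln (1 + 2 * q) / 2 - (- q + q\<^sup>2) \<le> - ln (1 + 2 * 0) / 2 - (- 0 + 0\<^sup>2)"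
    using assms
  proof (rule DERIV_nonpos_imp_nonincreasing)
    fix x :: real assume x: "0 \<le> x" "x \<le> q"
    have "((\<lambda>q. - ln (1 + 2 * q) / 2 - (- q + q\<^sup>2)) has_real_derivative (- (2 / (1 + 2 * x)) / 2 - (- 1 + 2 * x))) (at x)"
      using x by (auto intro!: derivative_eq_intros simp: field_simps)
    moreover have "- (2 / (1 + 2 * x)) / 2 - (- 1 + 2 * x) \<le> 0"
      using x by (simp add: field_simps)
    ultimately show "\<exists>y. ((\<lambda>q. - ln (1 + 2 * q) / 2 - (- q + q\<^sup>2)) has_real_derivative y) (at x) \<and> y \<le> 0"
      by blast
  qed
  then show ?thesis by simp
qed

text \<open>
  The hypothesis on \<open>K\<close> bounds the supremum of the exponent together with the Gaussian weight. Unlike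
  the closed form of this supremum, which involves the inverse of \<open>1 + 2 Q\<close>, it passes directly to the
  remaining variables when one variable is integrated out.
\<close>

theorem gaussian_quadratic_bound:
  fixes Q :: "'i \<Rightarrow> 'i \<Rightarrow> real"
  assumes "finite I"
    and sym: "\<And>i j. i \<in> I \<Longrightarrow> j \<in> I \<Longrightarrow> Q i j = Q j i"
    and psd: "\<And>z. 0 \<le> (\<Sum>i\<in>I. \<Sum>j\<in>I. Q i j * z i * z j)"
    and K: "\<And>z. (\<Sum>i\<in>I. b i * z i) - (\<Sum>i\<in>I. (z i)\<^sup>2) / 2 - (\<Sum>i\<in>I. \<Sum>j\<in>I. Q i j * z i * z j) \<le> K"
  shows "(\<integral>\<^sup>+x. ennreal (exp ((\<Sum>i\<in>I. b i * x i) - (\<Sum>i\<in>I. \<Sum>j\<in>I. Q i j * x i * x j)))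
             \<partial>Pi\<^sub>M I (\<lambda>_. std_gauss))
         \<le> ennreal (exp (K - (\<Sum>i\<in>I. Q i i) + (\<Sum>i\<in>I. \<Sum>j\<in>I. (Q i j)\<^sup>2)))"
  using assms
proof (induction I arbitrary: b Q K rule: finite_induct)
  case empty
  interpret prob_space "Pi\<^sub>M {} (\<lambda>_::'i. std_gauss)"
    by (intro prob_space_PiM prob_space_std_gauss)
  have "ennreal 1 \<le> ennreal (exp K)"
    using empty(3)[of undefined] by (intro ennreal_leI) simp
  then show ?case using emeasure_space_1 by simp
next
  case (insert i I)
  interpret G: prob_space std_gauss by (rule prob_space_std_gauss)
  interpret product_sigma_finite "\<lambda>_::'i. std_gauss" ..
  define q v where "q = Q i i" and "v = Q i"
  define D where "D = 1 + 2 * q"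
  define lin where "lin = (\<lambda>x. \<Sum>j\<in>I. v j * x j)"
  define F where "F = (\<lambda>x. \<Sum>j\<in>I. \<Sum>k\<in>I. Q j k * x j * x k)"
  \<comment> \<open>These come from completing the square in coordinate \<open>i\<close>. With the
    Gaussian weight included, the matrix of the exponent is half of \<open>1 + 2 Q\<close>, and
    \<open>1 + 2 Q'\<close> is the Schur complement of \<open>D\<close> in it.\<close>
  define b' where "b' = (\<lambda>j. b j - 2 * b i * v j / D)"
  define Q' where "Q' = (\<lambda>j k. Q j k - 2 * v j * v k / D)"
  define F' where "F' = (\<lambda>x. \<Sum>j\<in>I. \<Sum>k\<in>I. Q' j k * x j * x k)"
  have ne: "j \<in> I \<Longrightarrow> j \<noteq> i" for j using insert by auto
  have upd: "(\<Sum>j\<in>I. f j ((x(i := y)) j)) = (\<Sum>j\<in>I. f j (x j))" for f :: "'i \<Rightarrow> real \<Rightarrow> real" and x y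
    by (intro sum.cong) (auto simp: ne)
  have symv: "Q j i = v j" if "j \<in> I" for j
    using insert(4)[of i j] that by (simp add: v_def)
  have full: "(\<Sum>j\<in>insert i I. \<Sum>k\<in>insert i I. Q j k * (x(i := y)) j * (x(i := y)) k)
      = q * y\<^sup>2 + 2 * y * lin x + F x" for x y
  proof -
    have "(\<Sum>j\<in>insert i I. \<Sum>k\<in>insert i I. Q j k * (x(i := y)) j * (x(i := y)) k)
        = q * y * y + (\<Sum>k\<in>I. Q i k * y * x k) + (\<Sum>j\<in>I. Q j i * x j * y + (\<Sum>k\<in>I. Q j k * x j * x k))"
    proof -
      have "(\<Sum>k\<in>I. Q j k * z * (x(i := y)) k) = (\<Sum>k\<in>I. Q j k * z * x k)" for j z
        by (intro sum.cong) (auto simp: ne)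
      moreover have "(\<Sum>j\<in>I. Q j i * (x(i := y)) j * y + (\<Sum>k\<in>I. Q j k * (x(i := y)) j * x k))
          = (\<Sum>j\<in>I. Q j i * x j * y + (\<Sum>k\<in>I. Q j k * x j * x k))"
        by (intro sum.cong) (auto simp: ne)
      ultimately show ?thesis using insert(1,2) by (simp add: q_def)
    qed
    also have "(\<Sum>j\<in>I. Q j i * x j * y + (\<Sum>k\<in>I. Q j k * x j * x k)) = y * lin x + F x"
      by (simp add: sum.distrib F_def lin_def sum_distrib_left symv mult_ac cong: sum.cong)
    also have "(\<Sum>k\<in>I. Q i k * y * x k) = y * lin x"
      by (simp add: lin_def v_def sum_distrib_left mult_ac)
    finally show ?thesis by (simp add: power2_eq_square algebra_simps)
  qed
  have "0 \<le> q"
    using insert(5)[of "(\<lambda>_. 0)(i := 1)"] by (simp only: full) (simp add: lin_def F_def)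
  then have D: "D \<ge> 1" by (simp add: D_def)
  have F': "F' x = F x - 2 * (lin x)\<^sup>2 / D" for x
  proof -
    have "F' x = F x - (\<Sum>j\<in>I. \<Sum>k\<in>I. (2 / D) * ((v j * x j) * (v k * x k)))"
      unfolding F'_def F_def Q'_def by (simp add: sum_subtractf algebra_simps)
    also have "(\<Sum>j\<in>I. \<Sum>k\<in>I. (2 / D) * ((v j * x j) * (v k * x k))) = 2 * (lin x)\<^sup>2 / D"
      by (simp only: power2_eq_square lin_def sum_product sum_distrib_left [symmetric]) simp
    finally show ?thesis .
  qed
  have b': "(\<Sum>j\<in>I. b' j * x j) = (\<Sum>j\<in>I. b j * x j) - 2 * b i * lin x / D" for x
    unfolding b'_def lin_def by (simp add: algebra_simps sum_subtractf sum_distrib_left sum_divide_distrib)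
  have Fnn: "0 \<le> F x" for x
    using insert(5)[of "x(i := 0)"] by (simp only: full) simp
  have F'nn: "0 \<le> F' x" for x
  proof -
    \<comment> \<open>The minimiser of the full form with \<open>y\<^sup>2 / 2\<close> added; the
      minimum is \<open>F' x\<close>, which is therefore nonnegative.\<close>
    define y where "y = - 2 * lin x / D"
    have "0 \<le> q * y\<^sup>2 + 2 * y * lin x + F x"
      using insert(5)[of "x(i := y)"] by (simp only: full)
    also have "\<dots> \<le> F x + 2 * y * lin x + (q + 1/2) * y\<^sup>2"
      by (simp add: algebra_simps)
    also have "q + 1/2 = D / 2" by (simp add: D_def)
    also have "F x + 2 * y * lin x + D / 2 * y\<^sup>2 = F' x"
      using D unfolding F' y_def by (simp add: power2_eq_square field_simps)
    finally show ?thesis .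
  qed
  have K': "(\<Sum>j\<in>I. b' j * x j) - (\<Sum>j\<in>I. (x j)\<^sup>2) / 2 - F' x \<le> K - (b i)\<^sup>2 / (2 * D)" for x
  proof -
    \<comment> \<open>The maximiser over the eliminated coordinate. At this point the bound
      \<open>K\<close> gives up exactly the constant \<open>(b i)\<^sup>2 / (2 * D)\<close> that the
      inner integral produces.\<close>
    define y where "y = (b i - 2 * lin x) / D"
    have "(\<Sum>j\<in>insert i I. b j * (x(i := y)) j) = b i * y + (\<Sum>j\<in>I. b j * x j)"
      using insert(1,2) upd[of "\<lambda>j z. b j * z"] by simp
    moreover have "(\<Sum>j\<in>insert i I. ((x(i := y)) j)\<^sup>2) = y\<^sup>2 + (\<Sum>j\<in>I. (x j)\<^sup>2)"
      using insert(1,2) upd[of "\<lambda>j z. z\<^sup>2"] by simp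
    ultimately have "b i * y + (\<Sum>j\<in>I. b j * x j) - (y\<^sup>2 + (\<Sum>j\<in>I. (x j)\<^sup>2)) / 2
        - (q * y\<^sup>2 + 2 * y * lin x + F x) \<le> K"
      using insert(6)[of "x(i := y)"] by (simp only: full)
    moreover have "b i * y - y\<^sup>2 / 2 - (q * y\<^sup>2 + 2 * y * lin x) = (b i - 2 * lin x)\<^sup>2 / (2 * D)"
    proof -
      have "b i * y - y\<^sup>2 / 2 - (q * y\<^sup>2 + 2 * y * lin x) = (b i - 2 * lin x) * y - D / 2 * y\<^sup>2"
        by (simp add: D_def algebra_simps add_divide_distrib)
      also have "\<dots> = (b i - 2 * lin x)\<^sup>2 / (2 * D)"
        using D by (simp add: y_def power2_eq_square)
      finally show ?thesis .
    qed
    moreover have "(b i - 2 * lin x)\<^sup>2 / (2 * D) = (b i)\<^sup>2 / (2 * D) - 2 * b i * lin x / D + 2 * (lin x)\<^sup>2 / D"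
      using D by (simp add: power2_eq_square field_simps)
    ultimately show ?thesis unfolding b' F' by (simp add: add_divide_distrib)
  qed
  have inner: "(\<integral>\<^sup>+y. ennreal (exp ((\<Sum>j\<in>insert i I. b j * (x(i := y)) j)
        - (\<Sum>j\<in>insert i I. \<Sum>k\<in>insert i I. Q j k * (x(i := y)) j * (x(i := y)) k))) \<partial>std_gauss)
      = ennreal (exp ((b i)\<^sup>2 / (2 * D) - ln D / 2)) * ennreal (exp ((\<Sum>j\<in>I. b' j * x j) - F' x))" for x
  proof -
    have "(\<Sum>j\<in>insert i I. b j * (x(i := y)) j) = b i * y + (\<Sum>j\<in>I. b j * x j)" for y
      using insert(1,2) upd[of "\<lambda>j z. b j * z"] by simp
    then have "(\<integral>\<^sup>+y. ennreal (exp ((\<Sum>j\<in>insert i I. b j * (x(i := y)) j)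
        - (\<Sum>j\<in>insert i I. \<Sum>k\<in>insert i I. Q j k * (x(i := y)) j * (x(i := y)) k))) \<partial>std_gauss)
      = (\<integral>\<^sup>+y. ennreal (exp ((\<Sum>j\<in>I. b j * x j) - F x)) * ennreal (exp ((b i - 2 * lin x) * y - q * y\<^sup>2)) \<partial>std_gauss)"
      by (intro nn_integral_cong) (simp only: full, simp add: ennreal_mult'[symmetric] exp_add[symmetric] algebra_simps)
    also have "\<dots> = ennreal (exp ((\<Sum>j\<in>I. b j * x j) - F x)) * ennreal (exp ((b i - 2 * lin x)\<^sup>2 / (2 * D)) / sqrt D)"
      using \<open>0 \<le> q\<close> by (subst nn_integral_cmult) (auto simp: nn_integral_std_gauss_exp D_def)
    also have "\<dots> = ennreal (exp ((\<Sum>j\<in>I. b j * x j) - F x + (b i - 2 * lin x)\<^sup>2 / (2 * D) - ln D / 2))"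
    proof -
      have "sqrt D = exp (ln D / 2)" using D by (simp add: ln_sqrt[symmetric])
      then show ?thesis by (simp add: ennreal_mult'[symmetric] exp_add exp_diff)
    qed
    also have "(\<Sum>j\<in>I. b j * x j) - F x + (b i - 2 * lin x)\<^sup>2 / (2 * D) - ln D / 2
        = ((b i)\<^sup>2 / (2 * D) - ln D / 2) + ((\<Sum>j\<in>I. b' j * x j) - F' x)"
      using D unfolding b' F' by (simp add: power2_eq_square field_simps)
    finally show ?thesis by (simp add: ennreal_mult'[symmetric] exp_add)
  qed
  have "(\<integral>\<^sup>+x. ennreal (exp ((\<Sum>j\<in>insert i I. b j * x j) - (\<Sum>j\<in>insert i I. \<Sum>k\<in>insert i I. Q j k * x j * x k)))
             \<partial>Pi\<^sub>M (insert i I) (\<lambda>_. std_gauss))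
      = (\<integral>\<^sup>+x. ennreal (exp ((b i)\<^sup>2 / (2 * D) - ln D / 2)) * ennreal (exp ((\<Sum>j\<in>I. b' j * x j) - F' x)) \<partial>Pi\<^sub>M I (\<lambda>_. std_gauss))"
    by (subst product_nn_integral_insert[OF insert(1,2)]) (measurable, simp only: inner)
  also have "\<dots> = ennreal (exp ((b i)\<^sup>2 / (2 * D) - ln D / 2)) * (\<integral>\<^sup>+x. ennreal (exp ((\<Sum>j\<in>I. b' j * x j) - F' x)) \<partial>Pi\<^sub>M I (\<lambda>_. std_gauss))"
    unfolding F'_def by (subst nn_integral_cmult) auto
  also have "\<dots> \<le> ennreal (exp ((b i)\<^sup>2 / (2 * D) - ln D / 2))
      * ennreal (exp (K - (b i)\<^sup>2 / (2 * D) - (\<Sum>j\<in>I. Q' j j) + (\<Sum>j\<in>I. \<Sum>k\<in>I. (Q' j k)\<^sup>2)))"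
    unfolding F'_def
  proof (intro mult_left_mono insert.IH)
    show "Q' j k = Q' k j" if "j \<in> I" "k \<in> I" for j k
      using that insert(4)[of j k] by (simp add: Q'_def)
  qed (use F'nn K' in \<open>auto simp: F'_def\<close>)
  also have "\<dots> = ennreal (exp (K - ln D / 2 - (\<Sum>j\<in>I. Q' j j) + (\<Sum>j\<in>I. \<Sum>k\<in>I. (Q' j k)\<^sup>2)))"
    by (simp add: ennreal_mult'[symmetric] exp_add[symmetric])
  also have "\<dots> \<le> ennreal (exp (K - (\<Sum>j\<in>insert i I. Q j j) + (\<Sum>j\<in>insert i I. \<Sum>k\<in>insert i I. (Q j k)\<^sup>2)))"
  proof (intro ennreal_leI exp_le_cancel_iff[THEN iffD2])
    \<comment> \<open>Passing to \<open>Q'\<close> lowers the trace by \<open>2 * V / D\<close>, and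
      the off-diagonal squares in row and column \<open>i\<close>, which sum to
      \<open>2 * V\<close>, pay for this. The other squares only shrink: their sum drops by
      \<open>2 / D\<close> times the values at \<open>v\<close> of the two positive semidefinite
      forms of \<open>Q\<close> and \<open>Q'\<close>.\<close>
    define V where "V = (\<Sum>j\<in>I. (v j)\<^sup>2)"
    have V: "V \<ge> 0" by (simp add: V_def sum_nonneg)
    have tr: "(\<Sum>j\<in>I. Q' j j) = (\<Sum>j\<in>I. Q j j) - 2 * V / D"
      by (simp add: Q'_def V_def sum_subtractf sum_distrib_left sum_divide_distrib power2_eq_square mult_ac)
    have "(\<Sum>j\<in>I. \<Sum>k\<in>I. (Q j k)\<^sup>2) - (\<Sum>j\<in>I. \<Sum>k\<in>I. (Q' j k)\<^sup>2)
        = (\<Sum>j\<in>I. \<Sum>k\<in>I. (2 / D) * (Q j k * v j * v k + Q' j k * v j * v k))"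
      unfolding sum_subtractf[symmetric] by (intro sum.cong refl) (simp add: Q'_def power2_eq_square algebra_simps)
    also have "\<dots> = (2 / D) * (F v + F' v)"
      by (simp only: F_def F'_def sum_distrib_left sum.distrib distrib_left)
    also have "\<dots> \<ge> 0" using D Fnn F'nn by simp
    finally have sq: "(\<Sum>j\<in>I. \<Sum>k\<in>I. (Q' j k)\<^sup>2) \<le> (\<Sum>j\<in>I. \<Sum>k\<in>I. (Q j k)\<^sup>2)" by simp
    have full2: "(\<Sum>j\<in>insert i I. \<Sum>k\<in>insert i I. (Q j k)\<^sup>2) = q\<^sup>2 + 2 * V + (\<Sum>j\<in>I. \<Sum>k\<in>I. (Q j k)\<^sup>2)"
      using insert(1,2) by (simp add: sum.distrib symv V_def q_def v_def cong: sum.cong)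
    have "2 * V / D \<le> 2 * V" using D V by (simp add: divide_le_eq mult_le_cancel_left1)
    moreover have "- ln D / 2 \<le> - q + q\<^sup>2" unfolding D_def by (rule neg_half_ln_one_plus_le) fact
    ultimately show "K - ln D / 2 - (\<Sum>j\<in>I. Q' j j) + (\<Sum>j\<in>I. \<Sum>k\<in>I. (Q' j k)\<^sup>2)
        \<le> K - (\<Sum>j\<in>insert i I. Q j j) + (\<Sum>j\<in>insert i I. \<Sum>k\<in>insert i I. (Q j k)\<^sup>2)"
      using insert(1,2) sq unfolding full2 tr by (simp add: q_def)
  qed
  finally show ?case .
qed

section \<open>Sums over the pairs of a vertex set\<close>

definition pairs :: "nat set \<Rightarrow> (nat \<times> nat) set" where
  "pairs S = {(i, j). i \<in> S \<and> j \<in> S \<and> i < j}"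

lemma finite_pairs [simp]: "finite S \<Longrightarrow> finite (pairs S)"
  by (rule finite_subset[of _ "S \<times> S"]) (auto simp: pairs_def)

lemma pairs_empty [simp]: "pairs {} = {}"
  by (simp add: pairs_def)

lemma pairs_insert_max:
  assumes "\<And>i. i \<in> S \<Longrightarrow> i < m"
  shows "pairs (insert m S) = pairs S \<union> (\<lambda>i. (i, m)) ` S"
  using assms by (force simp: pairs_def)

lemma sum_pairs_insert_max:
  fixes f :: "nat \<Rightarrow> nat \<Rightarrow> real"
  assumes "finite S" "\<And>i. i \<in> S \<Longrightarrow> i < m"
  shows "(\<Sum>(i,j)\<in>pairs (insert m S). f i j) = (\<Sum>(i,j)\<in>pairs S. f i j) + (\<Sum>i\<in>S. f i m)"
proof -
  have "pairs S \<inter> (\<lambda>i. (i, m)) ` S = {}" using assms by (force simp: pairs_def)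
  moreover have "pairs (insert m S) = pairs S \<union> (\<lambda>i. (i, m)) ` S"
    by (rule pairs_insert_max) fact
  ultimately show ?thesis
    using assms(1) by (simp add: sum.union_disjoint sum.reindex inj_on_def)
qed

lemma sum_symmetric_pairs:
  fixes f :: "nat \<Rightarrow> nat \<Rightarrow> real"
  assumes "finite S" "\<And>i j. i \<in> S \<Longrightarrow> j \<in> S \<Longrightarrow> f i j = f j i"
  shows "(\<Sum>i\<in>S. \<Sum>j\<in>S. f i j) = (\<Sum>i\<in>S. f i i) + 2 * (\<Sum>(i,j)\<in>pairs S. f i j)"
  using assms
proof (induction S rule: finite_linorder_max_induct)
  case (insert m S)
  have [simp]: "m \<notin> S" using insert(2) by auto
  have "(\<Sum>i\<in>S. f m i) = (\<Sum>i\<in>S. f i m)"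
    using insert.prems by (intro sum.cong) auto
  then show ?case
    using insert by (simp add: sum.distrib sum_pairs_insert_max)
qed simp

lemma card_pairs:
  assumes "finite S" shows "2 * real (card (pairs S)) = real (card S) * (real (card S) - 1)"
proof -
  have "(\<Sum>i\<in>S. \<Sum>j\<in>S. 1) = (\<Sum>i\<in>S. 1) + 2 * (\<Sum>(i,j)\<in>pairs S. (1::real))"
    by (rule sum_symmetric_pairs) (use assms in auto)
  then show ?thesis using assms by (simp add: case_prod_beta algebra_simps)
qed

section \<open>Gaussian vectors conditioned on their norm\<close>

definition gauss_vec :: "nat \<Rightarrow> (nat \<Rightarrow> real) measure" where
  "gauss_vec d = Pi\<^sub>M {..<d} (\<lambda>_. std_gauss)"

definition ip :: "nat \<Rightarrow> (nat \<Rightarrow> real) \<Rightarrow> (nat \<Rightarrow> real) \<Rightarrow> real" where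
  "ip d x y = (\<Sum>m<d. x m * y m)"

definition shell :: "nat \<Rightarrow> real \<Rightarrow> (nat \<Rightarrow> real) set" where
  "shell d \<eta> = {x \<in> space (gauss_vec d). (1 - \<eta>) * d \<le> ip d x x \<and> ip d x x \<le> (1 + \<eta>) * d}"

text \<open>Restricting the space, rather than only the density, makes the norm bounds hold at every
  point of the space and not just almost everywhere.\<close>

definition shell_measure :: "nat \<Rightarrow> real \<Rightarrow> (nat \<Rightarrow> real) measure" where
  "shell_measure d \<eta> = density (restrict_space (gauss_vec d) (shell d \<eta>))
     (\<lambda>_. 1 / emeasure (gauss_vec d) (shell d \<eta>))"

lemma prob_space_gauss_vec: "prob_space (gauss_vec d)"
  unfolding gauss_vec_def by (intro prob_space_PiM prob_space_std_gauss)

lemma ip_commute: "ip d x y = ip d y x"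
  by (simp add: ip_def mult.commute)

lemma ip_measurable_gauss [measurable]: "ip d x \<in> borel_measurable (gauss_vec d)"
  unfolding ip_def gauss_vec_def by measurable

lemma ip_self_measurable_gauss [measurable]: "(\<lambda>x. ip d x x) \<in> borel_measurable (gauss_vec d)"
  unfolding ip_def gauss_vec_def by measurable

lemma shell_sets [measurable]: "shell d \<eta> \<in> sets (gauss_vec d)"
  unfolding shell_def by measurable

lemma ip_Cauchy_Schwarz: "(ip d x y)\<^sup>2 \<le> ip d x x * ip d y y"
  using Cauchy_Schwarz_ineq_sum[of x y "{..<d}"] by (simp add: ip_def power2_eq_square)

text \<open>The Laplace transform of a chi-square variable with \<open>d\<close> degrees of freedom.
  Negative \<open>q\<close> serves its upper tail, positive \<open>q\<close> its lower tail.\<close>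

lemma nn_integral_gauss_vec_exp_norm:
  assumes "q > -1/2"
  shows "(\<integral>\<^sup>+x. ennreal (exp (- q * ip d x x)) \<partial>gauss_vec d) = ennreal (exp (- real d * ln (1 + 2 * q) / 2))"
proof -
  interpret G: prob_space std_gauss by (rule prob_space_std_gauss)
  interpret product_sigma_finite "\<lambda>_::nat. std_gauss" ..
  have "(\<integral>\<^sup>+x. ennreal (exp (- q * ip d x x)) \<partial>gauss_vec d)
      = (\<integral>\<^sup>+x. (\<Prod>m<d. ennreal (exp (0 * x m - q * (x m)\<^sup>2))) \<partial>Pi\<^sub>M {..<d} (\<lambda>_. std_gauss))"
    unfolding gauss_vec_def
    by (intro nn_integral_cong) (simp add: prod_ennreal exp_sum[symmetric] ip_def sum_distrib_left
          sum_negf[symmetric] power2_eq_square)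
  also have "\<dots> = (\<Prod>m<d. (\<integral>\<^sup>+x. ennreal (exp (0 * x - q * x\<^sup>2)) \<partial>std_gauss))"
    by (rule product_nn_integral_prod) auto
  also have "\<dots> = ennreal ((1 / sqrt (1 + 2 * q)) ^ d)"
    by (subst nn_integral_std_gauss_exp[OF assms]) (use assms in \<open>simp add: ennreal_power[symmetric]\<close>)
  also have "1 / sqrt (1 + 2 * q) = exp (- ln (1 + 2 * q) / 2)"
  proof -
    have "sqrt (1 + 2 * q) = exp (ln (1 + 2 * q) / 2)" using assms by (simp add: ln_sqrt[symmetric])
    then show ?thesis by (simp add: exp_minus field_simps)
  qed
  finally show ?thesis by (simp add: exp_of_nat_mult[symmetric])
qed

lemma neg_half_ln_one_minus_le:
  assumes "0 \<le> (c::real)" "c \<le> 1/4" shows "- ln (1 - 2*c) / 2 \<le> c + 2 * c\<^sup>2"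
proof -
  have "- ln (1 - 2 * c) / 2 - (c + 2 * c\<^sup>2) \<le> - ln (1 - 2 * 0) / 2 - (0 + 2 * 0\<^sup>2)"
    using assms(1)
  proof (rule DERIV_nonpos_imp_nonincreasing)
    fix x :: real assume "0 \<le> x" "x \<le> c"
    then have x: "0 \<le> x" "x \<le> 1/4" using assms by auto
    have "((\<lambda>c. - ln (1 - 2 * c) / 2 - (c + 2 * c\<^sup>2)) has_real_derivative (- (- 2 / (1 - 2 * x)) / 2 - (1 + 4 * x))) (at x)"
      using x by (auto intro!: derivative_eq_intros simp: field_simps)
    moreover have "- (- 2 / (1 - 2 * x)) / 2 - (1 + 4 * x) \<le> 0"
    proof -
      have "0 \<le> x * (1/4 - x)" using x by simp
      then have "1 \<le> (1 + 4 * x) * (1 - 2 * x)" by (simp add: algebra_simps)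
      then show ?thesis using x by (simp add: field_simps)
    qed
    ultimately show "\<exists>y. ((\<lambda>c. - ln (1 - 2 * c) / 2 - (c + 2 * c\<^sup>2)) has_real_derivative y) (at x) \<and> y \<le> 0"
      by blast
  qed
  then show ?thesis by simp
qed

text \<open>Chernoff bounds for both tails of the squared norm. The parameters
  \<open>\<eta> / 4\<close> and \<open>\<eta> / 2\<close> minimise
  \<open>2 * c\<^sup>2 - c * \<eta>\<close> and \<open>c\<^sup>2 - c * \<eta>\<close>, the exponents
  per dimension after the logarithm has been estimated. The constant 16 brings each tail down to
  \<open>exp (- 2)\<close>, which is at most \<open>1/4\<close>.\<close>

lemma shell_emeasure_ge:
  assumes "0 < \<eta>" "\<eta> \<le> 1" "16 \<le> \<eta>\<^sup>2 * real d"
  shows "ennreal (1/2) \<le> emeasure (gauss_vec d) (shell d \<eta>)"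
proof -
  interpret prob_space "gauss_vec d" by (rule prob_space_gauss_vec)
  define U where "U = {x \<in> space (gauss_vec d). (1 + \<eta>) * d < ip d x x}"
  define L where "L = {x \<in> space (gauss_vec d). ip d x x < (1 - \<eta>) * d}"
  have [measurable]: "U \<in> sets (gauss_vec d)" "L \<in> sets (gauss_vec d)"
    unfolding U_def L_def by measurable
  have e: "exp (- 2) \<le> (1/4::real)"
  proof -
    have "2 \<le> exp (1::real)" using exp_ge_add_one_self[of 1] by simp
    then have "2 * 2 \<le> exp 1 * exp (1::real)" by (intro mult_mono) auto
    also have "\<dots> = exp 2" by (simp add: exp_add[symmetric])
    finally show ?thesis by (simp add: exp_minus field_simps)
  qed
  have U: "emeasure (gauss_vec d) U \<le> ennreal (1/4)"
  proof -
    define c where "c = \<eta> / 4"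
    have "emeasure (gauss_vec d) U = (\<integral>\<^sup>+x. indicator U x \<partial>gauss_vec d)" by simp
    also have "\<dots> \<le> (\<integral>\<^sup>+x. ennreal (exp (- c * (1 + \<eta>) * d)) * ennreal (exp (- (- c) * ip d x x)) \<partial>gauss_vec d)"
    proof (intro nn_integral_mono)
      fix x assume "x \<in> space (gauss_vec d)"
      have "0 \<le> c * (ip d x x - (1 + \<eta>) * d)" if "x \<in> U"
        using that assms by (auto simp: U_def c_def)
      then show "indicator U x \<le> ennreal (exp (- c * (1 + \<eta>) * d)) * ennreal (exp (- (- c) * ip d x x))"
        by (auto simp: indicator_def ennreal_mult'[symmetric] exp_add[symmetric] algebra_simps
              simp del: ennreal_1 simp flip: ennreal_1 intro!: ennreal_leI)
    qed
    also have "\<dots> = ennreal (exp (- c * (1 + \<eta>) * d)) * ennreal (exp (- real d * ln (1 + 2 * (- c)) / 2))"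
      by (subst nn_integral_cmult, measurable, subst nn_integral_gauss_vec_exp_norm) (use assms in \<open>auto simp: c_def\<close>)
    also have "\<dots> = ennreal (exp (- c * (1 + \<eta>) * d + - real d * ln (1 + 2 * (- c)) / 2))"
      by (simp only: ennreal_mult'[symmetric] exp_ge_zero exp_add)
    also have "\<dots> \<le> ennreal (exp (-2))"
    proof (intro ennreal_leI exp_le_cancel_iff[THEN iffD2])
      have "- ln (1 - 2 * c) / 2 \<le> c + 2 * c\<^sup>2"
        by (rule neg_half_ln_one_minus_le) (use assms in \<open>auto simp: c_def\<close>)
      then have "d * (- ln (1 - 2 * c) / 2) \<le> d * (c + 2 * c\<^sup>2)" by (intro mult_left_mono) auto
      then have "- c * (1 + \<eta>) * d + - real d * ln (1 + 2 * (- c)) / 2 \<le> d * (2 * c\<^sup>2 - c * \<eta>)"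
        by (simp add: algebra_simps)
      also have "\<dots> = - (\<eta>\<^sup>2 * d) / 8" by (simp add: c_def power2_eq_square field_simps)
      finally show "- c * (1 + \<eta>) * d + - real d * ln (1 + 2 * (- c)) / 2 \<le> - 2" using assms by simp
    qed
    also have "\<dots> \<le> ennreal (1/4)" using e by (intro ennreal_leI)
    finally show ?thesis .
  qed
  have L: "emeasure (gauss_vec d) L \<le> ennreal (1/4)"
  proof -
    define c where "c = \<eta> / 2"
    have "emeasure (gauss_vec d) L = (\<integral>\<^sup>+x. indicator L x \<partial>gauss_vec d)" by simp
    also have "\<dots> \<le> (\<integral>\<^sup>+x. ennreal (exp (c * (1 - \<eta>) * d)) * ennreal (exp (- c * ip d x x)) \<partial>gauss_vec d)"
    proof (intro nn_integral_mono)
      fix x assume "x \<in> space (gauss_vec d)"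
      have "0 \<le> c * ((1 - \<eta>) * d - ip d x x)" if "x \<in> L"
        using that assms by (auto simp: L_def c_def)
      then show "indicator L x \<le> ennreal (exp (c * (1 - \<eta>) * d)) * ennreal (exp (- c * ip d x x))"
        by (auto simp: indicator_def ennreal_mult'[symmetric] exp_add[symmetric] algebra_simps
              simp del: ennreal_1 simp flip: ennreal_1 intro!: ennreal_leI)
    qed
    also have "\<dots> = ennreal (exp (c * (1 - \<eta>) * d)) * ennreal (exp (- real d * ln (1 + 2 * c) / 2))"
      by (subst nn_integral_cmult, measurable, subst nn_integral_gauss_vec_exp_norm) (use assms in \<open>auto simp: c_def\<close>)
    also have "\<dots> = ennreal (exp (c * (1 - \<eta>) * d + - real d * ln (1 + 2 * c) / 2))"
      by (simp only: ennreal_mult'[symmetric] exp_ge_zero exp_add)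
    also have "\<dots> \<le> ennreal (exp (-2))"
    proof (intro ennreal_leI exp_le_cancel_iff[THEN iffD2])
      have "- ln (1 + 2 * c) / 2 \<le> - c + c\<^sup>2"
        by (rule neg_half_ln_one_plus_le) (use assms in \<open>auto simp: c_def\<close>)
      then have "d * (- ln (1 + 2 * c) / 2) \<le> d * (- c + c\<^sup>2)" by (intro mult_left_mono) auto
      then have "c * (1 - \<eta>) * d + - real d * ln (1 + 2 * c) / 2 \<le> d * (c\<^sup>2 - c * \<eta>)"
        by (simp add: algebra_simps)
      also have "\<dots> = - (\<eta>\<^sup>2 * d) / 4" by (simp add: c_def power2_eq_square field_simps)
      finally show "c * (1 - \<eta>) * d + - real d * ln (1 + 2 * c) / 2 \<le> - 2" using assms by simp
    qed
    also have "\<dots> \<le> ennreal (1/4)" using e by (intro ennreal_leI)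
    finally show ?thesis .
  qed
  have "space (gauss_vec d) - shell d \<eta> \<subseteq> U \<union> L"
    by (auto simp: shell_def U_def L_def)
  then have "prob (space (gauss_vec d) - shell d \<eta>) \<le> prob (U \<union> L)"
    by (intro finite_measure_mono) auto
  also have "\<dots> \<le> prob U + prob L" by (rule measure_Un_le) auto
  also have "\<dots> \<le> 1/4 + 1/4"
    using U L by (intro add_mono) (simp_all add: emeasure_eq_measure)
  finally have "1 - prob (shell d \<eta>) \<le> 1/2" by (simp add: prob_compl)
  then show ?thesis
    unfolding emeasure_eq_measure by (intro ennreal_leI) simp
qed

text \<open>All that the clique count uses of the vectors, with \<open>s\<close> in place of
  \<open>sqrt d\<close>. For fixed \<open>x j\<close> and an unconditioned Gaussian
  \<open>y\<close>, the values \<open>G (x j) y\<close> are jointly Gaussian with covariances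
  \<open>G (x i) (x j) / s\<close> and variances between \<open>1 - \<eta>\<close> and
  \<open>1 + \<eta>\<close>. The bound \<open>eliminate\<close> expands the resulting Laplace
  transform; its factor 2 is the price of conditioning \<open>y\<close>.\<close>

locale latent_kernel = prob_space \<mu> for \<mu> :: "'a measure" +
  fixes G :: "'a \<Rightarrow> 'a \<Rightarrow> real" and s \<eta> :: real
  assumes s_pos: "0 < s" and \<eta>_bounds: "0 < \<eta>" "\<eta> \<le> 1"
    and G_measurable [measurable]: "(\<lambda>(x, y). G x y) \<in> borel_measurable (\<mu> \<Otimes>\<^sub>M \<mu>)"
    and G_bound: "x \<in> space \<mu> \<Longrightarrow> y \<in> space \<mu> \<Longrightarrow> \<bar>G x y\<bar> \<le> 2 * s"
    and eliminate: "\<And>S x c b. finite S \<Longrightarrow> (\<And>j. j \<in> S \<Longrightarrow> x j \<in> space \<mu>) \<Longrightarrow> (\<And>j. j \<in> S \<Longrightarrow> 0 \<le> c j) \<Longrightarrow>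
      (\<integral>\<^sup>+y. ennreal (exp (b * (\<Sum>j\<in>S. G (x j) y) - (\<Sum>j\<in>S. c j * (G (x j) y)\<^sup>2))) \<partial>\<mu>)
      \<le> 2 * ennreal (exp (b\<^sup>2 / 2 * ((1 + \<eta>) * card S + 2 / s * (\<Sum>(i,j)\<in>pairs S. G (x i) (x j)))
            - (1 - \<eta>) * (\<Sum>j\<in>S. c j) + 4 * (\<Sum>j\<in>S. (c j)\<^sup>2)
            + 2 / s\<^sup>2 * (\<Sum>(i,j)\<in>pairs S. c i * c j * (G (x i) (x j))\<^sup>2)))"

lemma sets_shell_measure [measurable_cong]:
  "sets (shell_measure d \<eta>) = sets (restrict_space (gauss_vec d) (shell d \<eta>))"
  by (simp add: shell_measure_def)

lemma space_shell_measure: "space (shell_measure d \<eta>) = shell d \<eta>"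
  unfolding shell_measure_def by (auto simp: space_restrict_space shell_def)

text \<open>The shell has probability at least \<open>1/2\<close>, so conditioning at most doubles
  the integral of a nonnegative function. What remains is a Gaussian integral in the coordinates of
  \<open>y\<close>, and conditioning the other vectors controls the diagonal inner products in its
  bound.\<close>

lemma latent_kernel_shell:
  assumes "0 < \<eta>" "\<eta> \<le> 1" "16 \<le> \<eta>\<^sup>2 * real d"
  shows "latent_kernel (shell_measure d \<eta>) (\<lambda>x y. ip d x y / sqrt d) (sqrt d) \<eta>"
proof -
  define P where "P = emeasure (gauss_vec d) (shell d \<eta>)"
  interpret V: prob_space "gauss_vec d" by (rule prob_space_gauss_vec)
  have P: "ennreal (1/2) \<le> P" "P \<noteq> \<infinity>" "P \<noteq> 0"
    using shell_emeasure_ge[OF assms] V.emeasure_finite unfolding P_def by auto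
  have d: "0 < d" using assms by (cases d) auto
  have id: "(\<lambda>x. x) \<in> measurable (shell_measure d \<eta>) (gauss_vec d)"
    by (simp add: measurable_cong_sets[OF sets_shell_measure refl] measurable_restrict_space1)
  have nn: "(\<integral>\<^sup>+y. f y \<partial>shell_measure d \<eta>) \<le> 2 * (\<integral>\<^sup>+y. f y \<partial>gauss_vec d)"
    if [measurable]: "f \<in> borel_measurable (gauss_vec d)" for f
  proof -
    have f': "f \<in> borel_measurable (restrict_space (gauss_vec d) (shell d \<eta>))"
      by (intro measurable_restrict_space1 that)
    have "(\<integral>\<^sup>+y. f y \<partial>shell_measure d \<eta>) = 1 / P * (\<integral>\<^sup>+y. f y * indicator (shell d \<eta>) y \<partial>gauss_vec d)"
      unfolding shell_measure_def P_def[symmetric] using f'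
      by (subst nn_integral_density) (auto simp: nn_integral_cmult nn_integral_restrict_space)
    also have "\<dots> \<le> 2 * (\<integral>\<^sup>+y. f y \<partial>gauss_vec d)"
    proof (intro mult_mono nn_integral_mono)
      define pr where "pr = V.prob (shell d \<eta>)"
      have Ppr: "P = ennreal pr" by (simp add: P_def pr_def V.emeasure_eq_measure)
      have "1/2 \<le> pr"
        using P(1) unfolding Ppr by (subst (asm) ennreal_le_iff) (auto simp: pr_def)
      then have "1 / P = ennreal (1 / pr)" unfolding Ppr
        by (subst ennreal_1[symmetric], subst divide_ennreal) auto
      also have "\<dots> \<le> ennreal 2" using \<open>1/2 \<le> pr\<close> by (intro ennreal_leI) (simp add: divide_le_eq)
      finally show "1 / P \<le> 2" by simp
    qed (auto simp: indicator_def)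
    finally show ?thesis .
  qed
  have norm: "(1 - \<eta>) \<le> ip d x x / d" "ip d x x / d \<le> 1 + \<eta>" "0 \<le> ip d x x" if "x \<in> shell d \<eta>" for x
    using that d by (auto simp: shell_def field_simps ip_def sum_nonneg)
  have "emeasure (shell_measure d \<eta>) (space (shell_measure d \<eta>)) = 1"
  proof -
    have "shell d \<eta> \<in> sets (restrict_space (gauss_vec d) (shell d \<eta>))"
      by (simp add: sets_restrict_space_iff)
    then have "emeasure (shell_measure d \<eta>) (shell d \<eta>) = 1 / P * P"
      by (simp add: shell_measure_def emeasure_density_const emeasure_restrict_space P_def)
    also have "\<dots> = 1" using P by (simp add: ennreal_divide_times ennreal_divide_self top.not_eq_extremum)
    finally show ?thesis by (simp add: space_shell_measure)
  qed
  then interpret prob_space "shell_measure d \<eta>" by (rule prob_spaceI)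
  show ?thesis
  proof
    show "0 < sqrt d" "0 < \<eta>" "\<eta> \<le> 1" using d assms by auto
    have [measurable]: "(\<lambda>x. x m) \<in> borel_measurable (shell_measure d \<eta>)" if "m < d" for m
      using measurable_compose[OF id, of "\<lambda>x. x m" borel] that
      by (simp add: gauss_vec_def)
    show "(\<lambda>(x, y). ip d x y / sqrt d) \<in> borel_measurable (shell_measure d \<eta> \<Otimes>\<^sub>M shell_measure d \<eta>)"
      unfolding ip_def case_prod_beta by measurable
  next
    fix x y assume "x \<in> space (shell_measure d \<eta>)" "y \<in> space (shell_measure d \<eta>)"
    then have xy: "x \<in> shell d \<eta>" "y \<in> shell d \<eta>" by (auto simp: space_shell_measure)
    have le: "ip d z z \<le> 2 * real d" if "z \<in> shell d \<eta>" for z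
      proof -
      have "ip d z z / d \<le> 2" using norm(2)[OF that] assms(2) by linarith
      then show ?thesis using d by (simp add: divide_le_eq)
    qed
    have "(ip d x y)\<^sup>2 \<le> ip d x x * ip d y y" by (rule ip_Cauchy_Schwarz)
    also have "\<dots> \<le> (2 * real d) * (2 * real d)" using xy le norm by (intro mult_mono) auto
    finally have "\<bar>ip d x y\<bar> \<le> 2 * real d" using abs_le_square_iff[of "ip d x y" "2 * real d"] by (simp add: power2_eq_square)
    also have "\<dots> = 2 * sqrt d * sqrt d" by simp
    finally show "\<bar>ip d x y / sqrt d\<bar> \<le> 2 * sqrt d" using d by (simp add: field_simps)
  next
    fix S :: "nat set" and x :: "nat \<Rightarrow> nat \<Rightarrow> real" and c :: "nat \<Rightarrow> real" and b :: real
    assume S: "finite S" and x: "\<And>j. j \<in> S \<Longrightarrow> x j \<in> space (shell_measure d \<eta>)" and c: "\<And>j. j \<in> S \<Longrightarrow> 0 \<le> c j"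
    have x: "x j \<in> shell d \<eta>" if "j \<in> S" for j using x[OF that] by (simp add: space_shell_measure)
    \<comment> \<open>In the coordinates of \<open>y\<close> the exponent is the linear form
      \<open>\<beta>\<close> minus the quadratic form \<open>Q\<close>, a sum of rank one forms
      along the \<open>x j\<close>. The norm of \<open>\<beta>\<close>, the trace of
      \<open>Q\<close> and the trace of its square are all expressed by inner products of the
      \<open>x j\<close>.\<close>
    define \<beta> where "\<beta> = (\<lambda>m. b / sqrt d * (\<Sum>j\<in>S. x j m))"
    define Q where "Q = (\<lambda>m n. \<Sum>j\<in>S. c j / d * (x j m * x j n))"
    let ?G = "\<lambda>x y. ip d x y / sqrt d"
    have lin: "(\<Sum>m<d. \<beta> m * y m) = b * (\<Sum>j\<in>S. ?G (x j) y)" for y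
    proof -
      have "(\<Sum>m<d. \<beta> m * y m) = b / sqrt d * (\<Sum>m<d. \<Sum>j\<in>S. x j m * y m)"
        by (simp add: \<beta>_def sum_distrib_left sum_distrib_right mult_ac)
      also have "(\<Sum>m<d. \<Sum>j\<in>S. x j m * y m) = (\<Sum>j\<in>S. ip d (x j) y)"
        unfolding ip_def by (rule sum.swap)
      finally show ?thesis by (simp add: sum_divide_distrib[symmetric])
    qed
    have quad: "(\<Sum>m<d. \<Sum>n<d. Q m n * y m * z n) = (\<Sum>j\<in>S. c j / d * (ip d (x j) y * ip d (x j) z))" for y z
    proof -
      have "(\<Sum>m<d. \<Sum>n<d. Q m n * y m * z n)
          = (\<Sum>m<d. \<Sum>n<d. \<Sum>j\<in>S. c j / d * ((x j m * y m) * (x j n * z n)))"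
        by (simp add: Q_def sum_distrib_left sum_distrib_right mult_ac)
      also have "\<dots> = (\<Sum>m<d. \<Sum>j\<in>S. \<Sum>n<d. c j / d * ((x j m * y m) * (x j n * z n)))"
        by (intro sum.cong refl sum.swap)
      also have "\<dots> = (\<Sum>j\<in>S. \<Sum>m<d. \<Sum>n<d. c j / d * ((x j m * y m) * (x j n * z n)))"
        by (rule sum.swap)
      also have "\<dots> = (\<Sum>j\<in>S. c j / d * (ip d (x j) y * ip d (x j) z))"
        unfolding ip_def sum_product by (simp only: sum_distrib_left)
      finally show ?thesis .
    qed
    have quad': "(\<Sum>m<d. \<Sum>n<d. Q m n * y m * y n) = (\<Sum>j\<in>S. c j * (?G (x j) y)\<^sup>2)" for y
      unfolding quad using d by (simp add: power_divide power2_eq_square)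
    have \<beta>2: "(\<Sum>m<d. (\<beta> m)\<^sup>2) = b\<^sup>2 / d * (\<Sum>i\<in>S. \<Sum>j\<in>S. ip d (x i) (x j))"
    proof -
      have "(\<Sum>m<d. (\<beta> m)\<^sup>2) = b * (\<Sum>j\<in>S. ?G (x j) \<beta>)"
        using lin[of \<beta>] by (simp add: power2_eq_square)
      also have "(\<Sum>j\<in>S. ?G (x j) \<beta>) = (\<Sum>j\<in>S. b / d * (\<Sum>i\<in>S. ip d (x i) (x j)))"
      proof (intro sum.cong refl)
        fix j
        have "ip d (x j) \<beta> = (\<Sum>m<d. \<beta> m * x j m)" by (simp add: ip_def mult.commute)
        then show "?G (x j) \<beta> = b / d * (\<Sum>i\<in>S. ip d (x i) (x j))"
          unfolding lin by (simp add: sum_divide_distrib[symmetric])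
      qed
      also have "\<dots> = b / d * (\<Sum>j\<in>S. \<Sum>i\<in>S. ip d (x i) (x j))" by (simp add: sum_distrib_left)
      finally show ?thesis
        by (subst sum.swap) (simp add: power2_eq_square)
    qed
    have tr: "(\<Sum>m<d. Q m m) = (\<Sum>j\<in>S. c j * (ip d (x j) (x j) / d))"
      unfolding Q_def by (subst sum.swap) (simp add: ip_def sum_distrib_left sum_divide_distrib)
    have Q2: "(\<Sum>m<d. \<Sum>n<d. (Q m n)\<^sup>2) = (\<Sum>i\<in>S. \<Sum>j\<in>S. c i * c j * (ip d (x i) (x j) / d)\<^sup>2)"
    proof -
      have "(\<Sum>m<d. \<Sum>n<d. (Q m n)\<^sup>2) = (\<Sum>m<d. \<Sum>n<d. \<Sum>i\<in>S. c i / d * (Q m n * x i m * x i n))"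
      proof (intro sum.cong refl)
        fix m n
        have "(Q m n)\<^sup>2 = Q m n * (\<Sum>i\<in>S. c i / d * (x i m * x i n))"
          by (simp only: power2_eq_square Q_def)
        then show "(Q m n)\<^sup>2 = (\<Sum>i\<in>S. c i / d * (Q m n * x i m * x i n))"
          by (simp add: sum_distrib_left mult_ac)
      qed
      also have "\<dots> = (\<Sum>m<d. \<Sum>i\<in>S. \<Sum>n<d. c i / d * (Q m n * x i m * x i n))"
        by (intro sum.cong refl sum.swap)
      also have "\<dots> = (\<Sum>i\<in>S. \<Sum>m<d. \<Sum>n<d. c i / d * (Q m n * x i m * x i n))"
        by (rule sum.swap)
      also have "\<dots> = (\<Sum>i\<in>S. c i / d * (\<Sum>j\<in>S. c j / d * (ip d (x j) (x i) * ip d (x j) (x i))))"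
        by (simp only: quad sum_distrib_left [symmetric])
      also have "\<dots> = (\<Sum>i\<in>S. \<Sum>j\<in>S. c i * c j * (ip d (x i) (x j) / d)\<^sup>2)"
        by (simp add: sum_distrib_left power2_eq_square ip_commute[of d "x i" "x j" for i j] mult_ac)
      finally show ?thesis .
    qed
    have "(\<integral>\<^sup>+y. ennreal (exp (b * (\<Sum>j\<in>S. ?G (x j) y) - (\<Sum>j\<in>S. c j * (?G (x j) y)\<^sup>2))) \<partial>shell_measure d \<eta>)
        \<le> 2 * (\<integral>\<^sup>+y. ennreal (exp (b * (\<Sum>j\<in>S. ?G (x j) y) - (\<Sum>j\<in>S. c j * (?G (x j) y)\<^sup>2))) \<partial>gauss_vec d)"
      by (rule nn) measurable
    also have "\<dots> = 2 * (\<integral>\<^sup>+y. ennreal (exp ((\<Sum>m<d. \<beta> m * y m) - (\<Sum>m<d. \<Sum>n<d. Q m n * y m * y n))) \<partial>Pi\<^sub>M {..<d} (\<lambda>_. std_gauss))"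
      unfolding lin quad' gauss_vec_def ..
    also have "\<dots> \<le> 2 * ennreal (exp ((\<Sum>m<d. (\<beta> m)\<^sup>2) / 2 - (\<Sum>m<d. Q m m) + (\<Sum>m<d. \<Sum>n<d. (Q m n)\<^sup>2)))"
    proof (intro mult_left_mono gaussian_quadratic_bound)
      show "Q m n = Q n m" for m n by (simp add: Q_def mult_ac)
      show psd: "0 \<le> (\<Sum>m<d. \<Sum>n<d. Q m n * z m * z n)" for z
        unfolding quad' using c by (intro sum_nonneg) auto
      \<comment> \<open>For this supremum \<open>Q\<close> is simply dropped, by positive
        semidefiniteness. It enters the final bound through its traces alone, so no inverse matrix
        appears.\<close>
      show "(\<Sum>i<d. \<beta> i * z i) - (\<Sum>i<d. (z i)\<^sup>2) / 2 - (\<Sum>i<d. \<Sum>j<d. Q i j * z i * z j) \<le> (\<Sum>m<d. (\<beta> m)\<^sup>2) / 2" for z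
      proof -
        have "0 \<le> (\<Sum>i<d. (\<beta> i - z i)\<^sup>2)" by (intro sum_nonneg) auto
        also have "\<dots> = (\<Sum>i<d. (\<beta> i)\<^sup>2) + (\<Sum>i<d. (z i)\<^sup>2) - 2 * (\<Sum>i<d. \<beta> i * z i)"
          by (simp add: power2_diff sum.distrib sum_subtractf sum_distrib_left mult_ac)
        finally show ?thesis using psd[of z] by simp
      qed
    qed auto
    also have "\<dots> \<le> 2 * ennreal (exp (b\<^sup>2 / 2 * ((1 + \<eta>) * card S + 2 / sqrt d * (\<Sum>(i,j)\<in>pairs S. ?G (x i) (x j)))
            - (1 - \<eta>) * (\<Sum>j\<in>S. c j) + 4 * (\<Sum>j\<in>S. (c j)\<^sup>2)
            + 2 / (sqrt d)\<^sup>2 * (\<Sum>(i,j)\<in>pairs S. c i * c j * (?G (x i) (x j))\<^sup>2)))"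
    proof (intro mult_left_mono ennreal_leI exp_le_cancel_iff[THEN iffD2])
      \<comment> \<open>The diagonal of the Gram matrix is bounded by the norm condition. Its
        off-diagonal part has the same shape as the linear exponent on the remaining vertices, and
        so becomes a shift of the slope.\<close>
      have a1: "(\<Sum>m<d. (\<beta> m)\<^sup>2) / 2 \<le> b\<^sup>2 / 2 * ((1 + \<eta>) * card S + 2 / sqrt d * (\<Sum>(i,j)\<in>pairs S. ?G (x i) (x j)))"
      proof -
        have "(\<Sum>i\<in>S. \<Sum>j\<in>S. ip d (x i) (x j) / d) = (\<Sum>i\<in>S. ip d (x i) (x i) / d) + 2 * (\<Sum>(i,j)\<in>pairs S. ip d (x i) (x j) / d)"
          by (rule sum_symmetric_pairs) (use S in \<open>auto simp: ip_commute\<close>)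
        moreover have "(\<Sum>i\<in>S. ip d (x i) (x i) / d) \<le> (\<Sum>i\<in>S. 1 + \<eta>)"
          by (intro sum_mono norm x)
        moreover have "2 * (\<Sum>(i,j)\<in>pairs S. ip d (x i) (x j) / d) = 2 / sqrt d * (\<Sum>(i,j)\<in>pairs S. ?G (x i) (x j))"
          by (simp add: case_prod_beta sum_distrib_left)
        ultimately have "(\<Sum>i\<in>S. \<Sum>j\<in>S. ip d (x i) (x j) / d) \<le> (1 + \<eta>) * card S + 2 / sqrt d * (\<Sum>(i,j)\<in>pairs S. ?G (x i) (x j))"
          by (simp add: mult.commute)
        then have "b\<^sup>2 / 2 * (\<Sum>i\<in>S. \<Sum>j\<in>S. ip d (x i) (x j) / d)
            \<le> b\<^sup>2 / 2 * ((1 + \<eta>) * card S + 2 / sqrt d * (\<Sum>(i,j)\<in>pairs S. ?G (x i) (x j)))"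
          by (intro mult_left_mono) auto
        then show ?thesis unfolding \<beta>2 by (simp add: sum_divide_distrib[symmetric])
      qed
      have a2: "(1 - \<eta>) * (\<Sum>j\<in>S. c j) \<le> (\<Sum>m<d. Q m m)"
        unfolding tr sum_distrib_left
        by (intro sum_mono) (metis c mult.commute mult_left_mono norm(1) x)
      have a3: "(\<Sum>m<d. \<Sum>n<d. (Q m n)\<^sup>2) \<le> 4 * (\<Sum>j\<in>S. (c j)\<^sup>2)
            + 2 / (sqrt d)\<^sup>2 * (\<Sum>(i,j)\<in>pairs S. c i * c j * (?G (x i) (x j))\<^sup>2)"
      proof -
        have "(\<Sum>i\<in>S. \<Sum>j\<in>S. c i * c j * (ip d (x i) (x j) / d)\<^sup>2)
            = (\<Sum>i\<in>S. c i * c i * (ip d (x i) (x i) / d)\<^sup>2) + 2 * (\<Sum>(i,j)\<in>pairs S. c i * c j * (ip d (x i) (x j) / d)\<^sup>2)"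
          by (rule sum_symmetric_pairs) (use S in \<open>auto simp: ip_commute mult.commute\<close>)
        moreover have "(\<Sum>i\<in>S. c i * c i * (ip d (x i) (x i) / d)\<^sup>2) \<le> (\<Sum>i\<in>S. c i * c i * 2\<^sup>2)"
        proof (intro sum_mono mult_left_mono power_mono)
          fix i assume i: "i \<in> S"
          show "ip d (x i) (x i) / d \<le> 2" using norm(2)[OF x[OF i]] assms(2) by linarith
          show "0 \<le> ip d (x i) (x i) / d" using norm(3)[OF x[OF i]] by simp
          show "0 \<le> c i * c i" by simp
        qed
        moreover have "2 * (\<Sum>(i,j)\<in>pairs S. c i * c j * (ip d (x i) (x j) / d)\<^sup>2)
            = 2 / (sqrt d)\<^sup>2 * (\<Sum>(i,j)\<in>pairs S. c i * c j * (?G (x i) (x j))\<^sup>2)"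
          by (simp add: case_prod_beta sum_distrib_left power2_eq_square mult_ac)
        ultimately show ?thesis unfolding Q2 by (simp add: power2_eq_square sum_distrib_left mult_ac)
      qed
      show "(\<Sum>m<d. (\<beta> m)\<^sup>2) / 2 - (\<Sum>m<d. Q m m) + (\<Sum>m<d. \<Sum>n<d. (Q m n)\<^sup>2)
         \<le> b\<^sup>2 / 2 * ((1 + \<eta>) * card S + 2 / sqrt d * (\<Sum>(i,j)\<in>pairs S. ?G (x i) (x j)))
            - (1 - \<eta>) * (\<Sum>j\<in>S. c j) + 4 * (\<Sum>j\<in>S. (c j)\<^sup>2)
            + 2 / (sqrt d)\<^sup>2 * (\<Sum>(i,j)\<in>pairs S. c i * c j * (?G (x i) (x j))\<^sup>2)"
        using a1 a2 a3 by linarith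
    qed auto
    finally show "(\<integral>\<^sup>+y. ennreal (exp (b * (\<Sum>j\<in>S. ?G (x j) y) - (\<Sum>j\<in>S. c j * (?G (x j) y)\<^sup>2))) \<partial>shell_measure d \<eta>)
      \<le> 2 * ennreal (exp (b\<^sup>2 / 2 * ((1 + \<eta>) * card S + 2 / sqrt d * (\<Sum>(i,j)\<in>pairs S. ?G (x i) (x j)))
            - (1 - \<eta>) * (\<Sum>j\<in>S. c j) + 4 * (\<Sum>j\<in>S. (c j)\<^sup>2)
            + 2 / (sqrt d)\<^sup>2 * (\<Sum>(i,j)\<in>pairs S. c i * c j * (?G (x i) (x j))\<^sup>2)))" .
  qed
qed

section \<open>Eliminating vertices\<close>

lemma exp_minus_le_quadratic:
  assumes "0 \<le> (x::real)" shows "exp (- x) \<le> 1 - x + x\<^sup>2 / 2"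
proof -
  have "exp (- x) - (1 - x + x\<^sup>2 / 2) \<le> exp (- 0) - (1 - 0 + 0\<^sup>2 / 2)"
    using assms
  proof (rule DERIV_nonpos_imp_nonincreasing)
    fix y :: real assume "0 \<le> y" "y \<le> x"
    have "((\<lambda>x. exp (- x) - (1 - x + x\<^sup>2 / 2)) has_real_derivative (- exp (- y) - (- 1 + y))) (at y)"
      by (auto intro!: derivative_eq_intros)
    moreover have "- exp (- y) - (- 1 + y) \<le> 0" using exp_ge_add_one_self[of "- y"] by simp
    ultimately show "\<exists>z. ((\<lambda>x. exp (- x) - (1 - x + x\<^sup>2 / 2)) has_real_derivative z) (at y) \<and> z \<le> 0" by blast
  qed
  then show ?thesis by simp
qed

text \<open>Each elimination of a vertex replaces the slope \<open>b\<close> by \<open>b + b\<^sup>2 / s\<close>.\<close>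

fun slope_sum :: "real \<Rightarrow> nat \<Rightarrow> real \<Rightarrow> real" where
  "slope_sum s 0 b = 0"
| "slope_sum s (Suc k) b = k * b\<^sup>2 + slope_sum s k (b + b\<^sup>2 / s)"

context latent_kernel
begin

lemma G_pair_measurable [measurable (raw)]:
  assumes "i \<in> S" "j \<in> S"
  shows "(\<lambda>x. G (x i) (x j)) \<in> borel_measurable (Pi\<^sub>M S (\<lambda>_. \<mu>))"
  using measurable_compose[OF _ G_measurable, of "\<lambda>x. (x i, x j)" "Pi\<^sub>M S (\<lambda>_. \<mu>)"] assms
  by simp

lemma sum_pairs_measurable [measurable (raw)]:
  assumes "\<And>i j. (i, j) \<in> pairs S \<Longrightarrow> f i j \<in> borel_measurable borel"
  shows "(\<lambda>x. \<Sum>(i,j)\<in>pairs S. f i j (G (x i) (x j)) :: real) \<in> borel_measurable (Pi\<^sub>M S (\<lambda>_. \<mu>))"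
proof (intro borel_measurable_sum)
  fix e assume e: "e \<in> pairs S"
  obtain i j where ij: "e = (i, j)" by force
  have "i \<in> S" "j \<in> S" using e ij by (auto simp: pairs_def)
  then show "(\<lambda>x. case e of (i, j) \<Rightarrow> f i j (G (x i) (x j))) \<in> borel_measurable (Pi\<^sub>M S (\<lambda>_. \<mu>))"
    using measurable_compose[OF G_pair_measurable assms] e ij by simp
qed

text \<open>
  An elimination lowers the coefficients \<open>c i j\<close> by at most \<open>2 * cm\<^sup>2 / s\<^sup>2\<close>; the lower bound on them
  keeps all coefficients nonnegative until the last vertex is gone.
\<close>

lemma exp_quadratic_integral_bound:
  fixes c :: "nat \<Rightarrow> nat \<Rightarrow> real"
  assumes "finite S" "0 \<le> cm"
    and "\<And>i j. (i, j) \<in> pairs S \<Longrightarrow> card S * (2 * cm\<^sup>2 / s\<^sup>2) \<le> c i j"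
    and "\<And>i j. (i, j) \<in> pairs S \<Longrightarrow> c i j \<le> cm"
  shows "(\<integral>\<^sup>+x. ennreal (exp (b * (\<Sum>(i,j)\<in>pairs S. G (x i) (x j))
              - (\<Sum>(i,j)\<in>pairs S. c i j * (G (x i) (x j))\<^sup>2))) \<partial>Pi\<^sub>M S (\<lambda>_. \<mu>))
     \<le> 2 ^ card S * ennreal (exp ((1 + \<eta>) / 2 * slope_sum s (card S) b - (1 - \<eta>) * (\<Sum>(i,j)\<in>pairs S. c i j)
           + card (pairs S) * (4 * cm\<^sup>2 + card S * (2 * cm\<^sup>2 / s\<^sup>2))))"
  using assms
proof (induction S arbitrary: b c rule: finite_linorder_max_induct)
  case empty
  interpret P: prob_space "Pi\<^sub>M {} (\<lambda>_::nat. \<mu>)"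
    by (intro prob_space_PiM prob_space_axioms)
  show ?case using P.emeasure_space_1 by simp
next
  case (insert m S)
  note fin = \<open>finite S\<close>
  have m: "m \<notin> S" using insert(2) by auto
  define k where "k = card S"
  define \<theta> where "\<theta> = 2 * cm\<^sup>2 / s\<^sup>2"
  have \<theta>: "\<theta> \<ge> 0" by (simp add: \<theta>_def)
  have card: "card (insert m S) = Suc k" using fin m by (simp add: k_def)
  have lt: "i < m" if "i \<in> S" for i using insert(2) that by auto
  have ps: "pairs (insert m S) = pairs S \<union> (\<lambda>i. (i, m)) ` S"
    by (rule pairs_insert_max) (rule lt)
  have sp: "(\<Sum>(i,j)\<in>pairs (insert m S). f i j) = (\<Sum>(i,j)\<in>pairs S. f i j) + (\<Sum>i\<in>S. f i m)" for f :: "nat \<Rightarrow> nat \<Rightarrow> real"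
    by (rule sum_pairs_insert_max) (use fin lt in auto)
  have c_lo: "Suc k * \<theta> \<le> c i j" and c_hi: "c i j \<le> cm" if "(i, j) \<in> pairs (insert m S)" for i j
    using insert.prems(2,3)[OF that] unfolding card \<theta>_def by auto
  have c_nn: "0 \<le> c i j" if "(i, j) \<in> pairs (insert m S)" for i j
    using c_lo[OF that] \<theta> by (smt (verit) mult_nonneg_nonneg of_nat_0_le_iff)
  \<comment> \<open>The cross terms \<open>c i m * c j m\<close> from \<open>eliminate\<close> stand
    in the exponent with a plus sign, so they lower the coefficients on the surviving pairs.\<close>
  define c' where "c' = (\<lambda>i j. c i j - 2 / s\<^sup>2 * (c i m * c j m))"
  define b' where "b' = b + b\<^sup>2 / s"
  have cc: "2 / s\<^sup>2 * (c i m * c j m) \<le> \<theta>" "0 \<le> 2 / s\<^sup>2 * (c i m * c j m)" if "(i, j) \<in> pairs S" for i j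
  proof -
    have ij: "(i, m) \<in> pairs (insert m S)" "(j, m) \<in> pairs (insert m S)"
      using that unfolding ps by (auto simp: pairs_def)
    have "c i m * c j m \<le> cm * cm"
      using ij c_hi c_nn insert.prems(1) by (intro mult_mono) auto
    then have "2 / s\<^sup>2 * (c i m * c j m) \<le> 2 / s\<^sup>2 * (cm * cm)" by (intro mult_left_mono) auto
    then show "2 / s\<^sup>2 * (c i m * c j m) \<le> \<theta>" by (simp add: \<theta>_def power2_eq_square)
    show "0 \<le> 2 / s\<^sup>2 * (c i m * c j m)" using ij c_nn by simp
  qed
  have IH: "(\<integral>\<^sup>+x. ennreal (exp (b' * (\<Sum>(i,j)\<in>pairs S. G (x i) (x j))
              - (\<Sum>(i,j)\<in>pairs S. c' i j * (G (x i) (x j))\<^sup>2))) \<partial>Pi\<^sub>M S (\<lambda>_. \<mu>))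
     \<le> 2 ^ k * ennreal (exp ((1 + \<eta>) / 2 * slope_sum s k b' - (1 - \<eta>) * (\<Sum>(i,j)\<in>pairs S. c' i j)
           + card (pairs S) * (4 * cm\<^sup>2 + k * \<theta>)))"
    unfolding k_def \<theta>_def
  proof (rule insert.IH)
    fix i j assume ij: "(i, j) \<in> pairs S"
    then have ij': "(i, j) \<in> pairs (insert m S)" unfolding ps by auto
    have "k * \<theta> \<le> c' i j"
      using c_lo[OF ij'] cc[OF ij] unfolding c'_def by (simp add: distrib_right)
    then show "card S * (2 * cm\<^sup>2 / s\<^sup>2) \<le> c' i j" by (simp add: k_def \<theta>_def)
    show "c' i j \<le> cm"
      using c_hi[OF ij'] cc[OF ij] unfolding c'_def by simp
  qed (use insert.prems in auto)
  interpret product_sigma_finite "\<lambda>_::nat. \<mu>" ..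
  define E where "E = b\<^sup>2 / 2 * ((1 + \<eta>) * k) - (1 - \<eta>) * (\<Sum>i\<in>S. c i m) + 4 * (\<Sum>i\<in>S. (c i m)\<^sup>2)"
  let ?P = "\<lambda>x. \<Sum>(i,j)\<in>pairs S. G (x i) (x j)"
  let ?R = "\<lambda>c x. \<Sum>(i,j)\<in>pairs S. c i j * (G (x i) (x j))\<^sup>2"
  have step: "(\<integral>\<^sup>+y. ennreal (exp (b * (\<Sum>(i,j)\<in>pairs (insert m S). G ((x(m := y)) i) ((x(m := y)) j))
              - (\<Sum>(i,j)\<in>pairs (insert m S). c i j * (G ((x(m := y)) i) ((x(m := y)) j))\<^sup>2))) \<partial>\<mu>)
        \<le> 2 * ennreal (exp E) * ennreal (exp (b' * ?P x - ?R c' x))"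
    if x: "x \<in> space (Pi\<^sub>M S (\<lambda>_. \<mu>))" for x
  proof -
    have xs: "x j \<in> space \<mu>" if "j \<in> S" for j using x that by (auto simp: space_PiM)
    have u1: "(\<Sum>(i,j)\<in>pairs (insert m S). f i j (G ((x(m := y)) i) ((x(m := y)) j)))
        = (\<Sum>(i,j)\<in>pairs S. f i j (G (x i) (x j))) + (\<Sum>i\<in>S. f i m (G (x i) y))"
      for f :: "nat \<Rightarrow> nat \<Rightarrow> real \<Rightarrow> real" and y
    proof -
      have "(\<Sum>(i,j)\<in>pairs S. f i j (G ((x(m := y)) i) ((x(m := y)) j))) = (\<Sum>(i,j)\<in>pairs S. f i j (G (x i) (x j)))"
        by (intro sum.cong) (use m in \<open>auto simp: pairs_def\<close>)
      moreover have "(\<Sum>i\<in>S. f i m (G ((x(m := y)) i) ((x(m := y)) m))) = (\<Sum>i\<in>S. f i m (G (x i) y))"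
        by (intro sum.cong) (use m in \<open>auto simp: pairs_def\<close>)
      ultimately show ?thesis using sp[of "\<lambda>i j. f i j (G ((x(m := y)) i) ((x(m := y)) j))"] by simp
    qed
    have "(\<integral>\<^sup>+y. ennreal (exp (b * (\<Sum>(i,j)\<in>pairs (insert m S). G ((x(m := y)) i) ((x(m := y)) j))
              - (\<Sum>(i,j)\<in>pairs (insert m S). c i j * (G ((x(m := y)) i) ((x(m := y)) j))\<^sup>2))) \<partial>\<mu>)
      = (\<integral>\<^sup>+y. ennreal (exp (b * ?P x - ?R c x))
           * ennreal (exp (b * (\<Sum>i\<in>S. G (x i) y) - (\<Sum>i\<in>S. c i m * (G (x i) y)\<^sup>2))) \<partial>\<mu>)"
      unfolding u1[of "\<lambda>i j z. z"] u1[of "\<lambda>i j z. c i j * z\<^sup>2"]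
      by (intro nn_integral_cong) (simp add: ennreal_mult'[symmetric] exp_add[symmetric] algebra_simps)
    also have "\<dots> = ennreal (exp (b * ?P x - ?R c x))
           * (\<integral>\<^sup>+y. ennreal (exp (b * (\<Sum>i\<in>S. G (x i) y) - (\<Sum>i\<in>S. c i m * (G (x i) y)\<^sup>2))) \<partial>\<mu>)"
    proof (intro nn_integral_cmult)
      have [measurable]: "G (x i) \<in> borel_measurable \<mu>" if "i \<in> S" for i
        using measurable_compose[OF measurable_Pair1' G_measurable] xs[OF that] by simp
      show "(\<lambda>y. ennreal (exp (b * (\<Sum>i\<in>S. G (x i) y) - (\<Sum>i\<in>S. c i m * (G (x i) y)\<^sup>2)))) \<in> borel_measurable \<mu>"
        by measurable
    qed
    also have "\<dots> \<le> ennreal (exp (b * ?P x - ?R c x)) *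
        (2 * ennreal (exp (b\<^sup>2 / 2 * ((1 + \<eta>) * card S + 2 / s * ?P x)
            - (1 - \<eta>) * (\<Sum>j\<in>S. c j m) + 4 * (\<Sum>j\<in>S. (c j m)\<^sup>2)
            + 2 / s\<^sup>2 * (\<Sum>(i,j)\<in>pairs S. c i m * c j m * (G (x i) (x j))\<^sup>2))))"
      by (intro mult_left_mono eliminate) (use fin xs c_nn ps in auto)
    also have "\<dots> = 2 * ennreal (exp (b * ?P x - ?R c x + (b\<^sup>2 / 2 * ((1 + \<eta>) * card S + 2 / s * ?P x)
            - (1 - \<eta>) * (\<Sum>j\<in>S. c j m) + 4 * (\<Sum>j\<in>S. (c j m)\<^sup>2)
            + 2 / s\<^sup>2 * (\<Sum>(i,j)\<in>pairs S. c i m * c j m * (G (x i) (x j))\<^sup>2))))"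
      by (subst exp_add, subst ennreal_mult') (auto simp: mult_ac)
    also have "b * ?P x - ?R c x + (b\<^sup>2 / 2 * ((1 + \<eta>) * card S + 2 / s * ?P x)
            - (1 - \<eta>) * (\<Sum>j\<in>S. c j m) + 4 * (\<Sum>j\<in>S. (c j m)\<^sup>2)
            + 2 / s\<^sup>2 * (\<Sum>(i,j)\<in>pairs S. c i m * c j m * (G (x i) (x j))\<^sup>2))
        = E + (b' * ?P x - ?R c' x)"
    proof -
      have "?R c' x = ?R c x - 2 / s\<^sup>2 * (\<Sum>(i,j)\<in>pairs S. c i m * c j m * (G (x i) (x j))\<^sup>2)"
        unfolding sum_distrib_left sum_subtractf[symmetric] c'_def case_prod_beta
        by (intro sum.cong refl) (simp add: algebra_simps)
      moreover have "b\<^sup>2 / 2 * ((1 + \<eta>) * card S + 2 / s * ?P x) = b\<^sup>2 / 2 * ((1 + \<eta>) * k) + b\<^sup>2 / s * ?P x"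
        unfolding k_def by (simp add: distrib_left)
      moreover have "b' * ?P x = b * ?P x + b\<^sup>2 / s * ?P x" by (simp add: b'_def distrib_right)
      ultimately show ?thesis unfolding E_def by linarith
    qed
    finally show ?thesis by (simp add: exp_add ennreal_mult' mult.assoc)
  qed
  have "(\<integral>\<^sup>+x. ennreal (exp (b * (\<Sum>(i,j)\<in>pairs (insert m S). G (x i) (x j))
              - (\<Sum>(i,j)\<in>pairs (insert m S). c i j * (G (x i) (x j))\<^sup>2))) \<partial>Pi\<^sub>M (insert m S) (\<lambda>_. \<mu>))
      = (\<integral>\<^sup>+x. (\<integral>\<^sup>+y. ennreal (exp (b * (\<Sum>(i,j)\<in>pairs (insert m S). G ((x(m := y)) i) ((x(m := y)) j))
              - (\<Sum>(i,j)\<in>pairs (insert m S). c i j * (G ((x(m := y)) i) ((x(m := y)) j))\<^sup>2))) \<partial>\<mu>) \<partial>Pi\<^sub>M S (\<lambda>_. \<mu>))"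
  proof (rule product_nn_integral_insert[OF fin m])
    have [measurable]: "(\<lambda>x. \<Sum>(i,j)\<in>pairs (insert m S). G (x i) (x j)) \<in> borel_measurable (Pi\<^sub>M (insert m S) (\<lambda>_. \<mu>))"
      by (rule sum_pairs_measurable) simp
    have [measurable]: "(\<lambda>x. \<Sum>(i,j)\<in>pairs (insert m S). c i j * (G (x i) (x j))\<^sup>2) \<in> borel_measurable (Pi\<^sub>M (insert m S) (\<lambda>_. \<mu>))"
      by (rule sum_pairs_measurable) simp
    show "(\<lambda>x. ennreal (exp (b * (\<Sum>(i,j)\<in>pairs (insert m S). G (x i) (x j))
              - (\<Sum>(i,j)\<in>pairs (insert m S). c i j * (G (x i) (x j))\<^sup>2)))) \<in> borel_measurable (Pi\<^sub>M (insert m S) (\<lambda>_. \<mu>))"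
      by measurable
  qed
  also have "\<dots> \<le> (\<integral>\<^sup>+x. 2 * ennreal (exp E) * ennreal (exp (b' * ?P x - ?R c' x)) \<partial>Pi\<^sub>M S (\<lambda>_. \<mu>))"
    by (intro nn_integral_mono step)
  also have "\<dots> = 2 * ennreal (exp E) * (\<integral>\<^sup>+x. ennreal (exp (b' * ?P x - ?R c' x)) \<partial>Pi\<^sub>M S (\<lambda>_. \<mu>))"
  proof (intro nn_integral_cmult)
    have [measurable]: "?P \<in> borel_measurable (Pi\<^sub>M S (\<lambda>_. \<mu>))"
      by (rule sum_pairs_measurable) simp
    have [measurable]: "?R c' \<in> borel_measurable (Pi\<^sub>M S (\<lambda>_. \<mu>))"
      by (rule sum_pairs_measurable) simp
    show "(\<lambda>x. ennreal (exp (b' * ?P x - ?R c' x))) \<in> borel_measurable (Pi\<^sub>M S (\<lambda>_. \<mu>))"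
      by measurable
  qed
  also have "\<dots> \<le> 2 * ennreal (exp E) * (2 ^ k * ennreal (exp ((1 + \<eta>) / 2 * slope_sum s k b' - (1 - \<eta>) * (\<Sum>(i,j)\<in>pairs S. c' i j)
           + card (pairs S) * (4 * cm\<^sup>2 + k * \<theta>))))"
    by (intro mult_left_mono IH) auto
  also have "\<dots> = 2 ^ Suc k * ennreal (exp (E + ((1 + \<eta>) / 2 * slope_sum s k b' - (1 - \<eta>) * (\<Sum>(i,j)\<in>pairs S. c' i j)
           + card (pairs S) * (4 * cm\<^sup>2 + k * \<theta>))))"
    by (subst exp_add, subst ennreal_mult') (auto simp: mult_ac)
  also have "\<dots> \<le> 2 ^ Suc k * ennreal (exp ((1 + \<eta>) / 2 * slope_sum s (Suc k) b - (1 - \<eta>) * (\<Sum>(i,j)\<in>pairs (insert m S). c i j)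
           + card (pairs (insert m S)) * (4 * cm\<^sup>2 + Suc k * \<theta>)))"
  proof (intro mult_left_mono ennreal_leI exp_le_cancel_iff[THEN iffD2])
    define N where "N = real (card (pairs S))"
    have N: "real (card (pairs (insert m S))) = N + k"
      using sp[of "\<lambda>_ _. 1"] by (simp add: N_def k_def case_prod_beta)
    have s1: "(\<Sum>i\<in>S. (c i m)\<^sup>2) \<le> k * cm\<^sup>2"
    proof -
      have "(\<Sum>i\<in>S. (c i m)\<^sup>2) \<le> (\<Sum>i\<in>S. cm\<^sup>2)"
        using c_hi c_nn ps by (intro sum_mono power_mono) auto
      then show ?thesis by (simp add: k_def)
    qed
    have s2: "(\<Sum>(i,j)\<in>pairs S. c i j) - N * \<theta> \<le> (\<Sum>(i,j)\<in>pairs S. c' i j)"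
    proof -
      have "(\<Sum>(i,j)\<in>pairs S. c i j) - N * \<theta> = (\<Sum>(i,j)\<in>pairs S. c i j - \<theta>)"
        by (simp add: case_prod_beta sum_subtractf N_def)
      also have "\<dots> \<le> (\<Sum>(i,j)\<in>pairs S. c' i j)"
        using cc(1) by (intro sum_mono) (auto simp: c'_def)
      finally show ?thesis .
    qed
    have s3: "(1 - \<eta>) * ((\<Sum>(i,j)\<in>pairs S. c i j) - N * \<theta>) \<le> (1 - \<eta>) * (\<Sum>(i,j)\<in>pairs S. c' i j)"
      using \<eta>_bounds s2 by (intro mult_left_mono) auto
    have s4: "(1 - \<eta>) * (N * \<theta>) \<le> 1 * (N * \<theta>)"
      using \<eta>_bounds \<theta> by (intro mult_right_mono) (auto simp: N_def)
    have s5: "0 \<le> k * (Suc k * \<theta>)" using \<theta> by simp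
    \<comment> \<open>Raising \<open>k\<close> to \<open>Suc k\<close> enlarges the error allowance
      of the old pairs by \<open>N * \<theta>\<close>, which covers the drop of their coefficients.
      The \<open>k\<close> new pairs contribute \<open>4 * (k * cm\<^sup>2)\<close>, which covers
      the squares of the eliminated coefficients.\<close>
    have "E + ((1 + \<eta>) / 2 * slope_sum s k b' - (1 - \<eta>) * (\<Sum>(i,j)\<in>pairs S. c' i j) + N * (4 * cm\<^sup>2 + k * \<theta>))
      \<le> (1 + \<eta>) / 2 * slope_sum s (Suc k) b - (1 - \<eta>) * ((\<Sum>(i,j)\<in>pairs S. c i j) + (\<Sum>i\<in>S. c i m))
           + (N + k) * (4 * cm\<^sup>2 + Suc k * \<theta>)"
    proof -
      have "(1 + \<eta>) / 2 * slope_sum s (Suc k) b = b\<^sup>2 / 2 * ((1 + \<eta>) * k) + (1 + \<eta>) / 2 * slope_sum s k b'"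
        by (simp add: b'_def algebra_simps add_divide_distrib)
      moreover have "(N + k) * (4 * cm\<^sup>2 + Suc k * \<theta>) = N * (4 * cm\<^sup>2 + k * \<theta>) + N * \<theta> + 4 * (k * cm\<^sup>2) + k * (Suc k * \<theta>)"
        by (simp add: algebra_simps)
      ultimately show ?thesis using s1 s3 s4 s5 unfolding E_def distrib_left right_diff_distrib by linarith
    qed
    then show "E + ((1 + \<eta>) / 2 * slope_sum s k b' - (1 - \<eta>) * (\<Sum>(i,j)\<in>pairs S. c' i j)
           + card (pairs S) * (4 * cm\<^sup>2 + k * \<theta>))
      \<le> (1 + \<eta>) / 2 * slope_sum s (Suc k) b - (1 - \<eta>) * (\<Sum>(i,j)\<in>pairs (insert m S). c i j)
           + card (pairs (insert m S)) * (4 * cm\<^sup>2 + Suc k * \<theta>)"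
      unfolding sp N by (simp add: N_def)
  qed auto
  finally show ?case unfolding card \<theta>_def .
qed

text \<open>
  The factor \<open>exp (- \<alpha> * g\<^sup>2)\<close> supplies the reserve of nonnegativity in the previous lemma. The mixture
  with weights \<open>\<kappa>\<close> and \<open>1 - \<kappa>\<close> is needed because \<open>(1 + b * g) * exp (- b * g)\<close> decays
  more slowly than a Gaussian.
\<close>

theorem soft_clique_integral_bound:
  fixes b c \<kappa> :: real
  defines "\<alpha> \<equiv> \<lambda>k::nat. 8 * c\<^sup>2 * k / s\<^sup>2"
  assumes S: "finite S" and \<kappa>: "0 \<le> \<kappa>" "\<kappa> \<le> 1" and c: "0 \<le> c" "\<alpha> (card S) \<le> c"
    and dom: "\<And>g. \<bar>g\<bar> \<le> 2 * s \<Longrightarrow>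
      max 0 (1 + b * g) \<le> exp (b * g) * exp (- \<alpha> (card S) * g\<^sup>2) * (\<kappa> * exp (- c * g\<^sup>2) + (1 - \<kappa>))"
  shows "(\<integral>\<^sup>+x. ennreal (\<Prod>(i,j)\<in>pairs S. max 0 (1 + b * G (x i) (x j))) \<partial>Pi\<^sub>M S (\<lambda>_. \<mu>))
     \<le> ennreal (2 ^ card S * exp ((1 + \<eta>) / 2 * slope_sum s (card S) b
          + card (pairs S) * (16 * c\<^sup>2 + \<alpha> (card S) - \<kappa> * ((1 - \<eta>) * c - c\<^sup>2 / 2))))"
proof -
  define A where "A = \<alpha> (card S)"
  define P where "P = pairs S"
  define cm where "cm = A + c"
  define N where "N = card P"
  have A: "0 \<le> A" "A \<le> c" using c by (auto simp: A_def \<alpha>_def)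
  have cm: "0 \<le> cm" "cm \<le> 2 * c" using A by (auto simp: cm_def)
  have finP: "finite P" using S by (simp add: P_def)
  \<comment> \<open>As \<open>cm\<close> is at most \<open>2 * c\<close>, the reserve for
    \<open>card S\<close> eliminations is at most \<open>8 * c\<^sup>2 * card S / s\<^sup>2\<close>.
    This is where the constant 8 in \<open>\<alpha>\<close> comes from.\<close>
  have \<theta>: "card S * (2 * cm\<^sup>2 / s\<^sup>2) \<le> A"
  proof -
    have "cm\<^sup>2 \<le> (2 * c)\<^sup>2" using cm by (intro power_mono) auto
    then have "card S * (2 * cm\<^sup>2 / s\<^sup>2) \<le> card S * (2 * (2 * c)\<^sup>2 / s\<^sup>2)"
      by (intro mult_left_mono divide_right_mono) auto
    also have "\<dots> = A" by (simp add: A_def \<alpha>_def power2_eq_square)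
    finally show ?thesis .
  qed
  \<comment> \<open>The product over all pairs of the two-term mixture is expanded. \<open>X\<close>
    is the set of pairs that choose the Gaussian term and \<open>w X\<close> its binomial weight, so
    each summand is an exponential with coefficients \<open>A + c\<close> on \<open>X\<close> and
    \<open>A\<close> elsewhere.\<close>
  define cX where "cX = (\<lambda>(X :: (nat \<times> nat) set) i j. A + c * indicator X (i, j))"
  define w where "w = (\<lambda>X. \<kappa> ^ card X * (1 - \<kappa>) ^ card (P - X))"
  let ?g = "\<lambda>x e. case e of (i, j) \<Rightarrow> G (x i) (x j)"
  define f where "f = (\<lambda>X x. exp (b * (\<Sum>(i,j)\<in>P. G (x i) (x j)) - (\<Sum>(i,j)\<in>P. cX X i j * (G (x i) (x j))\<^sup>2)))"
  have pointwise: "(\<Prod>(i,j)\<in>P. max 0 (1 + b * G (x i) (x j))) \<le> (\<Sum>X\<in>Pow P. w X * f X x)"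
    if x: "x \<in> space (Pi\<^sub>M S (\<lambda>_. \<mu>))" for x
  proof -
    have "(\<Prod>(i,j)\<in>P. max 0 (1 + b * G (x i) (x j)))
        \<le> (\<Prod>e\<in>P. exp (b * ?g x e - A * (?g x e)\<^sup>2) * (\<kappa> * exp (- c * (?g x e)\<^sup>2) + (1 - \<kappa>)))"
    proof (intro prod_mono)
      fix e assume "e \<in> P"
      then obtain i j where e: "e = (i, j)" "i \<in> S" "j \<in> S" by (auto simp: P_def pairs_def)
      then have "\<bar>G (x i) (x j)\<bar> \<le> 2 * s" using x by (intro G_bound) (auto simp: space_PiM)
      from dom[OF this] show "0 \<le> (case e of (i, j) \<Rightarrow> max 0 (1 + b * G (x i) (x j))) \<and>
         (case e of (i, j) \<Rightarrow> max 0 (1 + b * G (x i) (x j)))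
         \<le> exp (b * ?g x e - A * (?g x e)\<^sup>2) * (\<kappa> * exp (- c * (?g x e)\<^sup>2) + (1 - \<kappa>))"
        by (simp add: e(1) A_def[symmetric] exp_add[symmetric])
    qed
    also have "\<dots> = exp (\<Sum>e\<in>P. b * ?g x e - A * (?g x e)\<^sup>2) * (\<Prod>e\<in>P. \<kappa> * exp (- c * (?g x e)\<^sup>2) + (1 - \<kappa>))"
      by (simp add: prod.distrib exp_sum finP)
    also have "(\<Prod>e\<in>P. \<kappa> * exp (- c * (?g x e)\<^sup>2) + (1 - \<kappa>))
        = (\<Sum>X\<in>Pow P. (\<Prod>e\<in>X. \<kappa> * exp (- c * (?g x e)\<^sup>2)) * (\<Prod>e\<in>P - X. 1 - \<kappa>))"
      by (rule prod_add) (rule finP)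
    also have "\<dots> = (\<Sum>X\<in>Pow P. w X * exp (- (\<Sum>e\<in>X. c * (?g x e)\<^sup>2)))"
    proof (intro sum.cong refl)
      fix X assume "X \<in> Pow P"
      then have "finite X" using finP finite_subset by auto
      then show "(\<Prod>e\<in>X. \<kappa> * exp (- c * (?g x e)\<^sup>2)) * (\<Prod>e\<in>P - X. 1 - \<kappa>) = w X * exp (- (\<Sum>e\<in>X. c * (?g x e)\<^sup>2))"
        by (simp add: prod.distrib w_def exp_sum sum_negf[symmetric] mult_ac)
    qed
    also have "exp (\<Sum>e\<in>P. b * ?g x e - A * (?g x e)\<^sup>2) * \<dots> = (\<Sum>X\<in>Pow P. w X * f X x)"
      unfolding sum_distrib_left
    proof (intro sum.cong refl)
      fix X assume X: "X \<in> Pow P"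
      have "(\<Sum>e\<in>X. c * (?g x e)\<^sup>2) = (\<Sum>e\<in>P. c * indicator X e * (?g x e)\<^sup>2)"
        by (rule sum.mono_neutral_cong_left) (use X finP in auto)
      then have "(\<Sum>e\<in>P. b * ?g x e - A * (?g x e)\<^sup>2) + - (\<Sum>e\<in>X. c * (?g x e)\<^sup>2)
          = b * (\<Sum>(i,j)\<in>P. G (x i) (x j)) - (\<Sum>(i,j)\<in>P. cX X i j * (G (x i) (x j))\<^sup>2)"
        by (simp add: cX_def case_prod_beta sum_subtractf sum_distrib_left distrib_right sum.distrib)
      then show "exp (\<Sum>e\<in>P. b * ?g x e - A * (?g x e)\<^sup>2) * (w X * exp (- (\<Sum>e\<in>X. c * (?g x e)\<^sup>2))) = w X * f X x"
        unfolding f_def by (simp only: exp_add[symmetric] mult.left_commute)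
    qed
    finally show ?thesis .
  qed
  have w_nn: "0 \<le> w X" for X using \<kappa> by (simp add: w_def)
  define E where "E = (1 + \<eta>) / 2 * slope_sum s (card S) b + N * (16 * c\<^sup>2 + A)"
  have int: "(\<integral>\<^sup>+x. ennreal (f X x) \<partial>Pi\<^sub>M S (\<lambda>_. \<mu>)) \<le> 2 ^ card S * ennreal (exp (E - (1 - \<eta>) * c * card X))"
    if X: "X \<in> Pow P" for X
  proof -
    have "(\<integral>\<^sup>+x. ennreal (f X x) \<partial>Pi\<^sub>M S (\<lambda>_. \<mu>))
      \<le> 2 ^ card S * ennreal (exp ((1 + \<eta>) / 2 * slope_sum s (card S) b - (1 - \<eta>) * (\<Sum>(i,j)\<in>P. cX X i j)
           + card P * (4 * cm\<^sup>2 + card S * (2 * cm\<^sup>2 / s\<^sup>2))))"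
      unfolding f_def P_def
    proof (rule exp_quadratic_integral_bound[OF S])
      fix i j
      have "cX X i j = A \<or> cX X i j = A + c" by (auto simp: cX_def indicator_def)
      then show "card S * (2 * cm\<^sup>2 / s\<^sup>2) \<le> cX X i j" "cX X i j \<le> cm"
        using \<theta> A by (auto simp: cm_def)
    qed (fact cm)
    also have "\<dots> \<le> 2 ^ card S * ennreal (exp (E - (1 - \<eta>) * c * card X))"
    proof (intro mult_left_mono ennreal_leI exp_le_cancel_iff[THEN iffD2])
      have "(\<Sum>(i,j)\<in>P. cX X i j) = N * A + c * card X"
      proof -
        have "(\<Sum>e\<in>P. c * indicator X e) = (\<Sum>e\<in>X. c)"
          by (rule sum.mono_neutral_cong_right) (use X finP in auto)
        then show ?thesis
          by (simp add: cX_def case_prod_beta sum.distrib N_def)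
      qed
      then have "(1 - \<eta>) * (c * card X) \<le> (1 - \<eta>) * (\<Sum>(i,j)\<in>P. cX X i j)"
        using \<eta>_bounds A by (intro mult_left_mono) auto
      moreover have "card P * (4 * cm\<^sup>2 + card S * (2 * cm\<^sup>2 / s\<^sup>2)) \<le> N * (16 * c\<^sup>2 + A)"
      proof -
        have "cm\<^sup>2 \<le> (2 * c)\<^sup>2" using cm by (intro power_mono) auto
        then have "4 * cm\<^sup>2 + card S * (2 * cm\<^sup>2 / s\<^sup>2) \<le> 16 * c\<^sup>2 + A"
          using \<theta> by (simp add: power_mult_distrib)
        then show ?thesis unfolding N_def by (intro mult_left_mono) auto
      qed
      ultimately show "(1 + \<eta>) / 2 * slope_sum s (card S) b - (1 - \<eta>) * (\<Sum>(i,j)\<in>P. cX X i j)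
           + card P * (4 * cm\<^sup>2 + card S * (2 * cm\<^sup>2 / s\<^sup>2)) \<le> E - (1 - \<eta>) * c * card X"
        unfolding E_def by (simp add: mult.assoc)
    qed auto
    finally show ?thesis .
  qed
  have f_meas [measurable]: "(\<lambda>x. f X x) \<in> borel_measurable (Pi\<^sub>M S (\<lambda>_. \<mu>))" for X
  proof -
    have [measurable]: "(\<lambda>x. \<Sum>(i,j)\<in>P. G (x i) (x j)) \<in> borel_measurable (Pi\<^sub>M S (\<lambda>_. \<mu>))"
      unfolding P_def by (rule sum_pairs_measurable) simp
    have [measurable]: "(\<lambda>x. \<Sum>(i,j)\<in>P. cX X i j * (G (x i) (x j))\<^sup>2) \<in> borel_measurable (Pi\<^sub>M S (\<lambda>_. \<mu>))"
      unfolding P_def by (rule sum_pairs_measurable) simp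
    show ?thesis unfolding f_def by measurable
  qed
  have f_nn: "0 \<le> f X x" for X x by (simp add: f_def)
  have "(\<integral>\<^sup>+x. ennreal (\<Prod>(i,j)\<in>pairs S. max 0 (1 + b * G (x i) (x j))) \<partial>Pi\<^sub>M S (\<lambda>_. \<mu>))
      \<le> (\<integral>\<^sup>+x. (\<Sum>X\<in>Pow P. ennreal (w X) * ennreal (f X x)) \<partial>Pi\<^sub>M S (\<lambda>_. \<mu>))"
  proof (intro nn_integral_mono)
    fix x assume "x \<in> space (Pi\<^sub>M S (\<lambda>_. \<mu>))"
    from pointwise[OF this]
    have "ennreal (\<Prod>(i,j)\<in>P. max 0 (1 + b * G (x i) (x j))) \<le> ennreal (\<Sum>X\<in>Pow P. w X * f X x)"
      by (rule ennreal_leI)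
    also have "\<dots> = (\<Sum>X\<in>Pow P. ennreal (w X) * ennreal (f X x))"
      using w_nn f_nn by (simp add: sum_ennreal[symmetric] ennreal_mult)
    finally show "ennreal (\<Prod>(i,j)\<in>pairs S. max 0 (1 + b * G (x i) (x j))) \<le> (\<Sum>X\<in>Pow P. ennreal (w X) * ennreal (f X x))"
      by (simp add: P_def)
  qed
  also have "\<dots> = (\<Sum>X\<in>Pow P. ennreal (w X) * (\<integral>\<^sup>+x. ennreal (f X x) \<partial>Pi\<^sub>M S (\<lambda>_. \<mu>)))"
    by (subst nn_integral_sum) (auto simp: nn_integral_cmult)
  also have "\<dots> \<le> (\<Sum>X\<in>Pow P. ennreal (w X) * (2 ^ card S * ennreal (exp (E - (1 - \<eta>) * c * card X))))"
    by (intro sum_mono mult_left_mono int) auto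
  also have "\<dots> = (\<Sum>X\<in>Pow P. ennreal (w X * (2 ^ card S * exp (E - (1 - \<eta>) * c * card X))))"
    using w_nn by (simp add: ennreal_mult ennreal_power[symmetric])
  also have "\<dots> = ennreal (\<Sum>X\<in>Pow P. w X * (2 ^ card S * exp (E - (1 - \<eta>) * c * card X)))"
    using w_nn by (intro sum_ennreal) auto
  also have "(\<Sum>X\<in>Pow P. w X * (2 ^ card S * exp (E - (1 - \<eta>) * c * card X)))
      = 2 ^ card S * exp E * (\<kappa> * exp (- ((1 - \<eta>) * c)) + (1 - \<kappa>)) ^ N"
  proof -
    \<comment> \<open>The bound for a summand depends on \<open>X\<close> only through its
      cardinality, so summing with the weights \<open>w\<close> restores an \<open>N\<close>-th
      power.\<close>
    have "(\<kappa> * exp (- ((1 - \<eta>) * c)) + (1 - \<kappa>)) ^ N = (\<Prod>e\<in>P. \<kappa> * exp (- ((1 - \<eta>) * c)) + (1 - \<kappa>))"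
      by (simp add: N_def)
    also have "\<dots> = (\<Sum>X\<in>Pow P. (\<Prod>e\<in>X. \<kappa> * exp (- ((1 - \<eta>) * c))) * (\<Prod>e\<in>P - X. 1 - \<kappa>))"
      by (rule prod_add) (rule finP)
    also have "\<dots> = (\<Sum>X\<in>Pow P. w X * exp (- ((1 - \<eta>) * c * card X)))"
      by (simp add: w_def power_mult_distrib exp_of_nat_mult[symmetric] mult_ac)
    finally show ?thesis
      by (simp add: sum_distrib_left exp_diff exp_minus divide_inverse mult_ac)
  qed
  also have "\<dots> \<le> 2 ^ card S * exp E * exp (- \<kappa> * ((1 - \<eta>) * c - c\<^sup>2 / 2)) ^ N"
  proof (intro mult_left_mono power_mono)
    define x where "x = (1 - \<eta>) * c"
    have x: "0 \<le> x" "x \<le> c" using \<eta>_bounds c by (auto simp: x_def mult_left_le_one_le)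
    have "x - x\<^sup>2 / 2 \<le> 1 - exp (- x)" using exp_minus_le_quadratic[OF x(1)] by simp
    moreover have "x\<^sup>2 \<le> c\<^sup>2" using x by (intro power_mono) auto
    ultimately have "x - c\<^sup>2 / 2 \<le> 1 - exp (- x)" by simp
    then have "\<kappa> * (x - c\<^sup>2 / 2) \<le> \<kappa> * (1 - exp (- x))" using \<kappa> by (intro mult_left_mono) auto
    then have "\<kappa> * exp (- x) + (1 - \<kappa>) \<le> 1 + (- \<kappa> * (x - c\<^sup>2 / 2))" by (simp add: algebra_simps)
    also have "\<dots> \<le> exp (- \<kappa> * (x - c\<^sup>2 / 2))" by (rule exp_ge_add_one_self)
    finally show "\<kappa> * exp (- ((1 - \<eta>) * c)) + (1 - \<kappa>) \<le> exp (- \<kappa> * ((1 - \<eta>) * c - c\<^sup>2 / 2))"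
      by (simp add: x_def)
  qed (use \<kappa> in auto)
  also have "\<dots> = 2 ^ card S * exp (E - N * (\<kappa> * ((1 - \<eta>) * c - c\<^sup>2 / 2)))"
    by (simp add: exp_of_nat_mult[symmetric] exp_add[symmetric])
  also have "E - N * (\<kappa> * ((1 - \<eta>) * c - c\<^sup>2 / 2)) = (1 + \<eta>) / 2 * slope_sum s (card S) b
          + card (pairs S) * (16 * c\<^sup>2 + \<alpha> (card S) - \<kappa> * ((1 - \<eta>) * c - c\<^sup>2 / 2))"
    by (simp add: E_def A_def N_def P_def algebra_simps)
  finally show ?thesis by (simp add: ennreal_leI)
qed

end

section \<open>Real inequalities\<close>

lemma ln_one_plus_le_cubic:
  assumes "u > -1" shows "ln (1 + u) \<le> u - u\<^sup>2 / 2 + (u::real) ^ 3 / 3"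
proof -
  define f where "f = (\<lambda>u::real. u - u\<^sup>2 / 2 + u ^ 3 / 3 - ln (1 + u))"
  have der: "(f has_real_derivative (x ^ 3 / (1 + x))) (at x)" if "x > -1" for x
    unfolding f_def using that
    by (auto intro!: derivative_eq_intros simp: field_simps power2_eq_square power3_eq_cube)
  have "f 0 \<le> f u"
  proof (cases "u \<ge> 0")
    case True
    then show ?thesis
    proof (rule DERIV_nonneg_imp_nondecreasing)
      fix x assume "0 \<le> x" "x \<le> u"
      then show "\<exists>y. (f has_real_derivative y) (at x) \<and> 0 \<le> y"
        by (intro exI[of _ "x ^ 3 / (1 + x)"]) (auto intro!: der)
    qed
  next
    case False
    then have "u \<le> 0" by simp
    then show ?thesis
    proof (rule DERIV_nonpos_imp_nonincreasing)
      fix x assume "u \<le> x" "x \<le> 0"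
      then have "x > -1" "x ^ 3 \<le> 0" using assms by (auto simp: power3_eq_cube mult_nonneg_nonpos mult_nonpos_nonpos)
      then show "\<exists>y. (f has_real_derivative y) (at x) \<and> y \<le> 0"
        by (intro exI[of _ "x ^ 3 / (1 + x)"]) (auto intro!: der divide_nonpos_pos)
    qed
  qed
  then show ?thesis by (simp add: f_def)
qed

text \<open>Near zero \<open>ln (1 + u)\<close> lies about \<open>u\<^sup>2 / 2\<close> below
  \<open>u\<close>, which admits a mixture whose second-order coefficient
  \<open>\<kappa> * a\<close> is just under \<open>1/2\<close>. Away from zero a constant loss
  suffices, because the mixture never falls below \<open>1 - \<kappa>\<close>. The product
  \<open>\<kappa> * a\<close> is prescribed because it decides how well the second-order terms
  cancel later. The variable \<open>y\<close> is room for an extra factor, to be filled with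
  \<open>\<alpha> * g\<^sup>2\<close>.\<close>

lemma soft_edge_domination:
  fixes \<eta> :: real
  assumes "0 < \<eta>" "\<eta> < 1"
  obtains \<kappa> a \<tau> :: real where "0 < \<kappa>" "\<kappa> < 1" "0 < a" "\<kappa> * a = (1 - \<eta>) / 2" "0 < \<tau>"
    "\<And>u y. y \<le> \<eta> / 6 * u\<^sup>2 \<Longrightarrow> y \<le> \<tau> * \<bar>u\<bar> \<Longrightarrow>
       max 0 (1 + u) * exp y \<le> exp u * (\<kappa> * exp (- a * u\<^sup>2) + (1 - \<kappa>))"
proof -
  define u0 where "u0 = \<eta> / 4"
  have u0: "0 < u0" "u0 \<le> 1/4" using assms by (auto simp: u0_def)
  define \<tau> where "\<tau> = u0 / 8"
  \<comment> \<open>Beyond \<open>u0\<close> the exponent \<open>ln (1 + u) + y\<close> stays at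
    least \<open>u0\<^sup>2 / 4\<close> below \<open>u\<close>, and \<open>1 - \<kappa>\<close> is
    the factor for exactly this loss.\<close>
  define \<kappa> where "\<kappa> = 1 - exp (- (u0\<^sup>2 / 4))"
  define a where "a = (1 - \<eta>) / 2 / \<kappa>"
  have \<kappa>: "0 < \<kappa>" "\<kappa> < 1" using u0 by (auto simp: \<kappa>_def)
  have \<kappa>a: "\<kappa> * a = (1 - \<eta>) / 2" using \<kappa> by (simp add: a_def)
  have main: "max 0 (1 + u) * exp y \<le> exp u * (\<kappa> * exp (- a * u\<^sup>2) + (1 - \<kappa>))"
    if y: "y \<le> \<eta> / 6 * u\<^sup>2" "y \<le> \<tau> * \<bar>u\<bar>" for u y
  proof (cases "u > -1")
    case False
    then have "max 0 (1 + u) = 0" by simp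
    moreover have "0 \<le> exp u * (\<kappa> * exp (- a * u\<^sup>2) + (1 - \<kappa>))" using \<kappa> by (intro mult_nonneg_nonneg add_nonneg_nonneg) auto
    ultimately show ?thesis by simp
  next
    case True
    then have lhs: "max 0 (1 + u) * exp y = exp (ln (1 + u) + y)" by (simp add: exp_add)
    show ?thesis
    proof (cases "\<bar>u\<bar> \<le> u0")
      case True
      \<comment> \<open>The cubic term and \<open>y\<close> each cost \<open>\<eta> / 6\<close> of
        the coefficient \<open>1/2\<close>. The third sixth, down to
        \<open>(1 - \<eta>) / 2\<close>, absorbs the quadratic remainder of the exponential.\<close>
      define h where "h = 1/2 - \<eta> / 3"
      have h: "0 \<le> h" "h \<le> 1/2" using assms by (auto simp: h_def)
      have "u ^ 3 \<le> u0 * u\<^sup>2"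
      proof -
        have "u * u\<^sup>2 \<le> u0 * u\<^sup>2" using True by (intro mult_right_mono) auto
        then show ?thesis by (simp add: power3_eq_cube power2_eq_square mult_ac)
      qed
      also have "\<dots> \<le> \<eta> / 2 * u\<^sup>2" using assms by (intro mult_right_mono) (auto simp: u0_def)
      finally have u3: "u ^ 3 / 3 \<le> \<eta> / 6 * u\<^sup>2" by simp
      have "ln (1 + u) + y \<le> u + - (h * u\<^sup>2)"
        using ln_one_plus_le_cubic[OF \<open>u > -1\<close>] u3 y(1) by (simp add: h_def algebra_simps)
      then have "max 0 (1 + u) * exp y \<le> exp u * exp (- (h * u\<^sup>2))"
        unfolding lhs exp_add[symmetric] by simp
      also have "\<dots> \<le> exp u * (\<kappa> * exp (- a * u\<^sup>2) + (1 - \<kappa>))"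
      proof (intro mult_left_mono)
        have "exp (- (h * u\<^sup>2)) \<le> 1 - h * u\<^sup>2 + (h * u\<^sup>2)\<^sup>2 / 2"
          using h by (intro exp_minus_le_quadratic) auto
        also have "\<dots> = 1 - u\<^sup>2 * (h - h\<^sup>2 * u\<^sup>2 / 2)"
          by (simp add: power2_eq_square algebra_simps)
        also have "\<dots> \<le> 1 - u\<^sup>2 * ((1 - \<eta>) / 2)"
        proof -
          have "h\<^sup>2 \<le> (1/2)\<^sup>2" using h by (intro power_mono) auto
          moreover have "u\<^sup>2 \<le> u0\<^sup>2" using True by (metis abs_le_square_iff abs_of_pos u0(1))
          ultimately have "h\<^sup>2 * u\<^sup>2 \<le> (1/2)\<^sup>2 * u0\<^sup>2" by (intro mult_mono) auto
          also have "\<dots> \<le> \<eta> / 3"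
          proof -
            have "\<eta> * \<eta> \<le> \<eta> * 1" using assms by (intro mult_left_mono) auto
            then show ?thesis using assms by (simp add: u0_def power2_eq_square)
          qed
          finally have "(1 - \<eta>) / 2 \<le> h - h\<^sup>2 * u\<^sup>2 / 2" by (simp add: h_def field_simps)
          then have "u\<^sup>2 * ((1 - \<eta>) / 2) \<le> u\<^sup>2 * (h - h\<^sup>2 * u\<^sup>2 / 2)" by (intro mult_left_mono) auto
          then show ?thesis by simp
        qed
        also have "\<dots> = 1 - \<kappa> * (a * u\<^sup>2)" 
          using arg_cong[OF \<kappa>a, of "\<lambda>z. z * u\<^sup>2"] by (simp add: algebra_simps)
        also have "\<dots> \<le> 1 - \<kappa> * (1 - exp (- a * u\<^sup>2))"
          using exp_ge_add_one_self[of "- a * u\<^sup>2"] \<kappa> by (intro diff_left_mono mult_left_mono) auto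
        finally show "exp (- (h * u\<^sup>2)) \<le> \<kappa> * exp (- a * u\<^sup>2) + (1 - \<kappa>)" by (simp add: algebra_simps)
      qed auto
      finally show ?thesis .
    next
      case False
      have "ln (1 + u) + y \<le> u - u0\<^sup>2 / 4"
      proof (cases "u > 0")
        case True
        then have u: "u > u0" using False by simp
        \<comment> \<open>The tangent of the logarithm at \<open>u0\<close> has slope
          \<open>1 / (1 + u0)\<close>, which is at most \<open>1 - \<tau>\<close>; the difference to
          slope 1 leaves room for \<open>y\<close>.\<close>
        have "ln (1 + u) = ln (1 + u0) + ln ((1 + u) / (1 + u0))"
          using u u0 by (simp add: ln_div)
        also have "ln ((1 + u) / (1 + u0)) \<le> (1 + u) / (1 + u0) - 1"
          using u u0 by (intro ln_le_minus_one) auto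
        also have "\<dots> = (u - u0) / (1 + u0)" using u0 by (simp add: field_simps)
        also have "(u - u0) / (1 + u0) \<le> (u - u0) * (1 - \<tau>)"
        proof -
          have "1 \<le> (1 - \<tau>) * (1 + u0)"
          proof -
            have "u0 * u0 \<le> u0 * 1" using u0 by (intro mult_left_mono) auto
            then show ?thesis using u0 by (simp add: \<tau>_def algebra_simps)
          qed
          then have "1 / (1 + u0) \<le> 1 - \<tau>" using u0 by (simp add: divide_le_eq)
          then have "(u - u0) * (1 / (1 + u0)) \<le> (u - u0) * (1 - \<tau>)" using u by (intro mult_left_mono) auto
          then show ?thesis by simp
        qed
        also have "ln (1 + u0) \<le> u0 - u0\<^sup>2 / 2 + u0 ^ 3 / 3"
          using u0 by (intro ln_one_plus_le_cubic) auto
        also have "u0 ^ 3 / 3 \<le> u0\<^sup>2 / 8"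
        proof -
          have "u0\<^sup>2 * u0 \<le> u0\<^sup>2 * (1/4)" using u0 by (intro mult_left_mono) auto
          moreover have "0 \<le> u0\<^sup>2" "u0 ^ 3 = u0\<^sup>2 * u0" by (auto simp: power3_eq_cube power2_eq_square)
          ultimately show ?thesis by linarith
        qed
        finally have "ln (1 + u) \<le> u0 - u0\<^sup>2 / 2 + u0\<^sup>2 / 8 + (u - u0) * (1 - \<tau>)" by simp
        moreover have "y \<le> \<tau> * u" using y(2) True by simp
        moreover have "\<tau> * u0 = u0\<^sup>2 / 8" by (simp add: \<tau>_def power2_eq_square)
        moreover have "(u - u0) * (1 - \<tau>) = u - u0 - \<tau> * u + \<tau> * u0" by (simp add: algebra_simps)
        ultimately show ?thesis by simp
      next
        case False
        then have u: "u < - u0" using \<open>\<not> \<bar>u\<bar> \<le> u0\<close> by simp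
        have "u ^ 3 \<le> 0" using False by (auto simp: power3_eq_cube mult_nonneg_nonpos mult_nonpos_nonpos)
        then have "ln (1 + u) \<le> u - u\<^sup>2 / 2" using ln_one_plus_le_cubic[OF \<open>u > -1\<close>] by linarith
        moreover have "y \<le> \<tau> * (- u)" using y(2) False by simp
        moreover have "u0 * (3 / 8 * u0) \<le> (- u) * ((- u) / 2 - \<tau>)"
          using u u0 by (intro mult_mono) (auto simp: \<tau>_def)
        moreover have "(- u) * ((- u) / 2 - \<tau>) = u\<^sup>2 / 2 - \<tau> * (- u)"
          by (simp add: power2_eq_square algebra_simps)
        moreover have "u0 * (3 / 8 * u0) = 3 / 8 * u0\<^sup>2" by (simp add: power2_eq_square)
        moreover have "0 \<le> u0\<^sup>2" by simp
        ultimately show ?thesis by linarith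
      qed
      then have "max 0 (1 + u) * exp y \<le> exp u * (1 - \<kappa>)"
        unfolding lhs \<kappa>_def by (simp add: exp_add[symmetric])
      also have "\<dots> \<le> exp u * (\<kappa> * exp (- a * u\<^sup>2) + (1 - \<kappa>))"
        using \<kappa> by (intro mult_left_mono) auto
      finally show ?thesis .
    qed
  qed
  show ?thesis
    by (rule that[of \<kappa> a \<tau>]) (use \<kappa> \<kappa>a main u0 assms in \<open>auto simp: a_def \<tau>_def\<close>)
qed

text \<open>In the scale \<open>y = b / s\<close> the recursion is the Euler scheme for the
  differential equation with right-hand side \<open>y\<^sup>2\<close>, whose solution at time
  \<open>m\<close> is \<open>y / (1 - m * y)\<close>. The square of this solution dominates the
  square of the \<open>m\<close>-th slope for either sign, because
  \<open>(1 + y) * (1 - (m + 1) * y)\<close> is at most \<open>1 - m * (y + y\<^sup>2)\<close>. The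
  hypotheses keep \<open>1 + y\<close> positive and stay ahead of the blow-up.\<close>

lemma slope_sum_le_sum:
  assumes "0 < s" "- s < b" "k * b < s"
  shows "slope_sum s k b \<le> (\<Sum>m<k. (real k - 1 - real m) * (b\<^sup>2 / (1 - real m * (b / s))\<^sup>2))"
  using assms
proof (induction k arbitrary: b)
  case (Suc k)
  define y where "y = b / s"
  have b: "b = y * s" using Suc.prems by (simp add: y_def)
  have y: "-1 < y" "Suc k * y < 1"
    using Suc.prems by (auto simp: y_def field_simps)
  define y' where "y' = y + y\<^sup>2"
  have b': "b + b\<^sup>2 / s = y' * s" using Suc.prems(1) by (simp add: b y'_def power2_eq_square algebra_simps)
  have y'_gt: "-1 < y'"
  proof -
    have "0 \<le> (y + 1/2)\<^sup>2" by simp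
    then show ?thesis by (simp add: y'_def power2_eq_square algebra_simps)
  qed
  have y'_le: "k * y' < 1"
  proof (cases "y \<le> 0")
    case True
    have "y' = y * (1 + y)" by (simp add: y'_def power2_eq_square algebra_simps)
    then have "y' \<le> 0" using True y(1) by (simp add: mult_nonpos_nonneg)
    then show ?thesis by (smt (verit) mult_nonneg_nonpos of_nat_0_le_iff)
  next
    case False
    have "k * y < 1 - y" using y(2) by (simp add: algebra_simps)
    then have "(k * y) * (1 + y) < (1 - y) * (1 + y)" using False by (intro mult_strict_right_mono) auto
    also have "\<dots> \<le> 1" by (simp add: algebra_simps)
    finally show ?thesis by (simp add: y'_def power2_eq_square algebra_simps)
  qed
  have IH: "slope_sum s k (y' * s) \<le> (\<Sum>m<k. (real k - 1 - real m) * ((y' * s)\<^sup>2 / (1 - real m * (y' * s / s))\<^sup>2))"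
  proof (rule Suc.IH)
    show "0 < s" by fact
    show "- s < y' * s" using mult_strict_right_mono[OF y'_gt Suc.prems(1)] by simp
    show "k * (y' * s) < s" using mult_strict_right_mono[OF y'_le Suc.prems(1)] by (simp add: mult_ac)
  qed
  have term_le: "(y' * s)\<^sup>2 / (1 - real m * (y' * s / s))\<^sup>2 \<le> (y * s)\<^sup>2 / (1 - real (Suc m) * y)\<^sup>2" if "m < k" for m
  proof -
    have my: "Suc m * y < 1"
    proof (cases "y \<le> 0")
      case True then show ?thesis by (smt (verit) mult_nonneg_nonpos of_nat_0_le_iff)
    next
      case False
      then have "Suc m * y \<le> Suc k * y" using that by (intro mult_right_mono) auto
      then show ?thesis using y by simp
    qed
    have my': "m * y' < 1"
    proof (cases "y' \<le> 0")
      case True then show ?thesis by (smt (verit) mult_nonneg_nonpos of_nat_0_le_iff)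
    next
      case False
      then have "m * y' \<le> k * y'" using that by (intro mult_right_mono) auto
      then show ?thesis using y'_le by simp
    qed
    have "(1 + y) * (1 - real (Suc m) * y) \<le> 1 - m * y'"
      by (simp add: y'_def power2_eq_square algebra_simps)
    then have le: "(1 + y) / (1 - m * y') \<le> 1 / (1 - real (Suc m) * y)"
      using my my' by (simp add: divide_le_eq pos_le_divide_eq mult_ac)
    have "((1 + y) / (1 - m * y'))\<^sup>2 \<le> (1 / (1 - real (Suc m) * y))\<^sup>2"
      using le y(1) my' by (intro power_mono) auto
    then have "(y * s)\<^sup>2 * ((1 + y) / (1 - m * y'))\<^sup>2 \<le> (y * s)\<^sup>2 * (1 / (1 - real (Suc m) * y))\<^sup>2"
      by (intro mult_left_mono) auto
    moreover have "(y' * s)\<^sup>2 = (y * s)\<^sup>2 * (1 + y)\<^sup>2" by (simp add: y'_def power2_eq_square algebra_simps)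
    ultimately show ?thesis using Suc.prems(1) by (simp add: power_divide)
  qed
  have "slope_sum s (Suc k) b = k * b\<^sup>2 + slope_sum s k (y' * s)" by (simp add: b')
  also have "\<dots> \<le> k * b\<^sup>2 + (\<Sum>m<k. (real k - 1 - real m) * ((y * s)\<^sup>2 / (1 - real (Suc m) * y)\<^sup>2))"
    using IH by (intro add_left_mono order_trans[OF IH] sum_mono mult_left_mono term_le) auto
  also have "\<dots> = (\<Sum>m<Suc k. (real (Suc k) - 1 - real m) * (b\<^sup>2 / (1 - real m * (b / s))\<^sup>2))"
    by (subst sum.lessThan_Suc_shift) (simp add: b Suc.prems(1)[THEN less_imp_neq, symmetric] algebra_simps)
  finally show ?case .
qed simp

text \<open>The summand with \<open>b / s\<close> is the triangle term: summing \<open>2 * m\<close>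
  with the weights \<open>k - 1 - m\<close> gives twice the number of triangles, and the factor one
  half in front of \<open>slope_sum\<close> turns it into \<open>b ^ 3 / s\<close> for each of them.
  Its sign is that of \<open>b\<close>, which separates red from blue.\<close>

lemma slope_sum_bound:
  assumes s: "0 < s" and k: "\<bar>b\<bar> * k / s \<le> 1/4"
  shows "slope_sum s k b \<le> b\<^sup>2 * (k * (real k - 1) / 2 * (1 + 6 * (b * k / s)\<^sup>2)
            + b / s * (k * (real k - 1) * (real k - 2)) / 3)"
proof (cases "k = 0")
  case False
  define y where "y = b / s"
  have ky: "k * \<bar>y\<bar> \<le> 1/4" using k s by (simp add: y_def field_simps)
  have "\<bar>y\<bar> \<le> k * \<bar>y\<bar>" using False by (simp add: mult_le_cancel_right1)
  then have y: "\<bar>y\<bar> \<le> 1/4" using ky by simp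
  have b: "b = y * s" using s by (simp add: y_def)
  have "slope_sum s k b \<le> (\<Sum>m<k. (real k - 1 - real m) * (b\<^sup>2 / (1 - real m * (b / s))\<^sup>2))"
  proof (rule slope_sum_le_sum[OF s])
    show "- s < b" using mult_strict_right_mono[of "-1" y s] y s by (simp add: b)
    have "k * y \<le> 1/4" using ky by (smt (verit) mult_left_mono of_nat_0_le_iff)
    then show "k * b < s" using mult_strict_right_mono[of "k * y" 1 s] s by (simp add: b mult_ac)
  qed
  also have "\<dots> \<le> (\<Sum>m<k. (real k - 1 - real m) * (b\<^sup>2 * (1 + 2 * (real m * y) + 6 * (k * y)\<^sup>2)))"
  proof (intro sum_mono mult_left_mono)
    fix m assume m: "m \<in> {..<k}"
    define v where "v = m * y"
    have "\<bar>v\<bar> \<le> k * \<bar>y\<bar>" unfolding v_def abs_mult using m by (intro mult_mono) auto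
    then have v: "\<bar>v\<bar> \<le> 1/4" using ky by simp
    have "v\<^sup>2 \<le> (k * y)\<^sup>2" using \<open>\<bar>v\<bar> \<le> k * \<bar>y\<bar>\<close> by (simp add: abs_le_square_iff[symmetric] abs_mult)
    \<comment> \<open>The coefficient 6 is large enough because
      \<open>(1 + 2 * v + 6 * v\<^sup>2) * (1 - v)\<^sup>2\<close> exceeds 1 by exactly this
      product.\<close>
    have "0 \<le> v\<^sup>2 * (3 - 10 * v + 6 * v\<^sup>2)" using v by (intro mult_nonneg_nonneg) (auto intro!: add_nonneg_nonneg)
    then have "1 \<le> (1 + 2 * v + 6 * v\<^sup>2) * (1 - v)\<^sup>2" by (simp add: power2_eq_square algebra_simps)
    then have "1 / (1 - v)\<^sup>2 \<le> 1 + 2 * v + 6 * v\<^sup>2" using v by (simp add: divide_le_eq)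
    also have "\<dots> \<le> 1 + 2 * v + 6 * (k * y)\<^sup>2" using \<open>v\<^sup>2 \<le> (k * y)\<^sup>2\<close> by simp
    finally have "b\<^sup>2 * (1 / (1 - v)\<^sup>2) \<le> b\<^sup>2 * (1 + 2 * v + 6 * (k * y)\<^sup>2)" by (intro mult_left_mono) auto
    then show "b\<^sup>2 / (1 - real m * (b / s))\<^sup>2 \<le> b\<^sup>2 * (1 + 2 * (real m * y) + 6 * (k * y)\<^sup>2)"
      by (simp add: v_def y_def)
  qed auto
  also have "\<dots> = b\<^sup>2 * (k * (real k - 1) / 2 * (1 + 6 * (k * y)\<^sup>2) + y * (k * (real k - 1) * (real k - 2)) / 3)"
  proof -
    define c where "c = 1 + 6 * (k * y)\<^sup>2"
    have s1: "(\<Sum>m<k. real m) = k * (real k - 1) / 2" by (induction k) (auto simp: algebra_simps add_divide_distrib)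
    have s2: "(\<Sum>m<k. (real m)\<^sup>2) = k * (real k - 1) * (2 * real k - 1) / 6"
      by (induction k) (auto simp: algebra_simps add_divide_distrib power2_eq_square)
    have "(\<Sum>m<k. (real k - 1 - real m) * (c + 2 * (real m * y)))
        = (\<Sum>m<k. (real k - 1) * c + real m * (2 * y * (real k - 1) - c) - (real m)\<^sup>2 * (2 * y))"
      by (intro sum.cong) (auto simp: algebra_simps power2_eq_square)
    also have "\<dots> = k * ((real k - 1) * c) + (\<Sum>m<k. real m) * (2 * y * (real k - 1) - c) - (\<Sum>m<k. (real m)\<^sup>2) * (2 * y)"
      by (simp add: sum.distrib sum_subtractf sum_distrib_right)
    also have "\<dots> = k * (real k - 1) / 2 * c + y * (k * (real k - 1) * (real k - 2)) / 3"
      unfolding s1 s2 by (simp add: field_simps)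
    finally have "b\<^sup>2 * (\<Sum>m<k. (real k - 1 - real m) * (c + 2 * (real m * y)))
       = b\<^sup>2 * (k * (real k - 1) / 2 * c + y * (k * (real k - 1) * (real k - 2)) / 3)" by simp
    then show ?thesis by (simp add: c_def sum_distrib_left mult_ac add_ac)
  qed
  finally show ?thesis by (simp add: y_def mult_ac)
qed simp

text \<open>The claim says that \<open>F\<close> is positive at \<open>p\<close>. Its derivative
  \<open>F'\<close> is 1 minus twice the binary entropy in natural logarithms and decreases on the
  left half of the unit interval, so \<open>F\<close> is concave there. It vanishes at
  \<open>1/2\<close> and in the limit at 0, hence is positive in between. The bound
  \<open>lower\<close> supplies the limit at 0: were \<open>F p\<close> not positive,
  \<open>F\<close> would increase up to \<open>p\<close> and stay below a negative constant near
  0.\<close>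

lemma ratio_times_square_less:
  fixes p :: real
  assumes "0 < p" "p < 1/2"
  shows "ln p / ln (1 - p) * p\<^sup>2 < (1 - p)\<^sup>2"
proof -
  define F where "F = (\<lambda>x::real. x\<^sup>2 * ln x - (1 - x)\<^sup>2 * ln (1 - x))"
  define F' where "F' = (\<lambda>x::real. 1 + 2 * (x * ln x + (1 - x) * ln (1 - x)))"
  have F: "(F has_real_derivative F' x) (at x)" if "0 < x" "x < 1" for x
  proof -
    have "(F has_real_derivative (2 * x * ln x + x\<^sup>2 * (1 / x))
        - (2 * (1 - x) * (-1) * ln (1 - x) + (1 - x)\<^sup>2 * (1 / (1 - x) * (-1)))) (at x)"
      unfolding F_def using that by (auto intro!: derivative_eq_intros)
    moreover have "x\<^sup>2 * (1 / x) = x" "(1 - x)\<^sup>2 * (1 / (1 - x) * (-1)) = - (1 - x)"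
      using that by (auto simp: power2_eq_square)
    ultimately have "(F has_real_derivative (2 * x * ln x + x) - (2 * (1 - x) * (-1) * ln (1 - x) + - (1 - x))) (at x)"
      by (simp only:)
    then show ?thesis by (simp add: F'_def algebra_simps)
  qed
  have F': "(F' has_real_derivative 2 * (ln x - ln (1 - x))) (at x)" if "0 < x" "x < 1" for x
  proof -
    have "(F' has_real_derivative 0 + 2 * ((1 * ln x + x * (1 / x)) + ((-1) * ln (1 - x) + (1 - x) * (1 / (1 - x) * (-1))))) (at x)"
      unfolding F'_def using that by (auto intro!: derivative_eq_intros)
    then show ?thesis using that by simp
  qed
  have F'_dec: "F' y < F' x" if "0 < x" "x < y" "y \<le> 1/2" for x y
  proof -
    have "\<exists>z>x. z < y \<and> F' y - F' x = (y - x) * (2 * (ln z - ln (1 - z)))"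
      by (rule MVT2) (use that in \<open>auto intro!: F' simp del: right_diff_distrib_numeral\<close>)
    then obtain z where z: "x < z" "z < y" "F' y - F' x = (y - x) * (2 * (ln z - ln (1 - z)))" by blast
    have "ln z < ln (1 - z)" using z that by (subst ln_less_cancel_iff) auto
    then have "(y - x) * (2 * (ln z - ln (1 - z))) < 0" using that by (intro mult_pos_neg) auto
    then show ?thesis using z by simp
  qed
  have lower: "- x\<^sup>2 \<le> F x" if "0 < x" "x < 1" for x
  proof -
    have "x\<^sup>2 * (1 - 1 / x) \<le> x\<^sup>2 * ln x"
    proof (intro mult_left_mono)
      show "1 - 1 / x \<le> ln x" using ln_le_minus_one[of "1 / x"] that by (simp add: ln_div)
    qed auto
    moreover have "(1 - x)\<^sup>2 * ln (1 - x) \<le> (1 - x)\<^sup>2 * (- x)"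
      using ln_le_minus_one[of "1 - x"] that by (intro mult_left_mono) auto
    moreover have "x\<^sup>2 * (1 - 1 / x) - (1 - x)\<^sup>2 * (- x) = - x\<^sup>2 + x ^ 3"
      using that by (simp add: power2_eq_square power3_eq_cube field_simps)
    moreover have "0 \<le> x ^ 3" using that by simp
    ultimately show ?thesis unfolding F_def by linarith
  qed
  have "F p > 0"
  proof (rule ccontr)
    assume "\<not> F p > 0"
    then have Fp: "F p \<le> 0" by simp
    have "\<exists>z>p. z < 1/2 \<and> F (1/2) - F p = (1/2 - p) * F' z"
      by (rule MVT2) (use assms in \<open>auto intro!: F\<close>)
    then obtain z where z: "p < z" "z < 1/2" "F (1/2) - F p = (1/2 - p) * F' z" by blast
    have "F (1/2) = 0" by (simp add: F_def)
    then have "0 \<le> (1/2 - p) * F' z" using z Fp by simp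
    then have F'z: "0 \<le> F' z" using assms by (simp add: zero_le_mult_iff)
    have inc: "F x < F y" if "0 < x" "x < y" "y \<le> p" for x y
    proof -
      have "\<exists>w>x. w < y \<and> F y - F x = (y - x) * F' w"
        by (rule MVT2) (use that assms in \<open>auto intro!: F\<close>)
      then obtain w where w: "x < w" "w < y" "F y - F x = (y - x) * F' w" by blast
      have "F' w > 0" using F'_dec[of w z] w that z F'z by simp
      then have "(y - x) * F' w > 0" using that by (intro mult_pos_pos) auto
      then show ?thesis using w by simp
    qed
    define \<delta> where "\<delta> = - F (p / 2)"
    have \<delta>: "\<delta> > 0" using inc[of "p/2" p] Fp assms by (simp add: \<delta>_def)
    define x where "x = min (p / 4) (min \<delta> (1/2))"
    have x: "0 < x" "x < p / 2" "x \<le> \<delta>" "x \<le> 1/2" using \<delta> assms by (auto simp: x_def)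
    have "- x\<^sup>2 \<le> F x" using x by (intro lower) auto
    also have "F x < F (p / 2)" using x assms by (intro inc) auto
    finally have "\<delta> < x\<^sup>2" by (simp add: \<delta>_def)
    moreover have "x * x \<le> x * 1" using x by (intro mult_left_mono) auto
    ultimately show False using x by (simp add: power2_eq_square)
  qed
  then have "(1 - p)\<^sup>2 * ln (1 - p) < p\<^sup>2 * ln p" by (simp add: F_def)
  moreover have "ln (1 - p) < 0" using assms by simp
  ultimately show ?thesis by (simp add: divide_less_eq mult.commute)
qed

section \<open>Random colourings\<close>

lemma pairs_mono: "S \<subseteq> T \<Longrightarrow> pairs S \<subseteq> pairs T"
  by (auto simp: pairs_def)

text \<open>The union bound for independent edges that are red with individual probabilities
  \<open>\<pi> e\<close>. The product measure is the weight \<open>W\<close> on red edge sets;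
  expanding a product over all edges shows that a fixed clique is red or blue with the expected
  weight.\<close>

lemma not_ramsey_prop_weights:
  fixes \<pi> :: "nat \<times> nat \<Rightarrow> real"
  assumes \<pi>: "\<And>e. 0 \<le> \<pi> e" "\<And>e. \<pi> e \<le> 1"
    and less: "(\<Sum>S | S \<subseteq> {..<n} \<and> card S = l. \<Prod>e\<in>pairs S. \<pi> e)
        + (\<Sum>S | S \<subseteq> {..<n} \<and> card S = k. \<Prod>e\<in>pairs S. 1 - \<pi> e) < 1"
  shows "\<not> ramsey_prop l k n"
proof
  assume ramsey: "ramsey_prop l k n"
  define E where "E = pairs {..<n}"
  have finE: "finite E" by (simp add: E_def)
  define W where "W = (\<lambda>R. (\<Prod>e\<in>R. \<pi> e) * (\<Prod>e\<in>E - R. 1 - \<pi> e))"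
  define L where "L = {S. S \<subseteq> {..<n} \<and> card S = l}"
  define K where "K = {S. S \<subseteq> {..<n} \<and> card S = k}"
  have finLK: "finite L" "finite K" by (auto simp: L_def K_def)
  have W_nn: "0 \<le> W R" for R unfolding W_def using \<pi> by (intro mult_nonneg_nonneg prod_nonneg) auto
  have red: "(\<Sum>R\<in>Pow E. W R * of_bool (F \<subseteq> R)) = (\<Prod>e\<in>F. \<pi> e)" if F: "F \<subseteq> E" for F
  proof -
    have "(\<Prod>e\<in>F. \<pi> e) = (\<Prod>e\<in>E. \<pi> e + (if e \<in> F then 0 else 1 - \<pi> e))"
      by (rule prod.mono_neutral_cong_left) (use finE F in auto)
    also have "\<dots> = (\<Sum>R\<in>Pow E. (\<Prod>e\<in>R. \<pi> e) * (\<Prod>e\<in>E - R. if e \<in> F then 0 else 1 - \<pi> e))"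
      by (rule prod_add) (rule finE)
    also have "\<dots> = (\<Sum>R\<in>Pow E. W R * of_bool (F \<subseteq> R))"
    proof (intro sum.cong refl)
      fix R assume "R \<in> Pow E"
      show "(\<Prod>e\<in>R. \<pi> e) * (\<Prod>e\<in>E - R. if e \<in> F then 0 else 1 - \<pi> e) = W R * of_bool (F \<subseteq> R)"
      proof (cases "F \<subseteq> R")
        case True
        then have "(\<Prod>e\<in>E - R. if e \<in> F then 0 else 1 - \<pi> e) = (\<Prod>e\<in>E - R. 1 - \<pi> e)"
          by (intro prod.cong) auto
        then show ?thesis using True by (simp add: W_def)
      next
        case False
        then obtain e where "e \<in> F" "e \<in> E - R" using F by auto
        then have "(\<Prod>e\<in>E - R. if e \<in> F then 0 else 1 - \<pi> e) = 0"
          using finE by (intro prod_zero) auto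
        then show ?thesis using False by simp
      qed
    qed
    finally show ?thesis ..
  qed
  have blue: "(\<Sum>R\<in>Pow E. W R * of_bool (F \<inter> R = {})) = (\<Prod>e\<in>F. 1 - \<pi> e)" if F: "F \<subseteq> E" for F
  proof -
    have "(\<Prod>e\<in>F. 1 - \<pi> e) = (\<Prod>e\<in>E. (if e \<in> F then 0 else \<pi> e) + (1 - \<pi> e))"
      by (rule prod.mono_neutral_cong_left) (use finE F in auto)
    also have "\<dots> = (\<Sum>R\<in>Pow E. (\<Prod>e\<in>R. if e \<in> F then 0 else \<pi> e) * (\<Prod>e\<in>E - R. 1 - \<pi> e))"
      by (rule prod_add) (rule finE)
    also have "\<dots> = (\<Sum>R\<in>Pow E. W R * of_bool (F \<inter> R = {}))"
    proof (intro sum.cong refl)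
      fix R assume R: "R \<in> Pow E"
      show "(\<Prod>e\<in>R. if e \<in> F then 0 else \<pi> e) * (\<Prod>e\<in>E - R. 1 - \<pi> e) = W R * of_bool (F \<inter> R = {})"
      proof (cases "F \<inter> R = {}")
        case True
        then have "(\<Prod>e\<in>R. if e \<in> F then 0 else \<pi> e) = (\<Prod>e\<in>R. \<pi> e)"
          by (intro prod.cong) auto
        then show ?thesis using True by (simp add: W_def)
      next
        case False
        moreover have "finite R" using R finE finite_subset by auto
        ultimately have "(\<Prod>e\<in>R. if e \<in> F then 0 else \<pi> e) = 0"
          by (intro prod_zero) auto
        then show ?thesis using False by simp
      qed
    qed
    finally show ?thesis ..
  qed
  have "1 \<le> (\<Sum>S\<in>L. of_bool (pairs S \<subseteq> R)) + (\<Sum>S\<in>K. of_bool (pairs S \<inter> R = {}) :: real)" for R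
  proof -
    define c where "c = (\<lambda>A::nat set. (Min A, Max A) \<in> R)"
    have c: "c {x, y} \<longleftrightarrow> (x, y) \<in> R" if "x < y" for x y using that by (simp add: c_def)
    from ramsey consider "mono_clique c True n l" | "mono_clique c False n k"
      unfolding ramsey_prop_def by blast
    then show ?thesis
    proof cases
      case 1
      then obtain S where S: "S \<in> L" "\<forall>x\<in>S. \<forall>y\<in>S. x \<noteq> y \<longrightarrow> c {x, y} = True"
        unfolding mono_clique_def L_def by auto
      have "(x, y) \<in> R" if "x \<in> S" "y \<in> S" "x < y" for x y
        using S(2) that c[OF that(3)] by (metis less_irrefl)
      then have "pairs S \<subseteq> R" by (auto simp: pairs_def)
      then have "(1::real) = of_bool (pairs S \<subseteq> R)" by simp
      also have "\<dots> \<le> (\<Sum>S\<in>L. of_bool (pairs S \<subseteq> R))"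
        using S finLK by (intro member_le_sum) auto
      finally show ?thesis by (simp add: add_increasing2 sum_nonneg)
    next
      case 2
      then obtain S where S: "S \<in> K" "\<forall>x\<in>S. \<forall>y\<in>S. x \<noteq> y \<longrightarrow> c {x, y} = False"
        unfolding mono_clique_def K_def by auto
      have "(x, y) \<notin> R" if "x \<in> S" "y \<in> S" "x < y" for x y
        using S(2) that c[OF that(3)] by (metis less_irrefl)
      then have "pairs S \<inter> R = {}" by (auto simp: pairs_def)
      then have "(1::real) = of_bool (pairs S \<inter> R = {})" by simp
      also have "\<dots> \<le> (\<Sum>S\<in>K. of_bool (pairs S \<inter> R = {}))"
        using S finLK by (intro member_le_sum) auto
      finally show ?thesis by (simp add: add_increasing sum_nonneg)
    qed
  qed
  then have "(\<Sum>R\<in>Pow E. W R * 1) \<le> (\<Sum>R\<in>Pow E. W R * ((\<Sum>S\<in>L. of_bool (pairs S \<subseteq> R)) + (\<Sum>S\<in>K. of_bool (pairs S \<inter> R = {}))))"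
    using W_nn by (intro sum_mono mult_left_mono) auto
  also have "\<dots> = (\<Sum>R\<in>Pow E. \<Sum>S\<in>L. W R * of_bool (pairs S \<subseteq> R)) + (\<Sum>R\<in>Pow E. \<Sum>S\<in>K. W R * of_bool (pairs S \<inter> R = {}))"
    by (simp only: distrib_left sum.distrib sum_distrib_left)
  also have "\<dots> = (\<Sum>S\<in>L. \<Sum>R\<in>Pow E. W R * of_bool (pairs S \<subseteq> R)) + (\<Sum>S\<in>K. \<Sum>R\<in>Pow E. W R * of_bool (pairs S \<inter> R = {}))"
    by (intro arg_cong2[of _ _ _ _ "(+)"] sum.swap)
  also have "\<dots> = (\<Sum>S\<in>L. \<Prod>e\<in>pairs S. \<pi> e) + (\<Sum>S\<in>K. \<Prod>e\<in>pairs S. 1 - \<pi> e)"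
    by (intro arg_cong2[of _ _ _ _ "(+)"] sum.cong refl red blue) (auto simp: L_def K_def E_def intro!: pairs_mono)
  also have "\<dots> < 1" using less by (simp add: L_def K_def)
  finally show False using red[of "{}"] by simp
qed

section \<open>Lower bounds for the least element\<close>

lemma ramsey_prop_mono:
  assumes "ramsey_prop l k m" "m \<le> n" shows "ramsey_prop l k n"
proof -
  have "{..<m} \<subseteq> {..<n}" using assms(2) by auto
  then have "mono_clique c col m j \<Longrightarrow> mono_clique c col n j" for c col j
    unfolding mono_clique_def by (elim exE conjE) (rule exI, intro conjI, rule subset_trans)
  then show ?thesis using assms(1) unfolding ramsey_prop_def by blast
qed

text \<open>Ramsey's theorem for graphs guarantees that the \<open>LEAST\<close> in the definition
  is attained.\<close>

lemma ramsey_prop_exists: "\<exists>n. ramsey_prop l k n"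
proof -
  obtain r where r: "\<And>(V::nat set) E. finite V \<Longrightarrow> r \<le> card V \<Longrightarrow>
      \<exists>R\<subseteq>V. card R = l \<and> clique R E \<or> card R = k \<and> indep R E"
    using ramsey2[of l k] by blast
  have "mono_clique c True r l \<or> mono_clique c False r k" for c
  proof -
    obtain R where R: "R \<subseteq> {..<r}" "card R = l \<and> clique R {A. c A} \<or> card R = k \<and> indep R {A. c A}"
      using r[of "{..<r}" "{A. c A}"] by auto
    then show ?thesis unfolding mono_clique_def clique_def indep_def by auto
  qed
  then show ?thesis unfolding ramsey_prop_def by blast
qed

lemma less_ramsey_number:
  assumes "\<not> ramsey_prop l k n" shows "n < ramsey_number l k"
proof (rule ccontr)
  assume "\<not> n < ramsey_number l k"
  moreover have "ramsey_prop l k (ramsey_number l k)"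
    unfolding ramsey_number_def using ramsey_prop_exists by (rule LeastI_ex)
  ultimately show False using ramsey_prop_mono assms by (meson not_less)
qed

section \<open>First moment over the vectors and the edge colours\<close>

context latent_kernel
begin

lemma nn_integral_restrict_coordinates:
  fixes n :: nat
  assumes S: "S \<subseteq> {..<n}" and f: "f \<in> borel_measurable (Pi\<^sub>M S (\<lambda>_. \<mu>))"
    and dep: "\<And>x. f (restrict x S) = f x"
  shows "(\<integral>\<^sup>+x. f x \<partial>Pi\<^sub>M {..<n} (\<lambda>_. \<mu>)) = (\<integral>\<^sup>+x. f x \<partial>Pi\<^sub>M S (\<lambda>_. \<mu>))"
proof -
  interpret product_prob_space "\<lambda>_::nat. \<mu>" "{..<n}" ..
  have "finite S" using S finite_subset by auto
  then have "(\<integral>\<^sup>+x. f x \<partial>Pi\<^sub>M S (\<lambda>_. \<mu>)) = (\<integral>\<^sup>+x. f x \<partial>distr (Pi\<^sub>M {..<n} (\<lambda>_. \<mu>)) (Pi\<^sub>M S (\<lambda>_. \<mu>)) (\<lambda>x. restrict x S))"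
    using S by (subst distr_PiM_restrict_finite) auto
  also have "\<dots> = (\<integral>\<^sup>+x. f (restrict x S) \<partial>Pi\<^sub>M {..<n} (\<lambda>_. \<mu>))"
    by (rule nn_integral_distr) (use S f in \<open>auto intro: measurable_restrict_subset\<close>)
  finally show ?thesis by (simp add: dep)
qed

text \<open>Edges become independent once the vectors are fixed. If the expected number of bad
  cliques is below 1 on average over the vectors, some choice of vectors has a conditional
  expectation below 1, and the union bound for independent edges applies to it.\<close>

theorem not_ramsey_prop_soft:
  fixes p t A B :: real
  assumes p: "0 < p" "p < 1" and AB: "0 \<le> A" "0 \<le> B"
    and red: "\<And>S. finite S \<Longrightarrow> card S = l \<Longrightarrow>
      (\<integral>\<^sup>+x. ennreal (\<Prod>(i,j)\<in>pairs S. max 0 (1 + (- t) * G (x i) (x j))) \<partial>Pi\<^sub>M S (\<lambda>_. \<mu>)) \<le> ennreal A"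
    and blue: "\<And>S. finite S \<Longrightarrow> card S = k \<Longrightarrow>
      (\<integral>\<^sup>+x. ennreal (\<Prod>(i,j)\<in>pairs S. max 0 (1 + (p * t / (1 - p)) * G (x i) (x j))) \<partial>Pi\<^sub>M S (\<lambda>_. \<mu>)) \<le> ennreal B"
    and less: "real n ^ l * (exp (l * (real l - 1) / 2 * ln p) * A)
             + real n ^ k * (exp (k * (real k - 1) / 2 * ln (1 - p)) * B) < 1"
  shows "\<not> ramsey_prop l k n"
proof -
  \<comment> \<open>Clipping is harmless for both colours, since clipping at 1 only lowers
    \<open>h\<close> and clipping at 0 only lowers \<open>1 - h\<close>. Writing
    \<open>1 - p * (1 - t * g)\<close> with the factor \<open>1 - p\<close> in front gives blue the
    slope \<open>p * t / (1 - p)\<close>.\<close>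
  define h where "h = (\<lambda>g::real. min 1 (max 0 (p * (1 + (- t) * g))))"
  have h01: "0 \<le> h g" "h g \<le> 1" for g by (auto simp: h_def)
  have h_red: "h g \<le> p * max 0 (1 + (- t) * g)" for g
  proof -
    have "h g \<le> max 0 (p * (1 + (- t) * g))" by (simp add: h_def)
    also have "\<dots> = p * max 0 (1 + (- t) * g)" using p by (simp add: max_mult_distrib_left)
    finally show ?thesis .
  qed
  have h_blue: "1 - h g \<le> (1 - p) * max 0 (1 + (p * t / (1 - p)) * g)" for g
  proof -
    have "1 - h g \<le> max 0 (1 - p * (1 + (- t) * g))" by (auto simp: h_def)
    also have "1 - p * (1 + (- t) * g) = (1 - p) * (1 + (p * t / (1 - p)) * g)"
      using p by (simp add: field_simps)
    also have "max 0 \<dots> = (1 - p) * max 0 (1 + (p * t / (1 - p)) * g)" using p by (simp add: max_mult_distrib_left)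
    finally show ?thesis .
  qed
  define \<pi> where "\<pi> = (\<lambda>x e. h (case e of (i, j) \<Rightarrow> G (x (i::nat)) (x (j::nat))))"
  define V where "V = Pi\<^sub>M {..<n} (\<lambda>_. \<mu>)"
  interpret V: prob_space V unfolding V_def by (intro prob_space_PiM prob_space_axioms)
  have [measurable]: "h \<in> borel_measurable borel" unfolding h_def by measurable
  have meas: "(\<lambda>x. ennreal (\<Prod>(i,j)\<in>pairs S. f (G (x i) (x j)))) \<in> borel_measurable (Pi\<^sub>M T (\<lambda>_. \<mu>))"
    if f: "f \<in> borel_measurable borel" and "S \<subseteq> T" for f :: "real \<Rightarrow> real" and S T
  proof -
    have "(\<lambda>x. \<Prod>(i,j)\<in>pairs S. f (G (x i) (x j))) \<in> borel_measurable (Pi\<^sub>M T (\<lambda>_. \<mu>))"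
    proof (intro borel_measurable_prod)
      fix e assume e: "e \<in> pairs S"
      obtain i j where ij: "e = (i, j)" by force
      have "i \<in> T" "j \<in> T" using e ij that by (auto simp: pairs_def)
      then show "(\<lambda>x. case e of (i, j) \<Rightarrow> f (G (x i) (x j))) \<in> borel_measurable (Pi\<^sub>M T (\<lambda>_. \<mu>))"
        using measurable_compose[OF G_pair_measurable f] ij by simp
    qed
    then show ?thesis by measurable
  qed
  have marginal: "(\<integral>\<^sup>+x. ennreal (\<Prod>(i,j)\<in>pairs S. f (G (x i) (x j))) \<partial>V) \<le> ennreal (exp (k * (real k - 1) / 2 * ln q) * C)"
    if S: "S \<subseteq> {..<n}" "card S = k" and q: "0 < q"
      and le: "\<And>g. 0 \<le> f g \<and> f g \<le> q * max 0 (1 + b * g)" and f: "f \<in> borel_measurable borel"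
      and C: "(\<integral>\<^sup>+x. ennreal (\<Prod>(i,j)\<in>pairs S. max 0 (1 + b * G (x i) (x j))) \<partial>Pi\<^sub>M S (\<lambda>_. \<mu>)) \<le> ennreal C" "0 \<le> C"
    for S q f b C k
  proof -
    have finS: "finite S" using S finite_subset by auto
    have "(\<integral>\<^sup>+x. ennreal (\<Prod>(i,j)\<in>pairs S. f (G (x i) (x j))) \<partial>V)
        = (\<integral>\<^sup>+x. ennreal (\<Prod>(i,j)\<in>pairs S. f (G (x i) (x j))) \<partial>Pi\<^sub>M S (\<lambda>_. \<mu>))"
      unfolding V_def
    proof (rule nn_integral_restrict_coordinates[OF S(1)])
      show "ennreal (\<Prod>(i,j)\<in>pairs S. f (G (restrict x S i) (restrict x S j)))
          = ennreal (\<Prod>(i,j)\<in>pairs S. f (G (x i) (x j)))" for x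
        by (intro arg_cong[of _ _ ennreal] prod.cong) (auto simp: pairs_def)
    qed (rule meas[OF f order_refl])
    also have "\<dots> \<le> (\<integral>\<^sup>+x. ennreal (q ^ card (pairs S)) * ennreal (\<Prod>(i,j)\<in>pairs S. max 0 (1 + b * G (x i) (x j))) \<partial>Pi\<^sub>M S (\<lambda>_. \<mu>))"
    proof (intro nn_integral_mono)
      fix x
      have "(\<Prod>(i,j)\<in>pairs S. f (G (x i) (x j))) \<le> (\<Prod>(i,j)\<in>pairs S. q * max 0 (1 + b * G (x i) (x j)))"
        using le by (intro prod_mono) auto
      also have "\<dots> = q ^ card (pairs S) * (\<Prod>(i,j)\<in>pairs S. max 0 (1 + b * G (x i) (x j)))"
        by (simp add: case_prod_beta prod.distrib)
      finally show "ennreal (\<Prod>(i,j)\<in>pairs S. f (G (x i) (x j)))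
          \<le> ennreal (q ^ card (pairs S)) * ennreal (\<Prod>(i,j)\<in>pairs S. max 0 (1 + b * G (x i) (x j)))"
        using q by (subst ennreal_mult'[symmetric]) (auto intro: ennreal_leI)
    qed
    also have "\<dots> = ennreal (q ^ card (pairs S)) * (\<integral>\<^sup>+x. ennreal (\<Prod>(i,j)\<in>pairs S. max 0 (1 + b * G (x i) (x j))) \<partial>Pi\<^sub>M S (\<lambda>_. \<mu>))"
      by (intro nn_integral_cmult meas) auto
    also have "\<dots> \<le> ennreal (q ^ card (pairs S)) * ennreal C"
      by (intro mult_left_mono C) auto
    also have "\<dots> = ennreal (q ^ card (pairs S) * C)" using q by (simp add: ennreal_mult')
    also have "q ^ card (pairs S) = exp (card (pairs S) * ln q)" using q by (simp add: exp_of_nat_mult)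
    also have "real (card (pairs S)) = k * (real k - 1) / 2" using card_pairs[OF finS] S by simp
    finally show ?thesis .
  qed
  define L where "L = {S. S \<subseteq> {..<n} \<and> card S = l}"
  define K where "K = {S. S \<subseteq> {..<n} \<and> card S = k}"
  have finLK: "finite L" "finite K" by (auto simp: L_def K_def)
  have card_le: "real (card {S. S \<subseteq> {..<n} \<and> card S = m}) \<le> real n ^ m" for m
  proof -
    have "card {S. S \<subseteq> {..<n} \<and> card S = m} = n choose m" by (simp add: n_subsets)
    then show ?thesis by (metis binomial_le_pow2 binomial_le_pow binomial_eq_0 of_nat_power of_nat_le_iff not_le zero_le)
  qed
  have "\<exists>x\<in>space V. (\<Sum>S\<in>L. \<Prod>e\<in>pairs S. \<pi> x e) + (\<Sum>S\<in>K. \<Prod>e\<in>pairs S. 1 - \<pi> x e) < 1"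
  proof (rule ccontr)
    assume "\<not> ?thesis"
    then have ge: "1 \<le> (\<Sum>S\<in>L. \<Prod>e\<in>pairs S. \<pi> x e) + (\<Sum>S\<in>K. \<Prod>e\<in>pairs S. 1 - \<pi> x e)" if "x \<in> space V" for x
      using that by (auto simp: not_less)
    let ?R = "\<lambda>S x. ennreal (\<Prod>(i,j)\<in>pairs S. h (G (x i) (x j)))"
    let ?B = "\<lambda>S x. ennreal (\<Prod>(i,j)\<in>pairs S. 1 - h (G (x i) (x j)))"
    have mR: "?R S \<in> borel_measurable V" if "S \<in> L" for S
      unfolding V_def using that by (intro meas) (auto simp: L_def)
    have mB: "?B S \<in> borel_measurable V" if "S \<in> K" for S
      unfolding V_def using that by (intro meas[of "\<lambda>g. 1 - h g"]) (auto simp: K_def)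
    have "1 = (\<integral>\<^sup>+x. 1 \<partial>V)" by (simp add: V.emeasure_space_1)
    also have "\<dots> \<le> (\<integral>\<^sup>+x. (\<Sum>S\<in>L. ?R S x) + (\<Sum>S\<in>K. ?B S x) \<partial>V)"
    proof (intro nn_integral_mono)
      fix x assume "x \<in> space V"
      then have "ennreal 1 \<le> ennreal ((\<Sum>S\<in>L. \<Prod>e\<in>pairs S. \<pi> x e) + (\<Sum>S\<in>K. \<Prod>e\<in>pairs S. 1 - \<pi> x e))"
        by (intro ennreal_leI ge)
      also have "\<dots> = ennreal (\<Sum>S\<in>L. \<Prod>e\<in>pairs S. \<pi> x e) + ennreal (\<Sum>S\<in>K. \<Prod>e\<in>pairs S. 1 - \<pi> x e)"
        by (intro ennreal_plus sum_nonneg prod_nonneg) (auto simp: \<pi>_def h01)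
      also have "\<dots> = (\<Sum>S\<in>L. ennreal (\<Prod>e\<in>pairs S. \<pi> x e)) + (\<Sum>S\<in>K. ennreal (\<Prod>e\<in>pairs S. 1 - \<pi> x e))"
        by (intro arg_cong2[of _ _ _ _ "(+)"] sum_ennreal[symmetric] prod_nonneg) (auto simp: \<pi>_def h01)
      finally show "1 \<le> (\<Sum>S\<in>L. ?R S x) + (\<Sum>S\<in>K. ?B S x)"
        by (simp add: \<pi>_def case_prod_beta)
    qed
    also have "\<dots> = (\<Sum>S\<in>L. \<integral>\<^sup>+x. ?R S x \<partial>V) + (\<Sum>S\<in>K. \<integral>\<^sup>+x. ?B S x \<partial>V)"
      by (subst nn_integral_add) (auto simp: nn_integral_sum mR mB intro!: borel_measurable_sum mR mB)
    also have "\<dots> \<le> (\<Sum>S\<in>L. ennreal (exp (l * (real l - 1) / 2 * ln p) * A)) + (\<Sum>S\<in>K. ennreal (exp (k * (real k - 1) / 2 * ln (1 - p)) * B))"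
    proof (intro add_mono sum_mono)
      fix S assume "S \<in> L"
      then have S: "S \<subseteq> {..<n}" "card S = l" by (auto simp: L_def)
      show "(\<integral>\<^sup>+x. ?R S x \<partial>V) \<le> ennreal (exp (l * (real l - 1) / 2 * ln p) * A)"
        by (rule marginal[OF S p(1) _ _ red]) (use h01 h_red S AB finite_subset[OF S(1)] in auto)
    next
      fix S assume "S \<in> K"
      then have S: "S \<subseteq> {..<n}" "card S = k" by (auto simp: K_def)
      show "(\<integral>\<^sup>+x. ?B S x \<partial>V) \<le> ennreal (exp (k * (real k - 1) / 2 * ln (1 - p)) * B)"
        by (rule marginal[OF S _ _ _ blue]) (use h01 h_blue S AB p finite_subset[OF S(1)] in auto)
    qed
    also have "\<dots> = ennreal (card L * (exp (l * (real l - 1) / 2 * ln p) * A) + card K * (exp (k * (real k - 1) / 2 * ln (1 - p)) * B))"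
      using AB by (simp add: ennreal_plus ennreal_mult ennreal_of_nat_eq_real_of_nat)
    also have "\<dots> \<le> ennreal (real n ^ l * (exp (l * (real l - 1) / 2 * ln p) * A) + real n ^ k * (exp (k * (real k - 1) / 2 * ln (1 - p)) * B))"
      unfolding L_def K_def using AB by (intro ennreal_leI add_mono mult_right_mono card_le) auto
    also have "\<dots> < ennreal 1" using less AB by (subst ennreal_less_iff) auto
    finally show False by simp
  qed
  then obtain x where "(\<Sum>S\<in>L. \<Prod>e\<in>pairs S. \<pi> x e) + (\<Sum>S\<in>K. \<Prod>e\<in>pairs S. 1 - \<pi> x e) < 1" by blast
  then show ?thesis
    by (intro not_ramsey_prop_weights[of "\<pi> x"]) (auto simp: \<pi>_def h01 L_def K_def)
qed

end

section \<open>Asymptotics\<close>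

text \<open>The first line is the slope contribution with its triangle term, the second the number
  of pairs times the saving from the mixture, including error terms. The size \<open>k\<close> is
  real so that it can be rescaled by \<open>l\<close>.\<close>

definition clique_exponent :: "real \<Rightarrow> real \<Rightarrow> real \<Rightarrow> real \<Rightarrow> real \<Rightarrow> real \<Rightarrow> real" where
  "clique_exponent \<kappa> \<eta> c b s k =
     (1 + \<eta>) / 2 * (b\<^sup>2 * (k * (k - 1) / 2 * (1 + 6 * (b * k / s)\<^sup>2) + b / s * (k * (k - 1) * (k - 2)) / 3))
     + k * (k - 1) / 2 * (16 * c\<^sup>2 + 8 * c\<^sup>2 * k / s\<^sup>2 - \<kappa> * ((1 - \<eta>) * c - c\<^sup>2 / 2))"

text \<open>The choice \<open>c = a * b\<^sup>2\<close> rewrites the Gaussian term in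
  \<open>u = b * g\<close> as one in \<open>g\<close>, and \<open>\<alpha> * g\<^sup>2\<close> takes
  the place of \<open>y\<close>. The linear bound on \<open>y\<close> uses \<open>G_bound\<close> to
  trade one factor \<open>g\<close> for \<open>2 * s\<close>; the last condition on \<open>k\<close>
  is the result.\<close>

lemma (in latent_kernel) soft_clique_integral_le:
  fixes b \<kappa> a \<tau> :: real
  defines "c \<equiv> a * b\<^sup>2"
  assumes S: "finite S" "card S = k"
    and params: "0 < \<kappa>" "\<kappa> < 1" "0 < a" "b \<noteq> 0"
    and dom: "\<And>u y. y \<le> \<eta> / 6 * u\<^sup>2 \<Longrightarrow> y \<le> \<tau> * \<bar>u\<bar> \<Longrightarrow>
       max 0 (1 + u) * exp y \<le> exp u * (\<kappa> * exp (- a * u\<^sup>2) + (1 - \<kappa>))"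
    and k: "\<bar>b\<bar> * k / s \<le> 1/4" "8 * c\<^sup>2 * k / s\<^sup>2 \<le> c" "8 * c\<^sup>2 * k / s\<^sup>2 \<le> \<eta> / 6 * b\<^sup>2"
      "16 * c\<^sup>2 * k / s \<le> \<tau> * \<bar>b\<bar>"
  shows "(\<integral>\<^sup>+x. ennreal (\<Prod>(i,j)\<in>pairs S. max 0 (1 + b * G (x i) (x j))) \<partial>Pi\<^sub>M S (\<lambda>_. \<mu>))
     \<le> ennreal (2 ^ k * exp (clique_exponent \<kappa> \<eta> c b s k))"
proof -
  define \<alpha> where "\<alpha> = 8 * c\<^sup>2 * k / s\<^sup>2"
  have \<alpha>: "0 \<le> \<alpha>" by (simp add: \<alpha>_def)
  have "(\<integral>\<^sup>+x. ennreal (\<Prod>(i,j)\<in>pairs S. max 0 (1 + b * G (x i) (x j))) \<partial>Pi\<^sub>M S (\<lambda>_. \<mu>))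
     \<le> ennreal (2 ^ card S * exp ((1 + \<eta>) / 2 * slope_sum s (card S) b
          + card (pairs S) * (16 * c\<^sup>2 + 8 * c\<^sup>2 * card S / s\<^sup>2 - \<kappa> * ((1 - \<eta>) * c - c\<^sup>2 / 2))))"
  proof (rule soft_clique_integral_bound[OF S(1)])
    fix g :: real assume g: "\<bar>g\<bar> \<le> 2 * s"
    have "max 0 (1 + b * g) * exp (\<alpha> * g\<^sup>2) \<le> exp (b * g) * (\<kappa> * exp (- a * (b * g)\<^sup>2) + (1 - \<kappa>))"
    proof (rule dom)
      have "\<alpha> * g\<^sup>2 \<le> (\<eta> / 6 * b\<^sup>2) * g\<^sup>2"
        using k(3) unfolding \<alpha>_def by (intro mult_right_mono) auto
      then show "\<alpha> * g\<^sup>2 \<le> \<eta> / 6 * (b * g)\<^sup>2" by (simp add: power_mult_distrib)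
      have "\<alpha> * g\<^sup>2 = \<alpha> * \<bar>g\<bar> * \<bar>g\<bar>" by (simp add: power2_eq_square)
      also have "\<dots> \<le> \<alpha> * (2 * s) * \<bar>g\<bar>" using g \<alpha> by (intro mult_right_mono mult_left_mono) auto
      also have "\<alpha> * (2 * s) = 16 * c\<^sup>2 * k / s" using s_pos by (simp add: \<alpha>_def power2_eq_square)
      also have "\<dots> * \<bar>g\<bar> \<le> \<tau> * \<bar>b\<bar> * \<bar>g\<bar>" using k(4) by (intro mult_right_mono) auto
      finally show "\<alpha> * g\<^sup>2 \<le> \<tau> * \<bar>b * g\<bar>" by (simp add: abs_mult)
    qed
    then have "max 0 (1 + b * g) * exp (\<alpha> * g\<^sup>2) * exp (- (\<alpha> * g\<^sup>2))
        \<le> exp (b * g) * (\<kappa> * exp (- a * (b * g)\<^sup>2) + (1 - \<kappa>)) * exp (- (\<alpha> * g\<^sup>2))"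
      by (rule mult_right_mono) simp
    then have "max 0 (1 + b * g) \<le> exp (b * g) * (\<kappa> * exp (- a * (b * g)\<^sup>2) + (1 - \<kappa>)) * exp (- (\<alpha> * g\<^sup>2))"
      by (simp only: mult.assoc exp_minus_inverse mult_1_right)
    then show "max 0 (1 + b * g) \<le> exp (b * g) * exp (- (8 * c\<^sup>2 * card S / s\<^sup>2) * g\<^sup>2) * (\<kappa> * exp (- c * g\<^sup>2) + (1 - \<kappa>))"
      by (simp add: \<alpha>_def S(2) c_def power_mult_distrib mult_ac)
  qed (use params k S in \<open>auto simp: c_def\<close>)
  also have "\<dots> \<le> ennreal (2 ^ k * exp (clique_exponent \<kappa> \<eta> c b s k))"
  proof (intro ennreal_leI mult_mono)
    have "real (card (pairs S)) = k * (real k - 1) / 2" using card_pairs[OF S(1)] S by simp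
    moreover have "(1 + \<eta>) / 2 * slope_sum s k b \<le> (1 + \<eta>) / 2 * (b\<^sup>2 * (k * (real k - 1) / 2 * (1 + 6 * (b * k / s)\<^sup>2)
            + b / s * (k * (real k - 1) * (real k - 2)) / 3))"
      using \<eta>_bounds s_pos k(1) by (intro mult_left_mono slope_sum_bound) auto
    ultimately show "exp ((1 + \<eta>) / 2 * slope_sum s (card S) b
          + card (pairs S) * (16 * c\<^sup>2 + 8 * c\<^sup>2 * card S / s\<^sup>2 - \<kappa> * ((1 - \<eta>) * c - c\<^sup>2 / 2)))
       \<le> exp (clique_exponent \<kappa> \<eta> c b s k)"
      unfolding clique_exponent_def S(2) exp_le_cancel_iff by (simp only: add_right_mono)
  qed (use S in auto)
  finally show ?thesis .
qed

text \<open>Divided by \<open>l\<^sup>2\<close>, the exponent is a rational function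
  \<open>R\<close> of \<open>k / l\<close>, \<open>s / l\<close> and \<open>1 / l\<close>,
  continuous where \<open>s / l\<close> is positive. The limit sets \<open>1 / l\<close> to 0, which
  removes the factor 2 per eliminated vertex but not the triangle term. \<open>L\<close> is the
  logarithm of the base in the lower bound and \<open>Q\<close> that of the edge
  probability.\<close>

lemma clique_exponent_limit:
  fixes k s :: "nat \<Rightarrow> real" and L :: real
  assumes k: "(\<lambda>l. k l / l) \<longlonglongrightarrow> \<gamma>" and s: "(\<lambda>l. s l / l) \<longlonglongrightarrow> \<sigma>" and "0 < \<sigma>"
  shows "(\<lambda>l. (L * real l * k l + k l * (k l - 1) / 2 * Q + k l * ln 2 + clique_exponent \<kappa> \<eta> c b (s l) (k l)) / (real l)\<^sup>2)
    \<longlonglongrightarrow> L * \<gamma> + \<gamma>\<^sup>2 / 2 * Q + \<gamma>\<^sup>2 / 2 * ((1 + \<eta>) / 2 * b\<^sup>2 * (1 + 6 * (b * \<gamma> / \<sigma>)\<^sup>2 + 2 / 3 * (b * \<gamma> / \<sigma>))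
          + 16 * c\<^sup>2 - \<kappa> * ((1 - \<eta>) * c - c\<^sup>2 / 2))"
proof (rule Lim_transform_eventually)
  define x y z where "x = (\<lambda>l::nat. k l / l)" and "y = (\<lambda>l::nat. s l / l)" and "z = (\<lambda>l::nat. 1 / real l)"
  define R where "R = (\<lambda>(x::real) (y::real) (z::real). L * x + x * (x - z) / 2 * Q + x * z * ln 2
      + (1 + \<eta>) / 2 * (b\<^sup>2 * (x * (x - z) / 2 * (1 + 6 * (b * x / y)\<^sup>2) + b / y * (x * (x - z) * (x - 2 * z)) / 3))
      + x * (x - z) / 2 * (16 * c\<^sup>2 + 8 * c\<^sup>2 * x * z / y\<^sup>2 - \<kappa> * ((1 - \<eta>) * c - c\<^sup>2 / 2)))"
  have x: "x \<longlonglongrightarrow> \<gamma>" and y: "y \<longlonglongrightarrow> \<sigma>" and z: "z \<longlonglongrightarrow> 0"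
    using k s lim_1_over_n by (auto simp: x_def y_def z_def)
  have "(\<lambda>l. R (x l) (y l) (z l)) \<longlonglongrightarrow> R \<gamma> \<sigma> 0"
    unfolding R_def using \<open>0 < \<sigma>\<close> by (intro tendsto_intros x y z) auto
  also have "R \<gamma> \<sigma> 0 = L * \<gamma> + \<gamma>\<^sup>2 / 2 * Q + \<gamma>\<^sup>2 / 2 * ((1 + \<eta>) / 2 * b\<^sup>2 * (1 + 6 * (b * \<gamma> / \<sigma>)\<^sup>2 + 2 / 3 * (b * \<gamma> / \<sigma>))
          + 16 * c\<^sup>2 - \<kappa> * ((1 - \<eta>) * c - c\<^sup>2 / 2))"
  proof -
    define v where "v = b * \<gamma> / \<sigma>"
    have "b / \<sigma> * (\<gamma> * (\<gamma> - 0) * (\<gamma> - 2 * 0)) = v * \<gamma>\<^sup>2" by (simp add: v_def power2_eq_square)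
    then have "R \<gamma> \<sigma> 0 = L * \<gamma> + \<gamma> * \<gamma> / 2 * Q + (1 + \<eta>) / 2 * (b\<^sup>2 * (\<gamma> * \<gamma> / 2 * (1 + 6 * v\<^sup>2) + v * \<gamma>\<^sup>2 / 3))
      + \<gamma> * \<gamma> / 2 * (16 * c\<^sup>2 - \<kappa> * ((1 - \<eta>) * c - c\<^sup>2 / 2))"
      unfolding R_def v_def by simp
    then show ?thesis unfolding v_def[symmetric] by (simp add: power2_eq_square algebra_simps add_divide_distrib)
  qed
  finally show "(\<lambda>l. R (x l) (y l) (z l)) \<longlonglongrightarrow> L * \<gamma> + \<gamma>\<^sup>2 / 2 * Q + \<gamma>\<^sup>2 / 2 * ((1 + \<eta>) / 2 * b\<^sup>2 * (1 + 6 * (b * \<gamma> / \<sigma>)\<^sup>2 + 2 / 3 * (b * \<gamma> / \<sigma>))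
          + 16 * c\<^sup>2 - \<kappa> * ((1 - \<eta>) * c - c\<^sup>2 / 2))" .
  have "\<forall>\<^sub>F l in sequentially. 0 < y l" using y \<open>0 < \<sigma>\<close> by (rule order_tendstoD)
  then show "\<forall>\<^sub>F l in sequentially. R (x l) (y l) (z l) =
     (L * real l * k l + k l * (k l - 1) / 2 * Q + k l * ln 2 + clique_exponent \<kappa> \<eta> c b (s l) (k l)) / (real l)\<^sup>2"
    using eventually_gt_at_top[of 0]
  proof eventually_elim
    case (elim l)
    define X Y n where "X = x l" and "Y = y l" and "n = real l"
    have n: "n > 0" and Y: "Y > 0" using elim by (auto simp: n_def Y_def)
    have kl: "k l = X * n" and sl: "s l = Y * n" using n by (auto simp: X_def Y_def x_def y_def n_def)
    have z: "z l = 1 / n" by (simp add: z_def n_def)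
    have e1: "L * n * (X * n) / n\<^sup>2 = L * X" using n by (simp add: power2_eq_square)
    have e2: "X * n * (X * n - 1) / n\<^sup>2 = X * (X - 1 / n)" using n by (simp add: power2_eq_square field_simps)
    have e3: "b * (X * n) / (Y * n) = b * X / Y" using n by simp
    have e4: "b / (Y * n) * (X * n * (X * n - 1) * (X * n - 2)) / n\<^sup>2 = b / Y * (X * (X - 1 / n) * (X - 2 * (1 / n)))"
      using n Y by (simp add: power2_eq_square field_simps)
    have e5: "8 * c\<^sup>2 * (X * n) / (Y * n)\<^sup>2 = 8 * c\<^sup>2 * X * (1 / n) / Y\<^sup>2"
      using n Y by (simp add: power2_eq_square field_simps)
    have e6: "X * n * ln 2 / n\<^sup>2 = X * (1 / n) * ln 2" using n by (simp add: power2_eq_square)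
    define A where "A = X * n * (X * n - 1)"
    define B where "B = b / (Y * n) * (X * n * (X * n - 1) * (X * n - 2))"
    define q where "q = 16 * c\<^sup>2 + 8 * c\<^sup>2 * X * (1 / n) / Y\<^sup>2 - \<kappa> * ((1 - \<eta>) * c - c\<^sup>2 / 2)"
    define r where "r = 1 + 6 * (b * X / Y)\<^sup>2"
    have "(L * n * (X * n) + A / 2 * Q + X * n * ln 2 + ((1 + \<eta>) / 2 * (b\<^sup>2 * (A / 2 * r + B / 3)) + A / 2 * q)) / n\<^sup>2
        = L * n * (X * n) / n\<^sup>2 + (A / n\<^sup>2) / 2 * Q + X * n * ln 2 / n\<^sup>2
          + ((1 + \<eta>) / 2 * (b\<^sup>2 * ((A / n\<^sup>2) / 2 * r + (B / n\<^sup>2) / 3)) + (A / n\<^sup>2) / 2 * q)"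
      by (simp add: add_divide_distrib algebra_simps)
    also have "\<dots> = R X Y (1 / n)"
      unfolding A_def B_def e1 e2 e4 e6 R_def q_def r_def by simp
    finally have fin: "(L * n * (X * n) + A / 2 * Q + X * n * ln 2 + ((1 + \<eta>) / 2 * (b\<^sup>2 * (A / 2 * r + B / 3)) + A / 2 * q)) / n\<^sup>2
        = R X Y (1 / n)" .
    show ?case
      unfolding clique_exponent_def kl sl n_def[symmetric] e3 e5 z X_def[symmetric] Y_def[symmetric]
      by (rule fin[symmetric, unfolded A_def B_def q_def r_def])
  qed
qed

lemma eventually_exp_less_half:
  fixes X :: "nat \<Rightarrow> real"
  assumes "(\<lambda>l. X l / (real l)\<^sup>2) \<longlonglongrightarrow> \<Theta>" "\<Theta> < 0"
  shows "\<forall>\<^sub>F l in sequentially. exp (X l) < 1/2"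
proof -
  have "\<forall>\<^sub>F l in sequentially. X l / (real l)\<^sup>2 < \<Theta> / 2"
    using assms by (intro order_tendstoD[OF assms(1)]) auto
  moreover have "\<forall>\<^sub>F l in sequentially. real l > max 1 (2 * ln 2 / - \<Theta>)"
    by (rule eventually_compose_filterlim[OF eventually_gt_at_top filterlim_real_sequentially])
  ultimately show ?thesis
  proof eventually_elim
    case (elim l)
    have l: "real l > 1" "2 * ln 2 / - \<Theta> < l" using elim by auto
    have "X l < \<Theta> / 2 * (real l)\<^sup>2" using elim(1) l by (simp add: pos_divide_less_eq)
    also have "\<dots> \<le> \<Theta> / 2 * real l"
    proof -
      have "real l * 1 \<le> real l * real l" using l by (intro mult_left_mono) auto
      then show ?thesis using assms(2) by (intro mult_left_mono_neg) (auto simp: power2_eq_square)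
    qed
    also have "\<dots> < - ln 2"
      using l(2) assms(2) by (simp add: divide_less_eq field_simps)
    finally have "exp (X l) < exp (- ln 2)" by simp
    then show ?case by (simp add: exp_minus)
  qed
qed

lemma tendsto_nat_floor_over:
  assumes "0 < (C::real)" shows "(\<lambda>l. real (nat \<lfloor>C * real l\<rfloor>) / real l) \<longlonglongrightarrow> C"
proof (rule tendsto_sandwich[where f = "\<lambda>l. C - 1 / real l" and h = "\<lambda>_. C"])
  show "(\<lambda>l. C - 1 / real l) \<longlonglongrightarrow> C"
    using tendsto_diff[OF tendsto_const lim_1_over_n] by simp
  show "\<forall>\<^sub>F l in sequentially. C - 1 / real l \<le> real (nat \<lfloor>C * real l\<rfloor>) / real l"
    using eventually_gt_at_top[of 0]
  proof eventually_elim
    case (elim l)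
    have "C * l - 1 \<le> real (nat \<lfloor>C * real l\<rfloor>)" by linarith
    then have "(C * l - 1) / l \<le> real (nat \<lfloor>C * real l\<rfloor>) / l" by (rule divide_right_mono) simp
    then show ?case using elim by (simp add: diff_divide_distrib)
  qed
  show "\<forall>\<^sub>F l in sequentially. real (nat \<lfloor>C * real l\<rfloor>) / real l \<le> C"
    using eventually_gt_at_top[of 0]
  proof eventually_elim
    case (elim l)
    have "real (nat \<lfloor>C * real l\<rfloor>) \<le> C * l" using assms by (simp add: of_nat_nat)
    then show ?case using elim by (simp add: field_simps)
  qed
qed (rule tendsto_const)

lemma tendsto_sqrt_nat_ceiling_over:
  assumes "0 < (\<sigma>::real)" shows "(\<lambda>l. sqrt (real (nat \<lceil>(\<sigma> * real l)\<^sup>2\<rceil>)) / real l) \<longlonglongrightarrow> \<sigma>"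
proof (rule tendsto_sandwich[where f = "\<lambda>_. \<sigma>" and h = "\<lambda>l. \<sigma> + 1 / real l"])
  show "(\<lambda>l. \<sigma> + 1 / real l) \<longlonglongrightarrow> \<sigma>"
    using tendsto_add[OF tendsto_const lim_1_over_n] by simp
  show "\<forall>\<^sub>F l in sequentially. \<sigma> \<le> sqrt (real (nat \<lceil>(\<sigma> * real l)\<^sup>2\<rceil>)) / real l"
    using eventually_gt_at_top[of 0]
  proof eventually_elim
    case (elim l)
    have "(\<sigma> * l)\<^sup>2 \<le> real (nat \<lceil>(\<sigma> * real l)\<^sup>2\<rceil>)" by linarith
    then have "\<sigma> * l \<le> sqrt (real (nat \<lceil>(\<sigma> * real l)\<^sup>2\<rceil>))" by (rule real_le_rsqrt)
    then show ?case using elim by (simp add: field_simps)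
  qed
  show "\<forall>\<^sub>F l in sequentially. sqrt (real (nat \<lceil>(\<sigma> * real l)\<^sup>2\<rceil>)) / real l \<le> \<sigma> + 1 / real l"
    using eventually_gt_at_top[of 0]
  proof eventually_elim
    case (elim l)
    have "0 \<le> \<sigma> * l" using assms by simp
    have "real (nat \<lceil>(\<sigma> * real l)\<^sup>2\<rceil>) \<le> (\<sigma> * l)\<^sup>2 + 1"
      by (smt (verit) of_int_ceiling_le_add_one of_nat_nat zero_le_power2 zero_le_ceiling ceiling_less_zero of_nat_0_le_iff nat_0_iff)
    also have "\<dots> \<le> (\<sigma> * l + 1)\<^sup>2" using \<open>0 \<le> \<sigma> * l\<close> by (simp add: power2_eq_square algebra_simps)
    finally have "sqrt (real (nat \<lceil>(\<sigma> * real l)\<^sup>2\<rceil>)) \<le> \<sigma> * l + 1"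
      using \<open>0 \<le> \<sigma> * l\<close> by (intro real_le_lsqrt) auto
    then show ?case using elim by (simp add: field_simps)
  qed
qed (rule tendsto_const)

text \<open>As \<open>k / s\<close> tends to \<open>\<gamma> / \<sigma>\<close> and
  \<open>k / s\<^sup>2\<close> to 0, only the first and last conditions constrain the
  limits.\<close>

lemma eventually_soft_clique_conditions:
  fixes k s :: "nat \<Rightarrow> real"
  assumes k: "(\<lambda>l. k l / l) \<longlonglongrightarrow> \<gamma>" and s: "(\<lambda>l. s l / l) \<longlonglongrightarrow> \<sigma>" and "0 < \<sigma>" "0 < c" "0 < \<delta>"
    and lim: "\<bar>b\<bar> * \<gamma> / \<sigma> < 1/4" "16 * c\<^sup>2 * \<gamma> / \<sigma> < e"
  shows "\<forall>\<^sub>F l in sequentially. \<bar>b\<bar> * k l / s l \<le> 1/4 \<and> 8 * c\<^sup>2 * k l / (s l)\<^sup>2 \<le> c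
      \<and> 8 * c\<^sup>2 * k l / (s l)\<^sup>2 \<le> \<delta> \<and> 16 * c\<^sup>2 * k l / s l \<le> e"
proof -
  have ks: "(\<lambda>l. k l / s l) \<longlonglongrightarrow> \<gamma> / \<sigma>"
  proof (rule Lim_transform_eventually)
    show "(\<lambda>l. (k l / l) / (s l / l)) \<longlonglongrightarrow> \<gamma> / \<sigma>" using \<open>0 < \<sigma>\<close> by (intro tendsto_divide k s) auto
    show "\<forall>\<^sub>F l in sequentially. (k l / l) / (s l / l) = k l / s l"
      using eventually_gt_at_top[of 0] by eventually_elim auto
  qed
  have ks2: "(\<lambda>l. k l / (s l)\<^sup>2) \<longlonglongrightarrow> 0"
  proof (rule Lim_transform_eventually)
    have "(\<lambda>l. (k l / l) / (s l / l)\<^sup>2 * (1 / real l)) \<longlonglongrightarrow> \<gamma> / \<sigma>\<^sup>2 * 0"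
      using \<open>0 < \<sigma>\<close> by (intro tendsto_intros k s lim_1_over_n) auto
    then show "(\<lambda>l. (k l / l) / (s l / l)\<^sup>2 * (1 / real l)) \<longlonglongrightarrow> 0" by simp
    show "\<forall>\<^sub>F l in sequentially. (k l / l) / (s l / l)\<^sup>2 * (1 / real l) = k l / (s l)\<^sup>2"
      using eventually_gt_at_top[of 0] by eventually_elim (simp add: power2_eq_square)
  qed
  have a: "(\<lambda>l. \<bar>b\<bar> * (k l / s l)) \<longlonglongrightarrow> \<bar>b\<bar> * (\<gamma> / \<sigma>)" by (intro tendsto_intros ks)
  have b: "(\<lambda>l. 8 * c\<^sup>2 * (k l / (s l)\<^sup>2)) \<longlonglongrightarrow> 8 * c\<^sup>2 * 0" by (intro tendsto_intros ks2)
  have d: "(\<lambda>l. 16 * c\<^sup>2 * (k l / s l)) \<longlonglongrightarrow> 16 * c\<^sup>2 * (\<gamma> / \<sigma>)" by (intro tendsto_intros ks)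
  have "\<forall>\<^sub>F l in sequentially. \<bar>b\<bar> * (k l / s l) < 1/4" using a lim by (intro order_tendstoD[OF a]) auto
  moreover have "\<forall>\<^sub>F l in sequentially. 8 * c\<^sup>2 * (k l / (s l)\<^sup>2) < c" using assms by (intro order_tendstoD[OF b]) auto
  moreover have "\<forall>\<^sub>F l in sequentially. 8 * c\<^sup>2 * (k l / (s l)\<^sup>2) < \<delta>" using assms by (intro order_tendstoD[OF b]) auto
  moreover have "\<forall>\<^sub>F l in sequentially. 16 * c\<^sup>2 * (k l / s l) < e" using lim by (intro order_tendstoD[OF d]) auto
  ultimately show ?thesis by eventually_elim auto
qed

text \<open>Here \<open>v\<close> is the limit of \<open>b * k / s\<close>. The second-order terms
  \<open>(1 + \<eta>) / 2 * b\<^sup>2\<close> and \<open>\<kappa> * (1 - \<eta>) * c = (1 -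
  \<eta>)\<^sup>2 / 2 * b\<^sup>2\<close> cancel up to \<open>3 / 2 * \<eta> * b\<^sup>2\<close>,
  and the triangle term proportional to \<open>v / 3\<close> becomes dominant. The 17 collects
  \<open>16 * c\<^sup>2\<close> and \<open>\<kappa> * c\<^sup>2 / 2\<close>.\<close>

lemma clique_exponent_limit_le:
  fixes \<kappa> a \<eta> b v :: real
  assumes "\<kappa> * a = (1 - \<eta>) / 2" "\<kappa> < 1"
  shows "(1 + \<eta>) / 2 * b\<^sup>2 * (1 + 6 * v\<^sup>2 + 2 / 3 * v) + 16 * (a * b\<^sup>2)\<^sup>2
      - \<kappa> * ((1 - \<eta>) * (a * b\<^sup>2) - (a * b\<^sup>2)\<^sup>2 / 2)
    \<le> b\<^sup>2 * ((1 + \<eta>) * v / 3 + 3 * (1 + \<eta>) * v\<^sup>2 + 3 / 2 * \<eta> + 17 * a\<^sup>2 * b\<^sup>2)"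
proof -
  define c where "c = a * b\<^sup>2"
  have kc: "\<kappa> * c = (1 - \<eta>) / 2 * b\<^sup>2" using assms by (simp add: c_def mult.assoc[symmetric])
  have "\<kappa> * ((1 - \<eta>) * c - c\<^sup>2 / 2) = (1 - \<eta>) * (\<kappa> * c) - \<kappa> * c\<^sup>2 / 2"
    by (simp add: algebra_simps)
  also have "\<dots> = (1 - \<eta>)\<^sup>2 / 2 * b\<^sup>2 - \<kappa> * c\<^sup>2 / 2" unfolding kc by (simp add: power2_eq_square)
  finally have e: "\<kappa> * ((1 - \<eta>) * c - c\<^sup>2 / 2) = (1 - \<eta>)\<^sup>2 / 2 * b\<^sup>2 - \<kappa> * c\<^sup>2 / 2" .
  have "\<kappa> * c\<^sup>2 \<le> 1 * c\<^sup>2" using assms by (intro mult_right_mono) auto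
  moreover have "0 \<le> c\<^sup>2" "0 \<le> \<eta>\<^sup>2 / 2 * b\<^sup>2" by auto
  moreover have "c\<^sup>2 = a\<^sup>2 * b\<^sup>2 * b\<^sup>2" by (simp add: c_def power2_eq_square)
  moreover have "b\<^sup>2 * ((1 + \<eta>) * v / 3 + 3 * (1 + \<eta>) * v\<^sup>2 + 3 / 2 * \<eta> + 17 * a\<^sup>2 * b\<^sup>2)
      = (1 + \<eta>) / 2 * b\<^sup>2 * (1 + 6 * v\<^sup>2 + 2 / 3 * v) - (1 - \<eta>)\<^sup>2 / 2 * b\<^sup>2 + \<eta>\<^sup>2 / 2 * b\<^sup>2 + 17 * (a\<^sup>2 * b\<^sup>2 * b\<^sup>2)"
    by (simp add: power2_eq_square algebra_simps add_divide_distrib diff_divide_distrib)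
  ultimately show ?thesis unfolding c_def[symmetric] e by linarith
qed

text \<open>The order of choices matters: \<open>C\<close> and \<open>p\<close> determine
  \<open>\<mu>\<close> and \<open>\<rho>\<close>, these determine \<open>\<eta>\<close>, and
  \<open>\<eta>\<close> determines \<open>\<kappa>\<close>, \<open>a\<close> and
  \<open>\<tau>\<close>. Since \<open>a\<close> may be huge, \<open>t\<close> is chosen after it,
  and the dimension then follows from \<open>t / \<rho>\<close>.\<close>

theorem theorem1p1:
  fixes C p :: real
  assumes "C > 1" and "0 < p" and "p < 1/2" and "C = ln p / ln (1 - p)"
  shows "\<exists>\<epsilon>>0. \<forall>\<^sub>F l in sequentially.
           real (ramsey_number l (nat \<lfloor>C * real l\<rfloor>)) \<ge> (p powr (-1/2) + \<epsilon>) ^ l"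
proof -
  define r where "r = p / (1 - p)"
  have r: "0 < r" "r < 1" using assms(1-3) by (auto simp: r_def)
  have Cr2: "C * r\<^sup>2 < 1"
  proof -
    have "C * p\<^sup>2 < (1 - p)\<^sup>2" using ratio_times_square_less[OF assms(2,3)] unfolding assms(4) .
    then have "C * p\<^sup>2 / (1 - p)\<^sup>2 < 1" using assms(3) by (subst divide_less_eq_1_pos) auto
    then show ?thesis by (simp add: r_def power_divide)
  qed
  \<comment> \<open>A quarter of the slack: \<open>C * r\<^sup>2\<close> is
    \<open>1 - 4 * \<mu>\<close>. Replacing \<open>p\<close> by \<open>p'\<close> may raise it to
    \<open>1 - 2 * \<mu>\<close>, still below the fraction \<open>1 - \<mu>\<close> of the red gain
    that is spent on raising \<open>p\<close>.\<close>
  define \<mu> where "\<mu> = (1 - C * r\<^sup>2) / 4"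
  have "0 < C * r\<^sup>2" using assms(1-3) r by simp
  then have \<mu>: "0 < \<mu>" "\<mu> < 1/4" using Cr2 by (auto simp: \<mu>_def)
  have \<mu>r: "0 < \<mu> * r" "\<mu> * r \<le> \<mu>" using \<mu> r by auto
  \<comment> \<open>\<open>\<rho>\<close> is the limit of \<open>t * l / s\<close>. Gains are linear
    and errors quadratic in it, and the factor \<open>60 * C\<^sup>2\<close> makes the blue errors
    small against the slack \<open>\<mu> * r\<close>.\<close>
  define \<rho> where "\<rho> = \<mu> * r / (60 * C\<^sup>2)"
  have C2: "1 < C\<^sup>2" using assms(1) by (simp add: one_less_power)
  have \<rho>0: "0 < \<rho>" unfolding \<rho>_def using \<mu>r(1) C2 by (intro divide_pos_pos) auto
  have C2\<rho>: "C\<^sup>2 * \<rho> = \<mu> * r / 60" using assms(1) by (simp add: \<rho>_def)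
  have C\<rho>: "C * \<rho> \<le> \<mu> * r / 60"
  proof -
    have "C * \<rho> \<le> C\<^sup>2 * \<rho>" using assms(1) \<rho>0 by (intro mult_right_mono) (auto simp: power2_eq_square)
    then show ?thesis using C2\<rho> by simp
  qed
  have "1 * \<rho> \<le> C * \<rho>" using assms(1) \<rho>0 by (intro mult_right_mono) auto
  then have \<rho>: "\<rho> \<le> C * \<rho>" "C * \<rho> \<le> 1/240" "\<rho> \<le> 1/240" "\<rho> \<le> \<mu> / 60" using C\<rho> \<mu>r \<mu> by linarith+
  \<comment> \<open>The second-order mismatch caused by \<open>\<eta>\<close> thus counts among the
    errors quadratic in \<open>\<rho>\<close>.\<close>
  define \<eta> where "\<eta> = \<rho>\<^sup>2"
  have \<eta>: "0 < \<eta>" "\<eta> < 1" using \<rho>0 \<rho> by (auto simp: \<eta>_def power_less_one_iff)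
  obtain \<kappa> a \<tau> where \<kappa>: "0 < \<kappa>" "\<kappa> < 1" and a: "0 < a" and \<kappa>a: "\<kappa> * a = (1 - \<eta>) / 2" and \<tau>: "0 < \<tau>"
    and dom: "\<And>u y. y \<le> \<eta> / 6 * u\<^sup>2 \<Longrightarrow> y \<le> \<tau> * \<bar>u\<bar> \<Longrightarrow>
       max 0 (1 + u) * exp y \<le> exp u * (\<kappa> * exp (- a * u\<^sup>2) + (1 - \<kappa>))"
    using soft_edge_domination[OF \<eta>] by metis
  \<comment> \<open>The red triangle gain is \<open>t\<^sup>2 * \<rho> / 6\<close> per
    \<open>l\<^sup>2\<close>, and the fraction \<open>1 - \<mu>\<close> of it is spent on the edge
    probability: \<open>P t\<close> raises \<open>ln p / 2\<close> by
    \<open>\<nu> t\<close>.\<close>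
  define \<nu> where "\<nu> = (\<lambda>t::real. t\<^sup>2 * \<rho> * (1 - \<mu>) / 6)"
  define P where "P = (\<lambda>t. p * exp (2 * \<nu> t))"
  have P: "(P \<longlongrightarrow> p) (at_right 0)"
  proof -
    have "(P \<longlongrightarrow> p * exp (2 * (0\<^sup>2 * \<rho> * (1 - \<mu>) / 6))) (at_right 0)"
      unfolding P_def \<nu>_def by (intro tendsto_intros) simp
    then show ?thesis by simp
  qed
  have "\<forall>\<^sub>F t in at_right 0. P t < 1/2" using assms(1-3) by (intro order_tendstoD[OF P]) auto
  moreover have "\<forall>\<^sub>F t in at_right 0. C * (P t / (1 - P t)) ^ 3 < r * (1 - 2 * \<mu>)"
  proof -
    have "((\<lambda>t. C * (P t / (1 - P t)) ^ 3) \<longlongrightarrow> C * r ^ 3) (at_right 0)"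
      unfolding r_def using assms(1-3) by (intro tendsto_intros P) auto
    moreover have "C * r ^ 3 < r * (1 - 2 * \<mu>)"
    proof -
      have "C * r\<^sup>2 < 1 - 2 * \<mu>" 
      proof -
        have "x < 1 - 2 * ((1 - x) / 4)" if "x < 1" for x :: real using that by (simp add: field_simps)
        from this[OF Cr2] show ?thesis by (simp only: \<mu>_def)
      qed
      then have "r * (C * r\<^sup>2) < r * (1 - 2 * \<mu>)" using r by (intro mult_strict_left_mono) auto
      then show ?thesis by (simp add: power3_eq_cube power2_eq_square mult_ac)
    qed
    ultimately show ?thesis by (rule order_tendstoD)
  qed
  moreover have "\<forall>\<^sub>F t in at_right 0. 17 * a\<^sup>2 * t\<^sup>2 < \<rho>\<^sup>2"
  proof -
    have "((\<lambda>t. 17 * a\<^sup>2 * t\<^sup>2) \<longlongrightarrow> 17 * a\<^sup>2 * 0\<^sup>2) (at_right 0)" by (intro tendsto_intros)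
    then show ?thesis using \<rho>0 by (intro order_tendstoD) auto
  qed
  moreover have "\<forall>\<^sub>F t in at_right 0. 16 * a\<^sup>2 * t\<^sup>2 * (C * \<rho>) < \<tau>"
  proof -
    have "((\<lambda>t. 16 * a\<^sup>2 * t\<^sup>2 * (C * \<rho>)) \<longlongrightarrow> 16 * a\<^sup>2 * 0\<^sup>2 * (C * \<rho>)) (at_right 0)" by (intro tendsto_intros)
    then show ?thesis using \<tau> by (intro order_tendstoD) auto
  qed
  moreover have "\<forall>\<^sub>F t::real in at_right 0. 0 < t" by (rule eventually_at_right_less)
  ultimately have "\<forall>\<^sub>F t in at_right 0. P t < 1/2 \<and> C * (P t / (1 - P t)) ^ 3 < r * (1 - 2 * \<mu>)
      \<and> 17 * a\<^sup>2 * t\<^sup>2 < \<rho>\<^sup>2 \<and> 16 * a\<^sup>2 * t\<^sup>2 * (C * \<rho>) < \<tau> \<and> 0 < t"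
    by eventually_elim auto
  \<comment> \<open>The four smallness conditions keep \<open>p'\<close> below \<open>1/2\<close>,
    preserve the slack at \<open>p'\<close>, make the error with \<open>17 * a\<^sup>2\<close>
    quadratic in \<open>\<rho>\<close>, and leave room for \<open>y\<close> in the edge
    domination.\<close>
  then obtain t where t: "P t < 1/2" "C * (P t / (1 - P t)) ^ 3 < r * (1 - 2 * \<mu>)"
      "17 * a\<^sup>2 * t\<^sup>2 < \<rho>\<^sup>2" "16 * a\<^sup>2 * t\<^sup>2 * (C * \<rho>) < \<tau>" "0 < t"
    using eventually_happens'[OF trivial_limit_at_right_real] by blast
  define p' r' where "p' = P t" and "r' = p' / (1 - p')"
  have p': "0 < p'" "p' < 1/2" using t assms(1-3) by (auto simp: p'_def P_def)
  have r': "0 < r'" "r' < 1" using p' by (auto simp: r'_def)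
  have Cr': "C * r' ^ 3 \<le> r * (1 - 2 * \<mu>)" using t(2) by (simp add: r'_def p'_def)
  define N where "N = \<nu> t"
  have N: "N = t\<^sup>2 * \<rho> * (1 - \<mu>) / 6" by (simp add: N_def \<nu>_def)
  have N0: "0 \<le> N" using \<rho>0 \<mu> unfolding N by simp
  have ln_p': "ln p' = ln p + 2 * N" using assms(1-3) by (simp add: p'_def P_def N_def ln_mult)
  have ln_q': "ln (1 - p') \<le> ln (1 - p) - 2 * N * r"
  proof -
    have "p * (1 + 2 * N) \<le> p'"
      unfolding p'_def P_def N_def[symmetric] using assms(1-3) by (intro mult_left_mono) auto
    then have "(1 - p') / (1 - p) \<le> (1 - p - 2 * N * p) / (1 - p)"
      using assms(1-3) by (intro divide_right_mono) (auto simp: algebra_simps)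
    also have "\<dots> = 1 - 2 * N * r" using assms(1-3) by (simp add: r_def diff_divide_distrib)
    finally have "(1 - p') / (1 - p) - 1 \<le> - (2 * N * r)" by simp
    moreover have "ln ((1 - p') / (1 - p)) \<le> (1 - p') / (1 - p) - 1"
      using assms(1-3) p' by (intro ln_le_minus_one) auto
    moreover have "ln ((1 - p') / (1 - p)) = ln (1 - p') - ln (1 - p)" using assms(1-3) p' by (simp add: ln_div)
    ultimately show ?thesis by simp
  qed
  have Clnq: "C * ln (1 - p) = ln p" using assms by simp
  \<comment> \<open>Before quadratic errors, red keeps a surplus
    \<open>t\<^sup>2 * \<rho> * \<mu> / 6\<close> and blue at least \<open>r\<close> times that for
    each unit of \<open>C\<close>. A quarter of the smaller one goes into the base.\<close>
  define \<epsilon>' where "\<epsilon>' = t\<^sup>2 * \<rho> * (\<mu> * r) / 24"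
  have T0: "0 < t\<^sup>2 * \<rho>" using t \<rho>0 by simp
  have \<epsilon>': "0 < \<epsilon>'" using T0 \<mu>r by (simp add: \<epsilon>'_def)
  define L where "L = - ln p / 2 + \<epsilon>'"
  define \<epsilon> where "\<epsilon> = exp L - p powr (-1/2)"
  have "p powr (-1/2) = exp (- ln p / 2)" using assms(1-3) by (simp add: powr_def)
  then have \<epsilon>: "0 < \<epsilon>" "p powr (-1/2) + \<epsilon> = exp L" using \<epsilon>' by (auto simp: \<epsilon>_def L_def)
  define \<sigma> where "\<sigma> = t / \<rho>"
  have \<sigma>: "0 < \<sigma>" using t \<rho>0 by (simp add: \<sigma>_def)
  define d where "d = (\<lambda>l. nat \<lceil>(\<sigma> * real l)\<^sup>2\<rceil>)"
  define s where "s = (\<lambda>l. sqrt (real (d l)))"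
  define k where "k = (\<lambda>l. nat \<lfloor>C * real l\<rfloor>)"
  have s_lim: "(\<lambda>l. s l / real l) \<longlonglongrightarrow> \<sigma>"
    unfolding s_def d_def by (rule tendsto_sqrt_nat_ceiling_over[OF \<sigma>])
  have k_lim: "(\<lambda>l. real (k l) / real l) \<longlonglongrightarrow> C"
    unfolding k_def using assms(1-3) by (intro tendsto_nat_floor_over) auto
  have l_lim: "(\<lambda>l. real l / real l) \<longlonglongrightarrow> 1"
    by (rule Lim_transform_eventually[OF tendsto_const])
      (use eventually_gt_at_top[of 0] in eventually_elim, simp)
  define bb where "bb = r' * t"
  have bb: "0 < bb" "bb\<^sup>2 \<le> t\<^sup>2" using r' t by (auto simp: bb_def power_mult_distrib mult_left_le_one_le power_le_one)
  have v_red: "(- t) * 1 / \<sigma> = - \<rho>" using t by (simp add: \<sigma>_def)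
  have v_blue: "bb * C / \<sigma> = r' * (C * \<rho>)" using t by (simp add: \<sigma>_def bb_def)
  have \<eta>\<rho>: "\<eta> * \<rho> \<le> \<rho>\<^sup>2" "\<eta> * \<rho>\<^sup>2 \<le> \<rho>\<^sup>2"
    using \<eta> \<rho>0 \<rho> by (auto simp: \<eta>_def mult_left_le)

  have red_neg: "L * 1 + 1\<^sup>2 / 2 * ln p' + 1\<^sup>2 / 2 * ((1 + \<eta>) / 2 * (- t)\<^sup>2 * (1 + 6 * ((- t) * 1 / \<sigma>)\<^sup>2 + 2 / 3 * ((- t) * 1 / \<sigma>))
          + 16 * (a * (- t)\<^sup>2)\<^sup>2 - \<kappa> * ((1 - \<eta>) * (a * (- t)\<^sup>2) - (a * (- t)\<^sup>2)\<^sup>2 / 2)) < 0"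
  proof -
    have "(1 + \<eta>) / 2 * (- t)\<^sup>2 * (1 + 6 * (- \<rho>)\<^sup>2 + 2 / 3 * (- \<rho>))
          + 16 * (a * (- t)\<^sup>2)\<^sup>2 - \<kappa> * ((1 - \<eta>) * (a * (- t)\<^sup>2) - (a * (- t)\<^sup>2)\<^sup>2 / 2)
        \<le> (- t)\<^sup>2 * ((1 + \<eta>) * (- \<rho>) / 3 + 3 * (1 + \<eta>) * (- \<rho>)\<^sup>2 + 3 / 2 * \<eta> + 17 * a\<^sup>2 * (- t)\<^sup>2)"
      by (rule clique_exponent_limit_le[OF \<kappa>a \<kappa>(2)])
    also have "\<dots> \<le> (- t)\<^sup>2 * (- \<rho> / 3 + 17 / 2 * \<rho>\<^sup>2)"
    proof (intro mult_left_mono)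
      have "(1 + \<eta>) * (- \<rho>) / 3 \<le> - \<rho> / 3" using \<eta> \<rho>0 by (simp add: algebra_simps)
      moreover have "3 * (1 + \<eta>) * (- \<rho>)\<^sup>2 \<le> 6 * \<rho>\<^sup>2" using \<eta>\<rho>(2) by (simp add: algebra_simps)
      ultimately show "(1 + \<eta>) * (- \<rho>) / 3 + 3 * (1 + \<eta>) * (- \<rho>)\<^sup>2 + 3 / 2 * \<eta> + 17 * a\<^sup>2 * (- t)\<^sup>2 \<le> - \<rho> / 3 + 17 / 2 * \<rho>\<^sup>2"
        using t(3) by (simp add: \<eta>_def)
    qed simp
    also have "\<dots> = t\<^sup>2 * \<rho> * (- 1 / 3 + 17 / 2 * \<rho>)" by (simp add: power2_eq_square algebra_simps)
    finally have le: "(1 + \<eta>) / 2 * (- t)\<^sup>2 * (1 + 6 * (- \<rho>)\<^sup>2 + 2 / 3 * (- \<rho>))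
          + 16 * (a * (- t)\<^sup>2)\<^sup>2 - \<kappa> * ((1 - \<eta>) * (a * (- t)\<^sup>2) - (a * (- t)\<^sup>2)\<^sup>2 / 2)
        \<le> t\<^sup>2 * \<rho> * (- 1 / 3 + 17 / 2 * \<rho>)" .
    \<comment> \<open>In units of \<open>t\<^sup>2 * \<rho>\<close> these are the larger base, the
      raised \<open>p\<close>, the triangle gain and the quadratic errors. The middle two leave
      \<open>- \<mu> / 6\<close>, which outweighs the rest.\<close>
    have "\<mu> * r / 24 + (1 - \<mu>) / 6 - 1 / 6 + 17 / 4 * \<rho> < 0" 
      using \<mu>r \<mu> \<rho>(4) unfolding diff_divide_distrib by linarith
    then have "t\<^sup>2 * \<rho> * (\<mu> * r / 24 + (1 - \<mu>) / 6 - 1 / 6 + 17 / 4 * \<rho>) < 0" using T0 by (rule mult_pos_neg[rotated])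
    moreover have "t\<^sup>2 * \<rho> * (\<mu> * r / 24 + (1 - \<mu>) / 6 - 1 / 6 + 17 / 4 * \<rho>)
        = \<epsilon>' + N + 1 / 2 * (t\<^sup>2 * \<rho> * (- 1 / 3 + 17 / 2 * \<rho>))"
      unfolding \<epsilon>'_def N by (simp add: algebra_simps add_divide_distrib diff_divide_distrib)
    ultimately have "\<epsilon>' + N + 1 / 2 * (t\<^sup>2 * \<rho> * (- 1 / 3 + 17 / 2 * \<rho>)) < 0" by simp
    moreover have "L * 1 + 1\<^sup>2 / 2 * ln p' = \<epsilon>' + N" unfolding L_def ln_p' by (simp add: algebra_simps)
    ultimately have "L * 1 + 1\<^sup>2 / 2 * ln p' + 1 / 2 * (t\<^sup>2 * \<rho> * (- 1 / 3 + 17 / 2 * \<rho>)) < 0" by linarith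
    moreover define Br where "Br = (1 + \<eta>) / 2 * (- t)\<^sup>2 * (1 + 6 * (- \<rho>)\<^sup>2 + 2 / 3 * (- \<rho>))
          + 16 * (a * (- t)\<^sup>2)\<^sup>2 - \<kappa> * ((1 - \<eta>) * (a * (- t)\<^sup>2) - (a * (- t)\<^sup>2)\<^sup>2 / 2)"
    moreover have "1 / 2 * Br \<le> 1 / 2 * (t\<^sup>2 * \<rho> * (- 1 / 3 + 17 / 2 * \<rho>))"
      unfolding Br_def using le by (rule mult_left_mono) simp
    ultimately have "L * 1 + 1\<^sup>2 / 2 * ln p' + 1 / 2 * Br < 0" by (meson add_left_mono le_less_trans)
    then show ?thesis unfolding v_red Br_def[symmetric] by simp
  qed

  have blue_neg: "L * C + C\<^sup>2 / 2 * ln (1 - p') + C\<^sup>2 / 2 * ((1 + \<eta>) / 2 * bb\<^sup>2 * (1 + 6 * (bb * C / \<sigma>)\<^sup>2 + 2 / 3 * (bb * C / \<sigma>))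
          + 16 * (a * bb\<^sup>2)\<^sup>2 - \<kappa> * ((1 - \<eta>) * (a * bb\<^sup>2) - (a * bb\<^sup>2)\<^sup>2 / 2)) < 0"
  proof -
    define v where "v = r' * (C * \<rho>)"
    have v: "0 \<le> v" "v \<le> C * \<rho>" "v \<le> 1" using r' \<rho> \<rho>0 assms(1)
      by (auto simp: v_def mult_left_le_one_le intro: order_trans[OF mult_left_le_one_le])
    have "(1 + \<eta>) / 2 * bb\<^sup>2 * (1 + 6 * v\<^sup>2 + 2 / 3 * v)
          + 16 * (a * bb\<^sup>2)\<^sup>2 - \<kappa> * ((1 - \<eta>) * (a * bb\<^sup>2) - (a * bb\<^sup>2)\<^sup>2 / 2)
        \<le> bb\<^sup>2 * ((1 + \<eta>) * v / 3 + 3 * (1 + \<eta>) * v\<^sup>2 + 3 / 2 * \<eta> + 17 * a\<^sup>2 * bb\<^sup>2)"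
      by (rule clique_exponent_limit_le[OF \<kappa>a \<kappa>(2)])
    also have "\<dots> \<le> bb\<^sup>2 * (v / 3 + 9 * C\<^sup>2 * \<rho>\<^sup>2)"
    proof (intro mult_left_mono)
      have "\<eta> * v \<le> \<eta> * 1" using v \<eta> by (intro mult_left_mono) auto
      then have 1: "(1 + \<eta>) * v / 3 \<le> v / 3 + \<rho>\<^sup>2 / 3" by (simp add: \<eta>_def algebra_simps)
      have "v\<^sup>2 \<le> (C * \<rho>)\<^sup>2" using v by (intro power_mono) auto
      moreover have "(1 + \<eta>) * v\<^sup>2 \<le> 2 * v\<^sup>2" using \<eta> by (intro mult_right_mono) auto
      ultimately have "3 * ((1 + \<eta>) * v\<^sup>2) \<le> 6 * (C * \<rho>)\<^sup>2" by linarith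
      then have 2: "3 * (1 + \<eta>) * v\<^sup>2 \<le> 6 * (C\<^sup>2 * \<rho>\<^sup>2)" by (simp only: power_mult_distrib mult.assoc)
      have "17 * a\<^sup>2 * bb\<^sup>2 \<le> 17 * a\<^sup>2 * t\<^sup>2" using bb by (intro mult_left_mono) auto
      then have 3: "17 * a\<^sup>2 * bb\<^sup>2 \<le> \<rho>\<^sup>2" using t(3) by simp
      have 4: "1 * \<rho>\<^sup>2 \<le> C\<^sup>2 * \<rho>\<^sup>2" using C2 by (intro mult_right_mono) auto
      have 5: "0 \<le> \<rho>\<^sup>2" by simp
      show "(1 + \<eta>) * v / 3 + 3 * (1 + \<eta>) * v\<^sup>2 + 3 / 2 * \<eta> + 17 * a\<^sup>2 * bb\<^sup>2 \<le> v / 3 + 9 * C\<^sup>2 * \<rho>\<^sup>2"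
        using 1 2 3 4 5 unfolding \<eta>_def by linarith
    qed simp
    finally have le: "(1 + \<eta>) / 2 * bb\<^sup>2 * (1 + 6 * v\<^sup>2 + 2 / 3 * v)
          + 16 * (a * bb\<^sup>2)\<^sup>2 - \<kappa> * ((1 - \<eta>) * (a * bb\<^sup>2) - (a * bb\<^sup>2)\<^sup>2 / 2)
        \<le> bb\<^sup>2 * (v / 3 + 9 * C\<^sup>2 * \<rho>\<^sup>2)" .
    have "C / 2 * (bb\<^sup>2 * (v / 3 + 9 * C\<^sup>2 * \<rho>\<^sup>2)) = C * (t\<^sup>2 * \<rho>) * (C * r' ^ 3 / 6 + 9 / 2 * (C\<^sup>2 * \<rho>) * r'\<^sup>2)"
      by (simp add: bb_def v_def power2_eq_square power3_eq_cube algebra_simps)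
    also have "\<dots> \<le> C * (t\<^sup>2 * \<rho>) * (r * (1 - 2 * \<mu>) / 6 + 9 / 2 * (\<mu> * r / 60))"
    proof (intro mult_left_mono add_mono)
      show "C * r' ^ 3 / 6 \<le> r * (1 - 2 * \<mu>) / 6" using Cr' by simp
      have "9 / 2 * (\<mu> * r / 60) * r'\<^sup>2 \<le> 9 / 2 * (\<mu> * r / 60) * 1"
        using \<mu>r r' by (intro mult_left_mono) (auto simp: power_le_one)
      then show "9 / 2 * (C\<^sup>2 * \<rho>) * r'\<^sup>2 \<le> 9 / 2 * (\<mu> * r / 60)" unfolding C2\<rho> by simp
      show "0 \<le> C * (t\<^sup>2 * \<rho>)" using T0 assms(1) by simp
    qed
    finally have le2: "C / 2 * (bb\<^sup>2 * (v / 3 + 9 * C\<^sup>2 * \<rho>\<^sup>2)) \<le> C * (t\<^sup>2 * \<rho>) * (r * (1 - 2 * \<mu>) / 6 + 9 / 2 * (\<mu> * r / 60))" .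
    have "C / 2 * ln (1 - p') \<le> C / 2 * (ln (1 - p) - 2 * N * r)"
      using ln_q' assms(1) by (intro mult_left_mono) auto
    also have "\<dots> = ln p / 2 - C * N * r" using Clnq by (simp add: algebra_simps)
    finally have le3: "C / 2 * ln (1 - p') \<le> ln p / 2 - C * N * r" .
    \<comment> \<open>Here \<open>1 / 24\<close> stems from \<open>\<epsilon>'\<close>, and
      \<open>- 11 / 120\<close> is the margin \<open>- 1 / 6\<close> between
      \<open>1 - 2 * \<mu>\<close> and \<open>1 - \<mu>\<close> plus the quadratic error
      \<open>9 / 2 * (1 / 60)\<close>.\<close>
    have "(1 / 24 - 11 / 120 * C) < 0" using assms(1) by simp
    then have "t\<^sup>2 * \<rho> * (\<mu> * r) * (1 / 24 - 11 / 120 * C) < 0"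
      by (rule mult_pos_neg[OF mult_pos_pos[OF T0 \<mu>r(1)]])
    moreover have "t\<^sup>2 * \<rho> * (\<mu> * r) * (1 / 24 - 11 / 120 * C)
        = \<epsilon>' - C * N * r + C * (t\<^sup>2 * \<rho>) * (r * (1 - 2 * \<mu>) / 6 + 9 / 2 * (\<mu> * r / 60))"
      unfolding \<epsilon>'_def N by (simp add: algebra_simps add_divide_distrib diff_divide_distrib)
    ultimately have neg: "L + C / 2 * ln (1 - p') + C / 2 * (bb\<^sup>2 * (v / 3 + 9 * C\<^sup>2 * \<rho>\<^sup>2)) < 0"
      using le2 le3 unfolding L_def by linarith
    define Br where "Br = (1 + \<eta>) / 2 * bb\<^sup>2 * (1 + 6 * v\<^sup>2 + 2 / 3 * v)
          + 16 * (a * bb\<^sup>2)\<^sup>2 - \<kappa> * ((1 - \<eta>) * (a * bb\<^sup>2) - (a * bb\<^sup>2)\<^sup>2 / 2)"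
    have "C / 2 * Br \<le> C / 2 * (bb\<^sup>2 * (v / 3 + 9 * C\<^sup>2 * \<rho>\<^sup>2))"
      using le assms(1) unfolding Br_def by (intro mult_left_mono) auto
    then have "L + C / 2 * ln (1 - p') + C / 2 * Br < 0" using neg by linarith
    then have "C * (L + C / 2 * ln (1 - p') + C / 2 * Br) < 0" using assms(1) by (intro mult_pos_neg) auto
    moreover have "C * (L + C / 2 * ln (1 - p') + C / 2 * Br) = L * C + C\<^sup>2 / 2 * ln (1 - p') + C\<^sup>2 / 2 * Br"
      by (simp add: power2_eq_square algebra_simps)
    ultimately show ?thesis unfolding v_blue v_def[symmetric] Br_def by simp
  qed

  define XR where "XR = (\<lambda>l. L * real l * real l + real l * (real l - 1) / 2 * ln p' + real l * ln 2
      + clique_exponent \<kappa> \<eta> (a * (- t)\<^sup>2) (- t) (s l) (real l))"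
  define XB where "XB = (\<lambda>l. L * real l * real (k l) + real (k l) * (real (k l) - 1) / 2 * ln (1 - p') + real (k l) * ln 2
      + clique_exponent \<kappa> \<eta> (a * bb\<^sup>2) bb (s l) (real (k l)))"
  have "\<forall>\<^sub>F l in sequentially. exp (XR l) < 1/2"
    by (rule eventually_exp_less_half[OF _ red_neg])
      (unfold XR_def, rule clique_exponent_limit[OF l_lim s_lim \<sigma>])
  moreover have "\<forall>\<^sub>F l in sequentially. exp (XB l) < 1/2"
    by (rule eventually_exp_less_half[OF _ blue_neg])
      (unfold XB_def, rule clique_exponent_limit[OF k_lim s_lim \<sigma>])
  moreover have "\<forall>\<^sub>F l in sequentially. \<bar>- t\<bar> * real l / s l \<le> 1/4 \<and> 8 * (a * (- t)\<^sup>2)\<^sup>2 * real l / (s l)\<^sup>2 \<le> a * (- t)\<^sup>2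
      \<and> 8 * (a * (- t)\<^sup>2)\<^sup>2 * real l / (s l)\<^sup>2 \<le> \<eta> / 6 * (- t)\<^sup>2 \<and> 16 * (a * (- t)\<^sup>2)\<^sup>2 * real l / s l \<le> \<tau> * \<bar>- t\<bar>"
  proof (rule eventually_soft_clique_conditions[OF l_lim s_lim \<sigma>])
    show "\<bar>- t\<bar> * 1 / \<sigma> < 1/4" using t \<rho> by (simp add: \<sigma>_def)
    have "16 * (a * (- t)\<^sup>2)\<^sup>2 * 1 / \<sigma> = 16 * a\<^sup>2 * t\<^sup>2 * \<rho> * t"
      using t by (simp add: \<sigma>_def power2_eq_square)
    also have "\<dots> < \<tau> * t"
    proof (intro mult_strict_right_mono)
      have "16 * a\<^sup>2 * t\<^sup>2 * \<rho> \<le> 16 * a\<^sup>2 * t\<^sup>2 * (C * \<rho>)" using \<rho> by (intro mult_left_mono) auto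
      then show "16 * a\<^sup>2 * t\<^sup>2 * \<rho> < \<tau>" using t(4) by simp
    qed (use t in simp)
    finally show "16 * (a * (- t)\<^sup>2)\<^sup>2 * 1 / \<sigma> < \<tau> * \<bar>- t\<bar>" using t by simp
  qed (use a t \<eta> in auto)
  moreover have "\<forall>\<^sub>F l in sequentially. \<bar>bb\<bar> * real (k l) / s l \<le> 1/4 \<and> 8 * (a * bb\<^sup>2)\<^sup>2 * real (k l) / (s l)\<^sup>2 \<le> a * bb\<^sup>2
      \<and> 8 * (a * bb\<^sup>2)\<^sup>2 * real (k l) / (s l)\<^sup>2 \<le> \<eta> / 6 * bb\<^sup>2 \<and> 16 * (a * bb\<^sup>2)\<^sup>2 * real (k l) / s l \<le> \<tau> * \<bar>bb\<bar>"
  proof (rule eventually_soft_clique_conditions[OF k_lim s_lim \<sigma>])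
    have "r' * (C * \<rho>) \<le> 1 * (C * \<rho>)" using r' \<rho> \<rho>0 by (intro mult_right_mono) auto
    then have v: "bb * C / \<sigma> \<le> C * \<rho>" unfolding v_blue by simp
    then show "\<bar>bb\<bar> * C / \<sigma> < 1/4" using bb \<rho> by simp
    have "16 * (a * bb\<^sup>2)\<^sup>2 * C / \<sigma> = 16 * a\<^sup>2 * bb\<^sup>2 * (bb * C / \<sigma>) * bb"
      by (simp add: power2_eq_square)
    also have "\<dots> < \<tau> * bb"
    proof (intro mult_strict_right_mono)
      have "16 * a\<^sup>2 * bb\<^sup>2 * (bb * C / \<sigma>) \<le> 16 * a\<^sup>2 * t\<^sup>2 * (C * \<rho>)"
        using v bb \<sigma> assms(1) by (intro mult_mono) auto
      then show "16 * a\<^sup>2 * bb\<^sup>2 * (bb * C / \<sigma>) < \<tau>" using t(4) by simp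
    qed (use bb in simp)
    finally show "16 * (a * bb\<^sup>2)\<^sup>2 * C / \<sigma> < \<tau> * \<bar>bb\<bar>" using bb by simp
  qed (use a bb \<eta> in auto)
  moreover have "\<forall>\<^sub>F l in sequentially. 4 / (\<eta> * \<sigma>) < real l"
    by (rule eventually_compose_filterlim[OF eventually_gt_at_top filterlim_real_sequentially])
  ultimately have "\<forall>\<^sub>F l in sequentially. real (ramsey_number l (nat \<lfloor>C * real l\<rfloor>)) \<ge> (p powr (-1/2) + \<epsilon>) ^ l"
  proof eventually_elim
    case (elim l)
    have d16: "16 \<le> \<eta>\<^sup>2 * real (d l)"
    proof -
      have "4 \<le> \<eta> * (\<sigma> * l)" using elim(5) \<eta> \<sigma> by (simp add: divide_less_eq mult_ac)
      then have "4\<^sup>2 \<le> (\<eta> * (\<sigma> * l))\<^sup>2" by (intro power_mono) auto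
      also have "\<dots> = \<eta>\<^sup>2 * (\<sigma> * l)\<^sup>2" by (simp add: power_mult_distrib)
      also have "\<dots> \<le> \<eta>\<^sup>2 * real (d l)" unfolding d_def by (intro mult_left_mono zero_le_power2) linarith
      finally show ?thesis by simp
    qed
    interpret latent_kernel "shell_measure (d l) \<eta>" "\<lambda>x y. ip (d l) x y / sqrt (d l)" "sqrt (d l)" \<eta>
      by (rule latent_kernel_shell) (use \<eta> d16 in auto)
    \<comment> \<open>Rounding down loses nothing: that \<open>n\<close> fails gives a Ramsey number
      of at least \<open>n + 1\<close>, which exceeds \<open>exp (L * l)\<close>.\<close>
    define n where "n = nat \<lfloor>exp (L * real l)\<rfloor>"
    have n: "real n \<le> exp (L * real l)" "exp (L * real l) < real n + 1"
      unfolding n_def by (simp add: of_nat_nat) linarith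
    have npow: "real n ^ m \<le> exp (L * real l * real m)" for m
    proof -
      have "real n ^ m \<le> exp (L * real l) ^ m" using n by (intro power_mono) auto
      then show ?thesis by (simp add: exp_of_nat2_mult)
    qed
    have two: "exp (real m * ln 2) = 2 ^ m" for m by (simp add: exp_of_nat_mult)
    have "\<not> ramsey_prop l (k l) n"
    proof (rule not_ramsey_prop_soft[where p = p' and t = t
          and A = "2 ^ l * exp (clique_exponent \<kappa> \<eta> (a * (- t)\<^sup>2) (- t) (sqrt (d l)) (real l))"
          and B = "2 ^ k l * exp (clique_exponent \<kappa> \<eta> (a * bb\<^sup>2) bb (sqrt (d l)) (real (k l)))"])
      fix S :: "nat set" assume S: "finite S" "card S = l"
      show "(\<integral>\<^sup>+x. ennreal (\<Prod>(i,j)\<in>pairs S. max 0 (1 + (- t) * (ip (d l) (x i) (x j) / sqrt (d l)))) \<partial>Pi\<^sub>M S (\<lambda>_. shell_measure (d l) \<eta>))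
          \<le> ennreal (2 ^ l * exp (clique_exponent \<kappa> \<eta> (a * (- t)\<^sup>2) (- t) (sqrt (d l)) (real l)))"
        by (rule soft_clique_integral_le[OF S \<kappa> a _ dom]) (use elim(3) t in \<open>auto simp: s_def\<close>)
    next
      fix S :: "nat set" assume S: "finite S" "card S = k l"
      have "p' * t / (1 - p') = bb" by (simp add: bb_def r'_def)
      moreover have "(\<integral>\<^sup>+x. ennreal (\<Prod>(i,j)\<in>pairs S. max 0 (1 + bb * (ip (d l) (x i) (x j) / sqrt (d l)))) \<partial>Pi\<^sub>M S (\<lambda>_. shell_measure (d l) \<eta>))
          \<le> ennreal (2 ^ k l * exp (clique_exponent \<kappa> \<eta> (a * bb\<^sup>2) bb (sqrt (d l)) (real (k l))))"
        by (rule soft_clique_integral_le[OF S \<kappa> a _ dom]) (use elim(4) bb in \<open>auto simp: s_def\<close>)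
      ultimately show "(\<integral>\<^sup>+x. ennreal (\<Prod>(i,j)\<in>pairs S. max 0 (1 + (p' * t / (1 - p')) * (ip (d l) (x i) (x j) / sqrt (d l)))) \<partial>Pi\<^sub>M S (\<lambda>_. shell_measure (d l) \<eta>))
          \<le> ennreal (2 ^ k l * exp (clique_exponent \<kappa> \<eta> (a * bb\<^sup>2) bb (sqrt (d l)) (real (k l))))"
        by simp
    next
      have "real n ^ l * (exp (l * (real l - 1) / 2 * ln p') * (2 ^ l * exp (clique_exponent \<kappa> \<eta> (a * (- t)\<^sup>2) (- t) (sqrt (d l)) (real l))))
          \<le> exp (L * real l * real l) * (exp (l * (real l - 1) / 2 * ln p') * (2 ^ l * exp (clique_exponent \<kappa> \<eta> (a * (- t)\<^sup>2) (- t) (sqrt (d l)) (real l))))"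
        by (intro mult_right_mono npow) auto
      also have "\<dots> = exp (XR l)"
        unfolding XR_def s_def exp_add two by (simp only: mult.assoc)
      finally have 1: "real n ^ l * (exp (l * (real l - 1) / 2 * ln p') * (2 ^ l * exp (clique_exponent \<kappa> \<eta> (a * (- t)\<^sup>2) (- t) (sqrt (d l)) (real l)))) \<le> exp (XR l)" .
      have "real n ^ k l * (exp (k l * (real (k l) - 1) / 2 * ln (1 - p')) * (2 ^ k l * exp (clique_exponent \<kappa> \<eta> (a * bb\<^sup>2) bb (sqrt (d l)) (real (k l)))))
          \<le> exp (L * real l * real (k l)) * (exp (k l * (real (k l) - 1) / 2 * ln (1 - p')) * (2 ^ k l * exp (clique_exponent \<kappa> \<eta> (a * bb\<^sup>2) bb (sqrt (d l)) (real (k l)))))"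
        by (intro mult_right_mono npow) auto
      also have "\<dots> = exp (XB l)"
        unfolding XB_def s_def exp_add two by (simp only: mult.assoc)
      finally have 2: "real n ^ k l * (exp (k l * (real (k l) - 1) / 2 * ln (1 - p')) * (2 ^ k l * exp (clique_exponent \<kappa> \<eta> (a * bb\<^sup>2) bb (sqrt (d l)) (real (k l))))) \<le> exp (XB l)" .
      show "real n ^ l * (exp (l * (real l - 1) / 2 * ln p') * (2 ^ l * exp (clique_exponent \<kappa> \<eta> (a * (- t)\<^sup>2) (- t) (sqrt (d l)) (real l))))
        + real n ^ k l * (exp (k l * (real (k l) - 1) / 2 * ln (1 - p')) * (2 ^ k l * exp (clique_exponent \<kappa> \<eta> (a * bb\<^sup>2) bb (sqrt (d l)) (real (k l))))) < 1"
        using 1 2 elim(1,2) by linarith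
    qed (use p' in auto)
    then have "n < ramsey_number l (k l)" by (rule less_ramsey_number)
    then have "real n + 1 \<le> real (ramsey_number l (k l))" by linarith
    moreover have "(p powr (-1/2) + \<epsilon>) ^ l = exp (L * real l)"
      unfolding \<epsilon>(2) by (simp add: exp_of_nat2_mult)
    ultimately show ?case using n by (simp add: k_def)
  qed
  then show ?thesis using \<epsilon>(1) by blast
qed

end
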